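(* Let $m\ge4$ and let $\boldsymbol u=(u_1,\dots,u_m)\in\mathbb{C}^m$ be a vector of distinct numbers, or equivalently such that $\mathcal{C}(\boldsymbol u)$ has distinct camera centers. Let $\widetilde{G}_m$ be the reduced Gröbner basis of the indeterminate collinear translation ideal $\widetilde{I}_{\mathcal{C}(\boldsymbol v)}\subseteq\mathbb{C}[\boldsymbol\ell,\boldsymbol v]$ with respect to $<$. Then the specialization $\phi_{\boldsymbol u}(\widetilde{G}_m)$ is a Gröbner basis (with respect to the GRevLex order on $\mathbb{C}[\boldsymbol\ell]$) for the ideal $\widetilde{I}_{\mathcal{C}(\boldsymbol u)}\subseteq\mathbb{C}[\boldsymbol\ell]$.
   Context: Let $\mathbb{C}[\boldsymbol\ell,\boldsymbol v]$ be the polynomial ring in the $4m$ variables $\ell_{i,j}$ ($1\le i\le3$, $1\le j\le m$) and $v_1,\dots,v_m$; $\ell_j=(\ell_{1,j},\ell_{2,j},\ell_{3,j})^T$. Let $C(v_i)=\begin{bmatrix}1&0&0&v_i\\0&1&0&0\\0&0&1&0\end{bmatrix}$, with center (kernel) $(v_i:0:0:-1)\in\mathbb{P}^3$. For $\sigma=\{i_1<i_2<i_3<i_4\}\subseteq[m]$ let $\Phi_{\mathcal{C}(\boldsymbol v),f,\sigma}(\ell)$ be the $10\times10$ matrix obtained by applying $\nu(x,y,z,w)=(x^2,y^2,z^2,w^2,xy,xz,xw,yz,yw,zw)^T$ to each of the ten column vectors $(1,0,0,0)$, $(0,0,0,1)$, $(1,0,0,1)$, $f_1=(0,1,0,0)$,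 $f_2=(0,0,1,0)$, $f_3=(0,1,1,0)$, and $e_i=(v_i,-\ell_{3,i},\ell_{2,i},-1)$ for $i=i_1,i_2,i_3,i_4$ (in this order). The indeterminate collinear translation ideal is $$\widetilde{I}_{\mathcal{C}(\boldsymbol v)}=\left\langle3\times3\text{-minors of }\begin{bmatrix}C(v_1)^T\ell_1&\cdots&C(v_m)^T\ell_m\end{bmatrix}\right\rangle+\sum_{\sigma\in\binom{[m]}{4}}\langle\det\Phi_{\mathcal{C}(\boldsymbol v),f,\sigma}(\ell)\rangle.$$ For $\boldsymbol u\in\mathbb{C}^m$, $\phi_{\boldsymbol u}:\mathbb{C}[\boldsymbol\ell,\boldsymbol v]\to\mathbb{C}[\boldsymbol\ell]$ is the ring homomorphism fixing $\boldsymbol\ell$ and evaluating $\boldsymbol v$ at $\boldsymbol u$; $\mathcal{C}(\boldsymbol u)=(C(u_1),\dots,C(u_m))$; and $\widetilde{I}_{\mathcal{C}(\boldsymbol u)}\subseteq\mathbb{C}[\boldsymbol\ell]$ is the ideal given by the same generators with $\boldsymbol v$ replaced by $\boldsymbol u$. The order $<$ is the product of the GRevLex orders on $\mathbb{C}[\boldsymbol\ell]$ and $\mathbb{C}[\boldsymbol v]$: $\boldsymbol\ell^{\alpha_1}\boldsymbol v^{\beta_1}<\boldsymbol\ell^{\alpha_2}\boldsymbol v^{\beta_2}$ if $\boldsymbol\ell^{\alpha_1}<_{\mathrm{GRevLex}}\boldsymbol\ell^{\alpha_2}$, or $\alpha_1=\alpha_2$ and $\boldsymbol v^{\beta_1}<_{\mathrm{GRevLex}}\boldsymbol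 v^{\beta_2}$, where $\alpha>_{\mathrm{GRevLex}}\beta$ iff $|\alpha|>|\beta|$, or $|\alpha|=|\beta|$ and the rightmost nonzero entry of $\alpha-\beta$ is negative; variables are listed in the order $\ell_{1,1},\dots,\ell_{1,m},\ell_{2,1},\dots,\ell_{2,m},\ell_{3,1},\dots,\ell_{3,m}$ and $v_1,\dots,v_m$. Reduced Gröbner basis: leading coefficients $1$, no leading term divides a term of another element. *)

theory Defs
  imports
    "HOL-Library.Poly_Mapping"
    "HOL-Algebra.Ideal"
    "Jordan_Normal_Form.DL_Submatrix"
    "Jordan_Normal_Form.Matrix_Kernel"
begin

section \<open>Polynomial rings\<close>

text \<open>
  All indices start at 0, as in the matrix library: \<^term>\<open>L i j\<close> stands for the variable
  $\ell_{i+1,j+1}$ and \<^term>\<open>V j\<close> for $v_{j+1}$.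
\<close>

datatype var = L nat nat | V nat

type_synonym monomial = "var \<Rightarrow>\<^sub>0 nat"
type_synonym mpoly = "monomial \<Rightarrow>\<^sub>0 complex"

definition Var :: "var \<Rightarrow> mpoly" where
  "Var x = Poly_Mapping.single (Poly_Mapping.single x 1) 1"

definition Const :: "complex \<Rightarrow> mpoly" where
  "Const c = Poly_Mapping.single 0 c"

text \<open>
  The type \<^typ>\<open>mpoly\<close> has infinitely many variables; the polynomial ring in the finitely many
  variables \<open>X\<close> is a subring of it. In particular the ring in the variables
  $\ell$ alone is a subring of the ring in $\ell$ and $v$.
\<close>

definition polys :: "var set \<Rightarrow> mpoly set" where
  "polys X = {p. \<forall>t\<in>Poly_Mapping.keys p. Poly_Mapping.keys t \<subseteq> X}"

definition poly_ring :: "var set \<Rightarrow> mpoly ring" where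
  "poly_ring X = \<lparr>carrier = polys X, monoid.mult = (*), one = 1, zero = 0, add = (+)\<rparr>"

lemma polys_plus: "p \<in> polys X \<Longrightarrow> q \<in> polys X \<Longrightarrow> p + q \<in> polys X"
  using keys_add[of p q] unfolding polys_def by blast

lemma polys_uminus: "p \<in> polys X \<Longrightarrow> - p \<in> polys X"
  unfolding polys_def by (simp add: in_keys_iff)

lemma polys_times: 
  assumes "p \<in> polys X" "q \<in> polys X"
  shows "p * q \<in> polys X"
proof -
  have "Poly_Mapping.keys t \<subseteq> X" if t: "t \<in> Poly_Mapping.keys (p * q)" for t
  proof -
    obtain a b where "t = a + b" "a \<in> Poly_Mapping.keys p" "b \<in> Poly_Mapping.keys q"
      using keys_mult[of p q] t by blast
    then show ?thesis
      using assms keys_add[of a b] unfolding polys_def by blast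
  qed
  then show ?thesis unfolding polys_def by blast
qed

lemma polys_zero: "0 \<in> polys X"
  by (simp add: polys_def)

lemma polys_one: "1 \<in> polys X"
  by (simp add: polys_def)

lemma cring_poly_ring: "cring (poly_ring X)"
proof (rule cringI)
  show "abelian_group (poly_ring X)"
  proof (rule abelian_groupI)
    fix p assume "p \<in> carrier (poly_ring X)"
    then show "\<exists>q\<in>carrier (poly_ring X). q \<oplus>\<^bsub>poly_ring X\<^esub> p = \<zero>\<^bsub>poly_ring X\<^esub>"
      by (intro bexI[of _ "- p"]) (simp_all add: poly_ring_def polys_uminus)
  qed (simp_all add: poly_ring_def polys_plus polys_zero ac_simps)
  show "comm_monoid (poly_ring X)"
    by (rule comm_monoidI) (simp_all add: poly_ring_def polys_times polys_one ac_simps)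
qed (simp add: poly_ring_def algebra_simps)


section \<open>Monomial orders and Groebner bases\<close>

text \<open>
  \<open>grevlex_less xs a b\<close> compares the exponent vectors of \<open>a\<close> and \<open>b\<close> with respect to the
  variables \<open>xs\<close>, listed from left to right; exponents of all other variables are ignored.
\<close>

definition grevlex_less :: "var list \<Rightarrow> monomial \<Rightarrow> monomial \<Rightarrow> bool" where
  "grevlex_less xs a b \<longleftrightarrow>
     (\<Sum>x\<leftarrow>xs. Poly_Mapping.lookup a x) < (\<Sum>x\<leftarrow>xs. Poly_Mapping.lookup b x) \<or>
     (\<Sum>x\<leftarrow>xs. Poly_Mapping.lookup a x) = (\<Sum>x\<leftarrow>xs. Poly_Mapping.lookup b x) \<and>
     (\<exists>k<length xs. int (Poly_Mapping.lookup b (xs ! k)) - int (Poly_Mapping.lookup a (xs ! k)) < 0 \<and>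
        (\<forall>k'. k < k' \<and> k' < length xs \<longrightarrow>
           Poly_Mapping.lookup b (xs ! k') = Poly_Mapping.lookup a (xs ! k')))"

definition product_less :: "var list \<Rightarrow> var list \<Rightarrow> monomial \<Rightarrow> monomial \<Rightarrow> bool" where
  "product_less xs ys a b \<longleftrightarrow>
     grevlex_less xs a b \<or>
     (\<forall>x\<in>set xs. Poly_Mapping.lookup a x = Poly_Mapping.lookup b x) \<and> grevlex_less ys a b"

definition leading_monomial :: "(monomial \<Rightarrow> monomial \<Rightarrow> bool) \<Rightarrow> mpoly \<Rightarrow> monomial" where
  "leading_monomial lt p =
     (THE t. t \<in> Poly_Mapping.keys p \<and> (\<forall>s\<in>Poly_Mapping.keys p. s \<noteq> t \<longrightarrow> lt s t))"

definition leading_coeff :: "(monomial \<Rightarrow> monomial \<Rightarrow> bool) \<Rightarrow> mpoly \<Rightarrow> complex" where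
  "leading_coeff lt p = Poly_Mapping.lookup p (leading_monomial lt p)"

definition leading_term :: "(monomial \<Rightarrow> monomial \<Rightarrow> bool) \<Rightarrow> mpoly \<Rightarrow> mpoly" where
  "leading_term lt p = Poly_Mapping.single (leading_monomial lt p) (leading_coeff lt p)"

definition monomial_dvd :: "monomial \<Rightarrow> monomial \<Rightarrow> bool" where
  "monomial_dvd s t \<longleftrightarrow> (\<exists>r. t = s + r)"

text \<open>The zero polynomial has no leading term and contributes nothing to the initial ideal.\<close>

definition initial_ideal ::
    "var set \<Rightarrow> (monomial \<Rightarrow> monomial \<Rightarrow> bool) \<Rightarrow> mpoly set \<Rightarrow> mpoly set" where
  "initial_ideal X lt S = Idl\<^bsub>poly_ring X\<^esub> (leading_term lt ` (S - {0}))"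

definition groebner_basis ::
    "var set \<Rightarrow> (monomial \<Rightarrow> monomial \<Rightarrow> bool) \<Rightarrow> mpoly set \<Rightarrow> mpoly set \<Rightarrow> bool" where
  "groebner_basis X lt I G \<longleftrightarrow>
     finite G \<and> G \<subseteq> I \<and> initial_ideal X lt G = initial_ideal X lt I"

definition reduced_groebner_basis ::
    "var set \<Rightarrow> (monomial \<Rightarrow> monomial \<Rightarrow> bool) \<Rightarrow> mpoly set \<Rightarrow> mpoly set \<Rightarrow> bool" where
  "reduced_groebner_basis X lt I G \<longleftrightarrow>
     groebner_basis X lt I G \<and>
     (\<forall>g\<in>G. g \<noteq> 0 \<and> leading_coeff lt g = 1) \<and>
     (\<forall>g\<in>G. \<forall>h\<in>G. g \<noteq> h \<longrightarrow>
        (\<forall>t\<in>Poly_Mapping.keys h. \<not> monomial_dvd (leading_monomial lt g) t))"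


section \<open>The collinear translation ideal\<close>

definition L_vars :: "nat \<Rightarrow> var list" where
  "L_vars m = [L i j. i \<leftarrow> [0..<3], j \<leftarrow> [0..<m]]"

definition V_vars :: "nat \<Rightarrow> var list" where
  "V_vars m = map V [0..<m]"

definition camera :: "'a::comm_ring_1 \<Rightarrow> 'a mat" where
  "camera a = mat_of_rows_list 4
     [[1, 0, 0, a],
      [0, 1, 0, 0],
      [0, 0, 1, 0]]"

text \<open>The center of a camera is its kernel, a point of projective 3-space.\<close>

lemma mat_kernel_camera:
  fixes a :: "'a::field"
  shows "mat_kernel (camera a) = {c \<cdot>\<^sub>v vec_of_list [a, 0, 0, -1] | c. True}" (is "_ = ?R")
proof (intro equalityI subsetI)
  have dims: "dim_row (camera a) = 3" "dim_col (camera a) = 4"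
    by (simp_all add: camera_def mat_of_rows_list_def)
  have lt3: "(\<forall>i<3. P i) \<longleftrightarrow> P 0 \<and> P (Suc 0) \<and> P (Suc (Suc 0))" for P :: "nat \<Rightarrow> bool"
    by (auto simp: numeral_3_eq_3 less_Suc_eq)
  have lt4: "(\<forall>i<4. P i) \<longleftrightarrow> P 0 \<and> P (Suc 0) \<and> P (Suc (Suc 0)) \<and> P (Suc (Suc (Suc 0)))"
    for P :: "nat \<Rightarrow> bool"
    by (auto simp: numeral_eq_Suc less_Suc_eq)
  have eqs: "camera a *\<^sub>v x = 0\<^sub>v 3 \<longleftrightarrow>
      x $ 0 + a * x $ 3 = 0 \<and> x $ 1 = 0 \<and> x $ 2 = 0" if "dim_vec x = 4" for x
  proof -
    have "camera a *\<^sub>v x = 0\<^sub>v 3 \<longleftrightarrow> (\<forall>i<3. row (camera a) i \<bullet> x = 0)"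
      by (auto simp: vec_eq_iff dims)
    also have "\<dots> \<longleftrightarrow> x $ 0 + a * x $ 3 = 0 \<and> x $ 1 = 0 \<and> x $ 2 = 0"
      unfolding lt3 using that
      by (simp add: scalar_prod_def camera_def mat_of_rows_list_def row_def numeral_eq_Suc)
    finally show ?thesis .
  qed
  {
    fix x assume "x \<in> mat_kernel (camera a)"
    then have d: "dim_vec x = 4" and k: "camera a *\<^sub>v x = 0\<^sub>v 3"
      unfolding mat_kernel_def dims by simp_all
    have e: "x $ 0 = - (a * x $ 3)" "x $ 1 = 0" "x $ 2 = 0"
      using k unfolding eqs[OF d] by (simp_all add: eq_neg_iff_add_eq_0)
    define y where "y = (- (x $ 3)) \<cdot>\<^sub>v vec_of_list [a, 0, 0, -1]"
    have "dim_vec y = 4" by (simp add: y_def)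
    moreover have "\<forall>i<4. x $ i = y $ i"
      unfolding lt4 y_def using e by (simp add: numeral_eq_Suc)
    ultimately have "x = y"
      using d by (metis eq_vecI)
    then show "x \<in> ?R" unfolding y_def by blast
  next
    fix x assume "x \<in> ?R"
    then obtain c where x: "x = c \<cdot>\<^sub>v vec_of_list [a, 0, 0, -1]" by blast
    then have d: "dim_vec x = 4" by simp
    have "camera a *\<^sub>v x = 0\<^sub>v 3"
      unfolding eqs[OF d] by (simp add: x numeral_eq_Suc)
    moreover have "x \<in> carrier_vec 4" using d by (rule carrier_vecI)
    ultimately show "x \<in> mat_kernel (camera a)"
      by (simp only: mat_kernel_def dims mem_Collect_eq)
  }
qed

lemma camera_center_eq_iff:
  fixes a b :: "'a::field"
  shows "mat_kernel (camera a) = mat_kernel (camera b) \<longleftrightarrow> a = b"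
proof
  assume eq: "mat_kernel (camera a) = mat_kernel (camera b)"
  have "vec_of_list [a, 0, 0, -1] = 1 \<cdot>\<^sub>v vec_of_list [a, 0, 0, -1]" by simp
  then have "vec_of_list [a, 0, 0, -1] \<in> mat_kernel (camera a)"
    unfolding mat_kernel_camera by blast
  then have "vec_of_list [a, 0, 0, -1] \<in> mat_kernel (camera b)"
    by (simp only: eq)
  then obtain c where c: "vec_of_list [a, 0, 0, -1] = c \<cdot>\<^sub>v vec_of_list [b, 0, 0, -1]"
    unfolding mat_kernel_camera by blast
  from arg_cong[OF c, of "\<lambda>x. x $ 3"] have "c = 1" by (simp add: numeral_eq_Suc)
  with arg_cong[OF c, of "\<lambda>x. x $ 0"] show "a = b" by simp
qed simp

definition minors :: "nat \<Rightarrow> 'a::comm_ring_1 mat \<Rightarrow> 'a set" where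
  "minors k A = {det (submatrix A I J) | I J.
     I \<subseteq> {..<dim_row A} \<and> J \<subseteq> {..<dim_col A} \<and> card I = k \<and> card J = k}"

definition L_vec :: "nat \<Rightarrow> mpoly vec" where
  "L_vec j = vec 3 (\<lambda>i. Var (L i j))"

text \<open>
  In the following definitions, \<open>w j\<close> is the camera parameter of the \<open>j\<close>-th camera: either the
  variable \<^term>\<open>V j\<close> or a constant.
\<close>

definition back_projected_planes :: "nat \<Rightarrow> (nat \<Rightarrow> mpoly) \<Rightarrow> mpoly mat" where
  "back_projected_planes m w =
     mat_of_cols 4 (map (\<lambda>j. transpose_mat (camera (w j)) *\<^sub>v L_vec j) [0..<m])"

definition veronese :: "'a::comm_ring_1 vec \<Rightarrow> 'a vec" where
  "veronese p = (let x = p $ 0; y = p $ 1; z = p $ 2; w = p $ 3 in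
     vec_of_list [x^2, y^2, z^2, w^2, x * y, x * z, x * w, y * z, y * w, z * w])"

definition e_vec :: "(nat \<Rightarrow> mpoly) \<Rightarrow> nat \<Rightarrow> mpoly vec" where
  "e_vec w i = vec_of_list [w i, - Var (L 2 i), Var (L 1 i), - 1]"

definition Phi :: "(nat \<Rightarrow> mpoly) \<Rightarrow> nat set \<Rightarrow> mpoly mat" where
  "Phi w \<sigma> = mat_of_cols 10 (map veronese
     (map vec_of_list
       [[1, 0, 0, 0], [0, 0, 0, 1], [1, 0, 0, 1],
        [0, 1, 0, 0], [0, 0, 1, 0], [0, 1, 1, 0]]
      @ map (e_vec w) (sorted_list_of_set \<sigma>)))"

definition translation_generators :: "nat \<Rightarrow> (nat \<Rightarrow> mpoly) \<Rightarrow> mpoly set" where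
  "translation_generators m w =
     minors 3 (back_projected_planes m w) \<union>
     {det (Phi w \<sigma>) | \<sigma>. \<sigma> \<subseteq> {..<m} \<and> card \<sigma> = 4}"

definition indeterminate_translation_ideal :: "nat \<Rightarrow> mpoly set" where
  "indeterminate_translation_ideal m =
     Idl\<^bsub>poly_ring (set (L_vars m) \<union> set (V_vars m))\<^esub>
       (translation_generators m (\<lambda>j. Var (V j)))"

definition translation_ideal :: "nat \<Rightarrow> complex vec \<Rightarrow> mpoly set" where
  "translation_ideal m u =
     Idl\<^bsub>poly_ring (set (L_vars m))\<^esub> (translation_generators m (\<lambda>j. Const (u $ j)))"

definition specialize :: "complex vec \<Rightarrow> mpoly \<Rightarrow> mpoly" where
  "specialize u p = (\<Sum>t\<in>Poly_Mapping.keys p. Const (Poly_Mapping.lookup p t) *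
     (\<Prod>x\<in>Poly_Mapping.keys t. (case x of L i j \<Rightarrow> Var x | V j \<Rightarrow> Const (u $ j)) ^ Poly_Mapping.lookup t x))"

end

theory Submission
  imports Defs
begin

text \<open>
  Write \<open>a\<^sub>j, b\<^sub>j, c\<^sub>j\<close> for the three coordinates of \<open>\<ell>\<^sub>j\<close>, that is for \<open>L 0 j\<close>, \<open>L 1 j\<close>, \<open>L 2 j\<close>. In the
  product order the leading \<open>\<ell>\<close>-monomial of a polynomial carries a coefficient in \<open>v\<close>, and a
  Groebner basis specializes well as long as enough of these coefficients survive. Precisely, let
  \<open>h\<close> be in the indeterminate ideal, with all \<open>\<ell>\<close>-monomials at most \<open>t\<close> and with a coefficient of \<open>t\<close>
  that does not vanish at \<open>u\<close>. Division of \<open>h\<close> by \<open>G\<close> writes this coefficient as a sum of products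
  with the coefficients of the divisors, so some \<open>g\<close> in \<open>G\<close> keeps a leading monomial that divides \<open>t\<close>
  (\<open>divisor_after_specialization\<close>). It therefore suffices that the leading monomial of every
  nonzero \<open>f\<close> in the specialized ideal is divisible by such a \<open>t\<close> (\<open>groebner_basis_specialize\<close>).

  The generators are the 3-minors of the matrix with rows \<open>a, b, c, v a\<close> and, because the quadrics
  through the six fixed points are spanned by \<open>x y, x z, y w, z w\<close>, the 4-minors of the matrix with
  rows \<open>b, c, v b, v c\<close> (\<open>det_Phi\<close>). Combining them gives elements of the indeterminate ideal with
  the leading \<open>\<ell>\<close>-monomials
    \<open>b\<^sub>i a\<^sub>j a\<^sub>k\<close>, \<open>c\<^sub>i a\<^sub>j a\<^sub>k\<close>, \<open>c\<^sub>i a\<^sub>j b\<^sub>k\<close>, \<open>c\<^sub>i c\<^sub>j b\<^sub>k b\<^sub>l\<close>, \<open>a\<^sub>i c\<^sub>j b\<^sub>k b\<^sub>l\<close>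
  for \<open>i < j < k < l\<close> (in the third one also for \<open>i < k < j\<close>), whose coefficients are products of
  differences \<open>v\<^sub>p - v\<^sub>q\<close> of distinct variables (\<open>forbidden_lift\<close>). These are nonzero at \<open>u\<close>.

  It remains to see that no nonzero element of the specialized ideal has a standard leading monomial,
  one divisible by none of these five. The ideal vanishes on the family
    \<open>a\<^sub>j = s \<lambda>\<^sub>j\<close>, \<open>b\<^sub>j = t \<lambda>\<^sub>j (x + u\<^sub>j)\<close>, \<open>c\<^sub>j = r \<lambda>\<^sub>j (y + u\<^sub>j)\<close>
  (\<open>param_generator\<close>); the back-projected planes of a general line are of this form.
  Reducing the lower terms of such an element would leave a nonzero combination of standard
  monomials that is zero on this family, but standard monomials are linearly independent there
  (\<open>standard_independent\<close>). By homogeneity this independence concerns the products of powers of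
  \<open>x + u\<^sub>j\<close> and \<open>y + u\<^sub>j\<close> given by standard monomials of one multidegree, and it follows by peeling
  off variables. At \<open>y = - u\<^sub>m\<close>, with \<open>m\<close> the last column, only monomials without \<open>c\<^sub>m\<close> survive, and what
  is left are products of powers of \<open>x + u\<^sub>j\<close>. Among these there is always a column \<open>q\<close> such that at most one
  monomial of the multidegree lacks \<open>b\<^sub>q\<close> (\<open>admissible_unique_last\<close>, \<open>admissible_unique_middle\<close>), so
  setting \<open>x = - u\<^sub>q\<close> shows that its coefficient is zero; all the other monomials contain \<open>b\<^sub>q\<close>,
  which can be divided out.
\<close>

abbreviation lookup :: "('a \<Rightarrow>\<^sub>0 'b::zero) \<Rightarrow> 'a \<Rightarrow> 'b" where "lookup \<equiv> Poly_Mapping.lookup"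
abbreviation keys :: "('a \<Rightarrow>\<^sub>0 'b::zero) \<Rightarrow> 'a set" where "keys \<equiv> Poly_Mapping.keys"
abbreviation single :: "'a \<Rightarrow> 'b \<Rightarrow> ('a \<Rightarrow>\<^sub>0 'b::zero)" where "single \<equiv> Poly_Mapping.single"

section \<open>Evaluation homomorphisms\<close>

definition subst_mon :: "(var \<Rightarrow> 'b::comm_ring_1) \<Rightarrow> monomial \<Rightarrow> 'b" where
  "subst_mon s t = (\<Prod>x\<in>keys t. s x ^ lookup t x)"

definition subst :: "(complex \<Rightarrow> 'b::comm_ring_1) \<Rightarrow> (var \<Rightarrow> 'b) \<Rightarrow> mpoly \<Rightarrow> 'b" where
  "subst h s p = (\<Sum>t\<in>keys p. h (lookup p t) * subst_mon s t)"

lemma subst_mon_superset: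
  assumes "finite X" "keys t \<subseteq> X"
  shows "subst_mon s t = (\<Prod>x\<in>X. s x ^ lookup t x)"
  unfolding subst_mon_def
  by (rule prod.mono_neutral_left) (use assms in \<open>auto simp: in_keys_iff\<close>)

lemma subst_mon_0 [simp]: "subst_mon s 0 = 1"
  by (simp add: subst_mon_def)

lemma subst_mon_single [simp]: "subst_mon s (single x n) = s x ^ n"
  by (cases "n = 0") (simp_all add: subst_mon_def)

lemma subst_mon_add: "subst_mon s (a + b) = subst_mon s a * subst_mon s b"
proof -
  let ?X = "keys a \<union> keys b"
  have "subst_mon s (a + b) = (\<Prod>x\<in>?X. s x ^ lookup (a + b) x)"
    using keys_add[of a b] by (intro subst_mon_superset) auto
  also have "\<dots> = subst_mon s a * subst_mon s b"
    by (simp add: subst_mon_superset[of ?X] lookup_add power_add prod.distrib)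
  finally show ?thesis .
qed

lemma poly_eq_sum_singles: "(p :: mpoly) = (\<Sum>t\<in>keys p. single t (lookup p t))"
  by (rule poly_mapping_eqI) (simp add: lookup_sum lookup_single when_def in_keys_iff)

lemma keys_minus_mpoly: "keys (p - q) \<subseteq> keys p \<union> keys (q :: mpoly)"
  by (auto simp: in_keys_iff lookup_minus)

lemma keys_uminus_mpoly [simp]: "keys (- q :: mpoly) = keys q"
  by (auto simp: in_keys_iff)

context
  fixes h :: "complex \<Rightarrow> 'b::comm_ring_1" and s :: "var \<Rightarrow> 'b"
  assumes h: "comm_ring_hom h"
begin

interpretation h: comm_ring_hom h by (rule h)

lemma subst_superset:
  assumes "finite T" "keys p \<subseteq> T"
  shows "subst h s p = (\<Sum>t\<in>T. h (lookup p t) * subst_mon s t)"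
  unfolding subst_def
  by (rule sum.mono_neutral_left) (use assms in \<open>auto simp: in_keys_iff\<close>)

lemma subst_add: "subst h s (p + q) = subst h s p + subst h s q"
proof -
  let ?T = "keys p \<union> keys q"
  have "subst h s (p + q) = (\<Sum>t\<in>?T. h (lookup (p + q) t) * subst_mon s t)"
    using keys_add[of p q] by (intro subst_superset) auto
  also have "\<dots> = subst h s p + subst h s q"
    by (simp add: subst_superset[of ?T] lookup_add algebra_simps sum.distrib h.hom_add)
  finally show ?thesis .
qed

lemma subst_0 [simp]: "subst h s 0 = 0"
  by (simp add: subst_def)

lemma subst_single: "subst h s (single t c) = h c * subst_mon s t"
  by (cases "c = 0") (simp_all add: subst_def)

lemma subst_sum: "subst h s (sum f A) = (\<Sum>x\<in>A. subst h s (f x))"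
  by (induction A rule: infinite_finite_induct) (simp_all add: subst_add)

lemma subst_times: "subst h s (p * q) = subst h s p * subst h s q"
proof -
  let ?P = "keys p" and ?Q = "keys q"
  let ?p = "lookup p" and ?q = "lookup q"
  have "p * q = (\<Sum>a\<in>?P. single a (?p a)) * (\<Sum>b\<in>?Q. single b (?q b))"
    using poly_eq_sum_singles[of p] poly_eq_sum_singles[of q] by simp
  also have "\<dots> = (\<Sum>a\<in>?P. \<Sum>b\<in>?Q. single (a + b) (?p a * ?q b))"
    by (simp add: sum_product mult_single)
  finally have "subst h s (p * q) = (\<Sum>a\<in>?P. \<Sum>b\<in>?Q. h (?p a * ?q b) * subst_mon s (a + b))"
    by (simp add: subst_sum subst_single)
  also have "\<dots> = subst h s p * subst h s q"
    unfolding subst_def sum_product by (simp add: subst_mon_add h.hom_mult mult_ac)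
  finally show ?thesis .
qed

lemma comm_ring_hom_subst: "comm_ring_hom (subst h s)"
proof unfold_locales
  show "subst h s 1 = 1"
    using subst_single[of 0 1] by simp
qed (simp_all add: subst_add subst_times)

lemma subst_Var [simp]: "subst h s (Var x) = s x"
  by (simp add: Var_def subst_single)

lemma subst_Const [simp]: "subst h s (Const c) = h c"
  by (simp add: Const_def subst_single)

text \<open>The universal property of polynomials: two evaluations agree once they agree on constants and
  on variables. Partial evaluations of a parametrization are compared in this way.\<close>

lemma hom_subst:
  assumes g: "comm_ring_hom g"
  shows "g (subst h s p) = subst (\<lambda>c. g (h c)) (\<lambda>x. g (s x)) p"
proof -
  interpret g: comm_ring_hom g by (rule g)
  show ?thesis
    by (simp add: subst_def subst_mon_def g.hom_sum g.hom_mult g.hom_prod g.hom_power)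
qed

end

lemma comm_ring_hom_Const: "comm_ring_hom Const"
  by unfold_locales (simp_all add: Const_def single_add mult_single)

definition specialize_var :: "complex vec \<Rightarrow> var \<Rightarrow> mpoly" where
  "specialize_var u x = (case x of L i j \<Rightarrow> Var x | V j \<Rightarrow> Const (u $ j))"

lemma specialize_eq_subst: "specialize u = subst Const (specialize_var u)"
  by (rule ext) (simp add: specialize_def subst_def subst_mon_def specialize_var_def)

lemma comm_ring_hom_specialize: "comm_ring_hom (specialize u)"
  unfolding specialize_eq_subst by (rule comm_ring_hom_subst[OF comm_ring_hom_Const])

section \<open>Membership in polynomial rings\<close>

lemma polys_minus: "p \<in> polys X \<Longrightarrow> q \<in> polys X \<Longrightarrow> p - q \<in> polys X"
  using polys_plus[of p X "- q"] polys_uminus[of q X] by simp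

lemma polys_Var: "x \<in> X \<Longrightarrow> Var x \<in> polys X"
  by (simp add: polys_def Var_def)

lemma polys_Const: "Const c \<in> polys X"
  by (simp add: polys_def Const_def)

lemma polys_sum: "(\<And>x. x \<in> A \<Longrightarrow> f x \<in> polys X) \<Longrightarrow> sum f A \<in> polys X"
  by (induction A rule: infinite_finite_induct) (auto simp: polys_zero polys_plus)

lemma polys_power: "p \<in> polys X \<Longrightarrow> p ^ n \<in> polys X"
  by (induction n) (auto simp: polys_one polys_times)

lemma polys_prod: "(\<And>x. x \<in> A \<Longrightarrow> f x \<in> polys X) \<Longrightarrow> prod f A \<in> polys X"
  by (induction A rule: infinite_finite_induct) (auto simp: polys_one polys_times)

lemma polys_single: "keys t \<subseteq> X \<Longrightarrow> single t c \<in> polys X"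
  by (cases "c = 0") (simp_all add: polys_def)

lemmas polys_intros = polys_plus polys_minus polys_uminus polys_times polys_zero polys_one
  polys_Var polys_Const polys_sum polys_power polys_prod

section \<open>Ideals\<close>

lemma poly_ring_simps [simp]:
  "carrier (poly_ring X) = polys X"
  "a \<otimes>\<^bsub>poly_ring X\<^esub> b = a * b"
  "a \<oplus>\<^bsub>poly_ring X\<^esub> b = a + b"
  "\<zero>\<^bsub>poly_ring X\<^esub> = 0"
  "\<one>\<^bsub>poly_ring X\<^esub> = 1"
  by (simp_all add: poly_ring_def)

lemma a_inv_poly_ring [simp]:
  assumes "p \<in> polys X"
  shows "\<ominus>\<^bsub>poly_ring X\<^esub> p = - p"
proof -
  interpret cring "poly_ring X" by (rule cring_poly_ring)
  show ?thesis
    by (rule minus_equality) (use assms in \<open>simp_all add: polys_uminus\<close>)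
qed

text \<open>Negation is multiplication by \<open>-1\<close>, so closure under sums and multiples suffices.\<close>

lemma ideal_poly_ringI:
  assumes "J \<subseteq> polys X" "0 \<in> J" "\<And>p q. p \<in> J \<Longrightarrow> q \<in> J \<Longrightarrow> p + q \<in> J"
    "\<And>p q. p \<in> J \<Longrightarrow> q \<in> polys X \<Longrightarrow> q * p \<in> J"
  shows "ideal J (poly_ring X)"
proof (rule idealI)
  interpret cring "poly_ring X" by (rule cring_poly_ring)
  show "ring (poly_ring X)" by (rule ring_axioms)
  show "subgroup J (add_monoid (poly_ring X))"
  proof
    fix p assume p: "p \<in> J"
    then have "(-1) * p \<in> J" using assms(4)[OF p, of "-1"] by (simp add: polys_uminus polys_one)
    moreover have "inv\<^bsub>add_monoid (poly_ring X)\<^esub> p = - p"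
      using a_inv_poly_ring[of p X] p assms(1) by (auto simp: a_inv_def)
    ultimately show "inv\<^bsub>add_monoid (poly_ring X)\<^esub> p \<in> J" by simp
  qed (use assms in \<open>auto simp: poly_ring_def\<close>)
qed (use assms in \<open>auto simp: mult.commute\<close>)

text \<open>Minimality of the generated ideal, as an induction principle over its members.\<close>

lemma genideal_poly_ring_induct:
  assumes "p \<in> Idl\<^bsub>poly_ring X\<^esub> S" "S \<subseteq> J"
    "J \<subseteq> polys X" "0 \<in> J" "\<And>p q. p \<in> J \<Longrightarrow> q \<in> J \<Longrightarrow> p + q \<in> J"
    "\<And>p q. p \<in> J \<Longrightarrow> q \<in> polys X \<Longrightarrow> q * p \<in> J"
  shows "p \<in> J"
proof -
  interpret cring "poly_ring X" by (rule cring_poly_ring)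
  have "Idl\<^bsub>poly_ring X\<^esub> S \<subseteq> J"
    using assms(2-) by (intro genideal_minimal ideal_poly_ringI)
  then show ?thesis using assms(1) by blast
qed

context
  fixes X S assumes S: "S \<subseteq> polys X"
begin

interpretation cring "poly_ring X" by (rule cring_poly_ring)

interpretation I: ideal "Idl\<^bsub>poly_ring X\<^esub> S" "poly_ring X"
  by (rule genideal_ideal) (use S in simp)

lemma idl_subset_polys: "Idl\<^bsub>poly_ring X\<^esub> S \<subseteq> polys X"
  using I.a_subset by simp

lemma idl_superset: "S \<subseteq> Idl\<^bsub>poly_ring X\<^esub> S"
  by (rule genideal_self) (use S in simp)

lemma idl_zero: "0 \<in> Idl\<^bsub>poly_ring X\<^esub> S"
  using I.zero_closed by simp

lemma idl_add: "p \<in> Idl\<^bsub>poly_ring X\<^esub> S \<Longrightarrow> q \<in> Idl\<^bsub>poly_ring X\<^esub> S \<Longrightarrow> p + q \<in> Idl\<^bsub>poly_ring X\<^esub> S"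
  using I.a_closed by simp

lemma idl_mult: "q \<in> polys X \<Longrightarrow> p \<in> Idl\<^bsub>poly_ring X\<^esub> S \<Longrightarrow> q * p \<in> Idl\<^bsub>poly_ring X\<^esub> S"
  using I.I_l_closed by simp

lemma idl_minus:
  assumes "p \<in> Idl\<^bsub>poly_ring X\<^esub> S" "q \<in> Idl\<^bsub>poly_ring X\<^esub> S"
  shows "p - q \<in> Idl\<^bsub>poly_ring X\<^esub> S"
  using idl_add[OF assms(1) idl_mult[OF _ assms(2), of "-1"]] by (simp add: polys_uminus polys_one)

lemma idl_sum: "(\<And>x. x \<in> A \<Longrightarrow> f x \<in> Idl\<^bsub>poly_ring X\<^esub> S) \<Longrightarrow> sum f A \<in> Idl\<^bsub>poly_ring X\<^esub> S"
  by (induction A rule: infinite_finite_induct) (auto simp: idl_zero idl_add)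

end

section \<open>Monomial orders\<close>

text \<open>In \<^typ>\<open>mpoly\<close> all variables live side by side; this is the factor of a monomial in the
  variables \<open>X\<close>, used to pass from a monomial in \<open>\<ell>\<close> and \<open>v\<close> to its \<open>\<ell>\<close>-monomial.\<close>

definition part :: "var set \<Rightarrow> monomial \<Rightarrow> monomial" where
  "part X t = (\<Sum>x\<in>keys t. if x \<in> X then single x (lookup t x) else 0)"

lemma lookup_part: "lookup (part X t) x = (if x \<in> X then lookup t x else 0)"
proof -
  have "lookup (part X t) x =
      (\<Sum>y\<in>keys t. if y = x then (if x \<in> X then lookup t x else 0) else 0)"
    unfolding part_def lookup_sum by (rule sum.cong) (auto simp: lookup_single when_def)
  then show ?thesis by (simp add: in_keys_iff)
qed

lemma keys_part: "keys (part X t) = keys t \<inter> X"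
  by (auto simp: in_keys_iff lookup_part split: if_splits)

lemma part_ident: "keys t \<subseteq> X \<Longrightarrow> part X t = t"
  by (rule poly_mapping_eqI) (auto simp: lookup_part in_keys_iff)

lemma grevlex_cong:
  assumes "\<And>x. x \<in> set xs \<Longrightarrow> lookup a x = lookup a' x"
    "\<And>x. x \<in> set xs \<Longrightarrow> lookup b x = lookup b' x"
  shows "grevlex_less xs a b \<longleftrightarrow> grevlex_less xs a' b'"
proof -
  have "sum_list (map (lookup a) xs) = sum_list (map (lookup a') xs)"
    "sum_list (map (lookup b) xs) = sum_list (map (lookup b') xs)"
    using assms by (simp_all cong: map_cong)
  moreover have "lookup a (xs ! k) = lookup a' (xs ! k)"
    "lookup b (xs ! k) = lookup b' (xs ! k)" if "k < length xs" for k
    using assms that by simp_all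
  ultimately show ?thesis unfolding grevlex_less_def by (simp cong: conj_cong)
qed

lemma grevlex_irrefl: "\<not> grevlex_less xs a a"
  by (simp add: grevlex_less_def)

lemma grevlex_add: "grevlex_less xs (a + c) (b + c) \<longleftrightarrow> grevlex_less xs a b"
proof -
  have "sum_list (map (lookup (t + c)) xs) =
      sum_list (map (lookup t) xs) + sum_list (map (lookup c) xs)" for t
    by (induction xs) (simp_all add: lookup_add)
  then show ?thesis unfolding grevlex_less_def by (simp add: lookup_add)
qed

lemma grevlex_trans:
  assumes "grevlex_less xs a b" "grevlex_less xs b c"
  shows "grevlex_less xs a c"
proof -
  let ?d = "\<lambda>t. \<Sum>x\<leftarrow>xs. lookup t x"
  have le: "?d a \<le> ?d b" "?d b \<le> ?d c" using assms unfolding grevlex_less_def by linarith+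
  show ?thesis
  proof (cases "?d a = ?d b \<and> ?d b = ?d c")
    case False
    then show ?thesis using le unfolding grevlex_less_def by linarith
  next
    case True
    obtain k where k: "k < length xs" "lookup b (xs ! k) < lookup a (xs ! k)"
      "\<And>k'. k < k' \<Longrightarrow> k' < length xs \<Longrightarrow> lookup b (xs ! k') = lookup a (xs ! k')"
      using assms(1) True unfolding grevlex_less_def by auto
    obtain l where l: "l < length xs" "lookup c (xs ! l) < lookup b (xs ! l)"
      "\<And>k'. l < k' \<Longrightarrow> k' < length xs \<Longrightarrow> lookup c (xs ! k') = lookup b (xs ! k')"
      using assms(2) True unfolding grevlex_less_def by auto
    have "max k l < length xs" using k l by simp
    moreover have "lookup c (xs ! max k l) < lookup a (xs ! max k l)"
      using k l by (cases k l rule: linorder_cases) (auto simp: max_def)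
    moreover have "lookup c (xs ! k') = lookup a (xs ! k')"
      if "max k l < k'" "k' < length xs" for k' using k(3)[of k'] l(3)[of k'] that by simp
    ultimately have "\<exists>k<length xs. int (lookup c (xs ! k)) - int (lookup a (xs ! k)) < 0 \<and>
        (\<forall>k'. k < k' \<and> k' < length xs \<longrightarrow> lookup c (xs ! k') = lookup a (xs ! k'))"
      by (intro exI[of _ "max k l"]) auto
    then show ?thesis using True unfolding grevlex_less_def by simp
  qed
qed

lemma grevlex_total:
  assumes "x \<in> set xs" "lookup a x \<noteq> lookup b x"
  shows "grevlex_less xs a b \<or> grevlex_less xs b a"
proof -
  let ?P = "\<lambda>k. k < length xs \<and> lookup a (xs ! k) \<noteq> lookup b (xs ! k)"
  define k where "k = Greatest ?P"
  obtain i where i: "?P i" using assms by (auto simp: in_set_conv_nth)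
  have "?P k" unfolding k_def by (rule GreatestI_nat[of ?P i "length xs"]) (use i in auto)
  moreover have "lookup a (xs ! k') = lookup b (xs ! k')"
    if "k < k'" "k' < length xs" for k'
    using Greatest_le_nat[of ?P k' "length xs"] that unfolding k_def by fastforce
  moreover have "lookup a (xs ! k) < lookup b (xs ! k) \<or>
      lookup b (xs ! k) < lookup a (xs ! k)"
    using \<open>?P k\<close> by linarith
  moreover have "grevlex_less xs c d \<or> grevlex_less xs d c"
    if "k < length xs" "lookup d (xs ! k) < lookup c (xs ! k)"
      "\<And>k'. k < k' \<Longrightarrow> k' < length xs \<Longrightarrow> lookup d (xs ! k') = lookup c (xs ! k')"
    for c d
  proof -
    have "\<exists>k<length xs. int (lookup d (xs ! k)) - int (lookup c (xs ! k)) < 0 \<and>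
        (\<forall>k'. k < k' \<and> k' < length xs \<longrightarrow> lookup d (xs ! k') = lookup c (xs ! k'))"
      using that by (intro exI[of _ k]) auto
    then show ?thesis unfolding grevlex_less_def by (meson linorder_neqE_nat)
  qed
  ultimately show ?thesis by metis
qed

text \<open>The total degree is compared first, and it bounds every exponent.\<close>

lemma finite_grevlex_below: "finite {s. keys s \<subseteq> set xs \<and> grevlex_less xs s t}"
proof -
  let ?d = "\<lambda>t. \<Sum>x\<leftarrow>xs. lookup t x"
  let ?F = "{f. \<forall>x. (x \<in> set xs \<longrightarrow> f x \<in> {..?d t}) \<and> (x \<notin> set xs \<longrightarrow> f x = 0)}"
  have "finite ?F" by (rule finite_set_of_finite_funs) simp_all
  moreover have "{s. keys s \<subseteq> set xs \<and> grevlex_less xs s t} \<subseteq> lookup -` ?F"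
  proof
    fix s assume "s \<in> {s. keys s \<subseteq> set xs \<and> grevlex_less xs s t}"
    then have s: "keys s \<subseteq> set xs" "grevlex_less xs s t" by auto
    have "lookup s x \<le> ?d t" if "x \<in> set xs" for x
    proof -
      have "lookup s x \<le> ?d s" using that by (intro member_le_sum_list) auto
      also have "\<dots> \<le> ?d t" using s(2) unfolding grevlex_less_def by linarith
      finally show ?thesis .
    qed
    moreover have "lookup s x = 0" if "x \<notin> set xs" for x
      using s(1) that by (auto simp: in_keys_iff)
    ultimately show "s \<in> lookup -` ?F" by simp
  qed
  moreover have "inj (lookup :: monomial \<Rightarrow> _)"
    by (rule injI) (rule iffD1[OF lookup_inject])
  ultimately show ?thesis by (meson finite_subset finite_vimageI)
qed

text \<open>Only finitely many monomials lie below a given one, so counting them ranks the order in the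
  natural numbers.\<close>

definition grevlex_rank :: "var list \<Rightarrow> monomial \<Rightarrow> nat" where
  "grevlex_rank xs t = card {s. keys s \<subseteq> set xs \<and> grevlex_less xs s t}"

lemma grevlex_rank_less:
  assumes "grevlex_less xs s t"
  shows "grevlex_rank xs s < grevlex_rank xs t"
  unfolding grevlex_rank_def
proof (rule psubset_card_mono[OF finite_grevlex_below])
  let ?s = "part (set xs) s" and ?below = "\<lambda>t. {r. keys r \<subseteq> set xs \<and> grevlex_less xs r t}"
  have cong: "grevlex_less xs ?s r \<longleftrightarrow> grevlex_less xs s r" for r
    by (rule grevlex_cong) (auto simp: lookup_part)
  have "?s \<in> ?below t" using assms cong by (auto simp: keys_part)
  moreover have "?s \<notin> ?below s" using cong grevlex_irrefl by simp
  ultimately have "?below s \<noteq> ?below t" by (rule_tac notI) simp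
  moreover have "?below s \<subseteq> ?below t"
    by (intro Collect_mono) (auto intro: grevlex_trans[OF _ assms])
  ultimately show "?below s \<subset> ?below t" by (intro psubsetI)
qed

lemma grevlex_rank_cong:
  assumes "\<And>x. x \<in> set xs \<Longrightarrow> lookup a x = lookup b x"
  shows "grevlex_rank xs a = grevlex_rank xs b"
proof -
  have "grevlex_less xs s a \<longleftrightarrow> grevlex_less xs s b" for s
    by (rule grevlex_cong) (simp_all add: assms)
  then show ?thesis unfolding grevlex_rank_def by simp
qed

text \<open>Termination of the division algorithm is part of the notion: \<open>lt\<close> is required to be
  well-founded, on all monomials at once.\<close>

locale monomial_order =
  fixes X :: "var set" and lt :: "monomial \<Rightarrow> monomial \<Rightarrow> bool"
  assumes irrefl: "\<not> lt a a"
    and trans: "lt a b \<Longrightarrow> lt b c \<Longrightarrow> lt a c"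
    and total: "keys a \<subseteq> X \<Longrightarrow> keys b \<subseteq> X \<Longrightarrow> a \<noteq> b \<Longrightarrow> lt a b \<or> lt b a"
    and add_mono: "lt a b \<Longrightarrow> lt (a + c) (b + c)"
    and wf: "wfP lt"
begin

lemma leading_monomial_exists:
  assumes "finite K" "K \<noteq> {}" "\<And>t. t \<in> K \<Longrightarrow> keys t \<subseteq> X"
  shows "\<exists>t\<in>K. \<forall>s\<in>K. s \<noteq> t \<longrightarrow> lt s t"
  using assms
proof (induction K rule: finite_ne_induct)
  case (insert x K)
  then obtain t where t: "t \<in> K" "\<forall>s\<in>K. s \<noteq> t \<longrightarrow> lt s t" by auto
  have "x \<noteq> t" using insert t by auto
  then consider "lt x t" | "lt t x" using total[of x t] insert.prems t(1) by blast
  then show ?case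
  proof cases
    case 1
    then show ?thesis using t by (intro bexI[of _ t]) auto
  next
    case 2
    have "lt s x" if "s \<in> insert x K" "s \<noteq> x" for s
      using that t(2) 2 trans[of s t x] by (cases "s = t") auto
    then show ?thesis by blast
  qed
qed simp

lemma leading_monomial_eqI:
  assumes "t \<in> keys p" "\<And>s. s \<in> keys p \<Longrightarrow> s \<noteq> t \<Longrightarrow> lt s t"
  shows "leading_monomial lt p = t"
  unfolding leading_monomial_def
proof (rule the_equality)
  fix s assume s: "s \<in> keys p \<and> (\<forall>r\<in>keys p. r \<noteq> s \<longrightarrow> lt r s)"
  show "s = t"
  proof (rule ccontr)
    assume "s \<noteq> t"
    then have "lt s t" "lt t s" using s assms by auto
    then show False using trans irrefl by metis
  qed
qed (use assms in blast)

lemma leading_monomial: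
  assumes "p \<in> polys X" "p \<noteq> 0"
  shows "leading_monomial lt p \<in> keys p"
    "s \<in> keys p \<Longrightarrow> s \<noteq> leading_monomial lt p \<Longrightarrow> lt s (leading_monomial lt p)"
proof -
  obtain t where "t \<in> keys p" "\<forall>s\<in>keys p. s \<noteq> t \<longrightarrow> lt s t"
    using leading_monomial_exists[of "keys p"] assms unfolding polys_def by auto
  moreover from this have "leading_monomial lt p = t" using leading_monomial_eqI[of t p] by blast
  ultimately show "leading_monomial lt p \<in> keys p"
    "s \<in> keys p \<Longrightarrow> s \<noteq> leading_monomial lt p \<Longrightarrow> lt s (leading_monomial lt p)" by auto
qed

lemma leading_coeff_nonzero: "p \<in> polys X \<Longrightarrow> p \<noteq> 0 \<Longrightarrow> leading_coeff lt p \<noteq> 0"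
  using leading_monomial(1)[of p] by (simp add: leading_coeff_def in_keys_iff)

lemma leading_term_polys: "p \<in> polys X \<Longrightarrow> p \<noteq> 0 \<Longrightarrow> leading_term lt p \<in> polys X"
  unfolding leading_term_def using leading_monomial(1)[of p]
  by (intro polys_single) (auto simp: polys_def)

text \<open>Being generated by monomials, the initial ideal consists of the polynomials all of whose
  monomials are multiples of a leading monomial.\<close>

lemma initial_ideal_keys:
  assumes S: "S \<subseteq> polys X" and p: "p \<in> initial_ideal X lt S" "t \<in> keys p"
  shows "\<exists>g\<in>S - {0}. monomial_dvd (leading_monomial lt g) t"
proof -
  let ?D = "\<lambda>t. \<exists>g\<in>S - {0}. monomial_dvd (leading_monomial lt g) t"
  let ?J = "{p \<in> polys X. \<forall>t\<in>keys p. ?D t}"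
  have D_add: "?D (s + t)" if D: "?D t" for s t
  proof -
    obtain g r where g: "g \<in> S - {0}" and t: "t = leading_monomial lt g + r"
      using D unfolding monomial_dvd_def by blast
    have "s + t = leading_monomial lt g + (s + r)" unfolding t by (simp add: ac_simps)
    then show ?thesis using g unfolding monomial_dvd_def by blast
  qed
  have "p \<in> ?J"
  proof (rule genideal_poly_ring_induct[of p X])
    show "p \<in> Idl\<^bsub>poly_ring X\<^esub> (leading_term lt ` (S - {0}))"
      using p(1) by (simp add: initial_ideal_def)
    show "leading_term lt ` (S - {0}) \<subseteq> ?J"
    proof safe
      fix g assume g: "g \<in> S" "g \<noteq> 0"
      show "leading_term lt g \<in> polys X" using leading_term_polys g S by blast
      fix t assume "t \<in> keys (leading_term lt g)"
      then have "t = leading_monomial lt g"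
        unfolding leading_term_def by (cases "leading_coeff lt g = 0") simp_all
      then have "monomial_dvd (leading_monomial lt g) t"
        unfolding monomial_dvd_def by (intro exI[of _ 0]) simp
      then show "?D t" using g by blast
    qed
    show "?J \<subseteq> polys X" "0 \<in> ?J" by (auto simp: polys_zero)
    show "p + q \<in> ?J" if "p \<in> ?J" "q \<in> ?J" for p q
    proof -
      have "?D t" if "t \<in> keys (p + q)" for t
        using \<open>p \<in> ?J\<close> \<open>q \<in> ?J\<close> keys_add[of p q] that by blast
      then show ?thesis using that polys_plus[of p X q] by simp
    qed
    show "q * p \<in> ?J" if "p \<in> ?J" "q \<in> polys X" for p q
    proof -
      have "?D t" if t: "t \<in> keys (q * p)" for t
      proof -
        obtain a b where ab: "t = a + b" "b \<in> keys p"
          using keys_mult[of q p] t by blast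
        then have "?D b" using \<open>p \<in> ?J\<close> by blast
        then show ?thesis unfolding ab(1) by (rule D_add)
      qed
      then show ?thesis using that polys_times[of q X p] by simp
    qed
  qed
  then show ?thesis using p(2) by blast
qed

text \<open>The converse of \<open>initial_ideal_keys\<close>: coefficients are units, so a monomial divisible by a leading
  monomial is a multiple of the leading term.\<close>

lemma leading_term_in_initial_ideal:
  assumes S: "S \<subseteq> polys X" and g: "g \<in> S" "g \<noteq> 0"
    and t: "monomial_dvd (leading_monomial lt g) t" "keys t \<subseteq> X"
  shows "single t c \<in> initial_ideal X lt S"
proof -
  obtain r where r: "t = leading_monomial lt g + r" using t(1) unfolding monomial_dvd_def by blast
  let ?q = "single r (c / leading_coeff lt g)"
  have "keys r \<subseteq> X"
    using t(2) unfolding r by (auto simp: in_keys_iff lookup_add)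
  then have q: "?q \<in> polys X" by (rule polys_single)
  have T: "leading_term lt ` (S - {0}) \<subseteq> polys X"
    using S leading_term_polys by blast
  have "?q * leading_term lt g \<in> initial_ideal X lt S"
    unfolding initial_ideal_def using g q
    by (intro idl_mult[OF T] subsetD[OF idl_superset[OF T]]) auto
  moreover have "?q * leading_term lt g = single t c"
    using leading_coeff_nonzero[of g] g S
    by (simp add: leading_term_def mult_single r add.commute subset_eq)
  ultimately show ?thesis by simp
qed

end

lemma monomial_order_grevlex: "monomial_order (set xs) (grevlex_less xs)"
proof
  fix a b c :: monomial
  show "\<not> grevlex_less xs a a" by (rule grevlex_irrefl)
  show "grevlex_less xs a c" if "grevlex_less xs a b" "grevlex_less xs b c"
    using that by (rule grevlex_trans)
  show "grevlex_less xs (a + c) (b + c)" if "grevlex_less xs a b"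
    using that by (simp only: grevlex_add)
  show "grevlex_less xs a b \<or> grevlex_less xs b a"
    if ab: "keys a \<subseteq> set xs" "keys b \<subseteq> set xs" "a \<noteq> b"
  proof -
    obtain x where x: "lookup a x \<noteq> lookup b x"
      using ab(3) poly_mapping_eqI[of a b] by auto
    then have "x \<in> keys a \<union> keys b" by (auto simp: in_keys_iff)
    then have "x \<in> set xs" using ab(1,2) by blast
    then show ?thesis using x by (rule grevlex_total)
  qed
  show "wfP (grevlex_less xs)"
    by (rule wfp_if_convertible_to_nat[of _ "grevlex_rank xs"]) (rule grevlex_rank_less)
qed

text \<open>Well-founded as the lexicographic product of the two ranks; the first rank depends only on the
  exponents of \<open>xs\<close>, so that it is constant while the second one decreases.\<close>

lemma monomial_order_product: "monomial_order (set xs \<union> set ys) (product_less xs ys)"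
proof
  fix a b c :: monomial
  show "\<not> product_less xs ys a a" by (simp add: product_less_def grevlex_irrefl)
  show "product_less xs ys a c" if "product_less xs ys a b" "product_less xs ys b c"
  proof -
    have "grevlex_less xs a c"
      if "grevlex_less xs a b" "\<forall>x\<in>set xs. lookup b x = lookup c x"
      using that grevlex_cong[of xs a a b c] by simp
    moreover have "grevlex_less xs a c"
      if "grevlex_less xs b c" "\<forall>x\<in>set xs. lookup a x = lookup b x"
      using that grevlex_cong[of xs a b c c] by simp
    moreover have "\<forall>x\<in>set xs. lookup a x = lookup c x"
      if "\<forall>x\<in>set xs. lookup a x = lookup b x"
        "\<forall>x\<in>set xs. lookup b x = lookup c x"
      using that by simp
    ultimately show ?thesis
      using that(1)[unfolded product_less_def] that(2)[unfolded product_less_def]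
        grevlex_trans[of xs a b c] grevlex_trans[of ys a b c]
      unfolding product_less_def by (elim disjE conjE) simp_all
  qed
  show "product_less xs ys a b \<or> product_less xs ys b a"
    if ab: "keys a \<subseteq> set xs \<union> set ys" "keys b \<subseteq> set xs \<union> set ys" "a \<noteq> b"
  proof (cases "\<exists>x\<in>set xs. lookup a x \<noteq> lookup b x")
    case True
    then show ?thesis using grevlex_total[of _ xs a b] unfolding product_less_def by blast
  next
    case False
    obtain x where x: "lookup a x \<noteq> lookup b x"
      using ab(3) poly_mapping_eqI[of a b] by auto
    then have "x \<in> keys a \<union> keys b" by (auto simp: in_keys_iff)
    then have "x \<in> set ys" using ab(1,2) False x by blast
    then show ?thesis using False grevlex_total[of x ys a b] x unfolding product_less_def by auto
  qed
  show "product_less xs ys (a + c) (b + c)" if "product_less xs ys a b"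
    using that by (auto simp: product_less_def grevlex_add lookup_add)
  have "wf (less_than <*lex*> less_than)" by (intro wf_lex_prod wf_less_than)
  then have "wf (inv_image (less_than <*lex*> less_than) (\<lambda>t. (grevlex_rank xs t, grevlex_rank ys t)))"
    by (rule wf_inv_image)
  moreover have "{(a, b). product_less xs ys a b} \<subseteq>
      inv_image (less_than <*lex*> less_than) (\<lambda>t. (grevlex_rank xs t, grevlex_rank ys t))"
  proof safe
    fix a b assume "product_less xs ys a b"
    then have "grevlex_rank xs a < grevlex_rank xs b \<or>
        grevlex_rank xs a = grevlex_rank xs b \<and> grevlex_rank ys a < grevlex_rank ys b"
      using grevlex_rank_less[of xs a b] grevlex_rank_less[of ys a b] grevlex_rank_cong[of xs a b]
      unfolding product_less_def by metis
    then show "(a, b) \<in> inv_image (less_than <*lex*> less_than) (\<lambda>t. (grevlex_rank xs t, grevlex_rank ys t))"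
      by simp
  qed
  ultimately show "wfP (product_less xs ys)"
    unfolding wfp_def by (rule wf_subset)
qed

section \<open>Specialization of Groebner bases\<close>

lemma set_L_vars: "set (L_vars m) = {L i j | i j. i < 3 \<and> j < m}"
  by (force simp: L_vars_def)

lemma set_V_vars: "set (V_vars m) = V ` {..<m}"
  by (auto simp: V_vars_def)

definition L_all :: "var set" where
  "L_all = {L i j | i j. True}"

lemma L_vars_subset_L_all: "set (L_vars m) \<subseteq> L_all"
  by (auto simp: set_L_vars L_all_def)

lemma prod_single:
  fixes g :: "'a \<Rightarrow> 'b::comm_semiring_1" and f :: "'a \<Rightarrow> 'c::comm_monoid_add"
  shows "finite A \<Longrightarrow> (\<Prod>x\<in>A. single (f x) (g x)) = single (sum f A) (prod g A)"
  by (induction A rule: finite_induct) (simp_all add: mult_single)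

lemma Var_power: "Var x ^ n = single (single x n) 1"
  by (induction n) (simp_all add: Var_def mult_single single_add[symmetric])

lemma Const_power: "Const c ^ n = Const (c ^ n)"
proof -
  interpret comm_ring_hom Const by (rule comm_ring_hom_Const)
  show ?thesis by (simp add: hom_power)
qed

definition camera_value :: "complex vec \<Rightarrow> var \<Rightarrow> complex" where
  "camera_value u x = (case x of L i j \<Rightarrow> 1 | V j \<Rightarrow> u $ j)"

text \<open>A monomial in \<open>\<ell>\<close> and \<open>v\<close> specializes to a scalar multiple of its \<open>\<ell>\<close>-monomial. Hence
  specialization can only delete or merge \<open>\<ell>\<close>-monomials, never create new ones.\<close>

lemma subst_mon_specialize:
  "subst_mon (specialize_var u) t = single (part L_all t) (subst_mon (camera_value u) t)"
proof -
  have "specialize_var u x ^ n =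
      single (if x \<in> L_all then single x n else 0) (camera_value u x ^ n)" for x n
    by (cases x) (simp_all add: specialize_var_def camera_value_def L_all_def Var_power Const_power[unfolded Const_def] Const_def)
  then show ?thesis
    unfolding subst_mon_def part_def by (simp add: prod_single)
qed

lemma specialize_single:
  "specialize u (single t c) = single (part L_all t) (c * subst_mon (camera_value u) t)"
  by (simp add: specialize_eq_subst subst_single comm_ring_hom_Const subst_mon_specialize Const_def mult_single)

lemma specialize_eq_sum:
  "specialize u p = (\<Sum>t\<in>keys p.
     single (part L_all t) (lookup p t * subst_mon (camera_value u) t))"
  unfolding specialize_eq_subst subst_def by (simp add: subst_mon_specialize Const_def mult_single)

lemma keys_specialize:
  assumes "s \<in> keys (specialize u p)"
  shows "\<exists>t\<in>keys p. s = part L_all t"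
  using subsetD[OF keys_sum assms[unfolded specialize_eq_sum]] by (auto split: if_splits)

lemma keys_part_L_all:
  assumes "p \<in> polys (set (L_vars m) \<union> set (V_vars m))" "t \<in> keys p"
  shows "keys (part L_all t) \<subseteq> set (L_vars m)"
proof -
  have "keys t \<subseteq> set (L_vars m) \<union> set (V_vars m)"
    using assms unfolding polys_def by blast
  moreover have "set (V_vars m) \<inter> L_all = {}" by (auto simp: set_V_vars L_all_def)
  ultimately show ?thesis unfolding keys_part by blast
qed

lemma specialize_polys:
  "p \<in> polys (set (L_vars m) \<union> set (V_vars m)) \<Longrightarrow> specialize u p \<in> polys (set (L_vars m))"
  unfolding polys_def[of "set (L_vars m)"] using keys_specialize keys_part_L_all by blast

text \<open>The non-strict comparison of \<open>\<ell>\<close>-monomials. It is only a preorder on monomials in \<open>\<ell>\<close> and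
  \<open>v\<close>, because it ignores \<open>v\<close>.\<close>

definition L_le :: "nat \<Rightarrow> monomial \<Rightarrow> monomial \<Rightarrow> bool" where
  "L_le m s t \<longleftrightarrow> grevlex_less (L_vars m) s t \<or>
     (\<forall>x\<in>set (L_vars m). lookup s x = lookup t x)"

lemma L_le_trans: "L_le m s t \<Longrightarrow> L_le m t r \<Longrightarrow> L_le m s r"
  using grevlex_trans[of "L_vars m" s t r] grevlex_cong[of "L_vars m" s s t r]
    grevlex_cong[of "L_vars m" s t r r]
  unfolding L_le_def by auto

lemma L_le_add: "L_le m (s + r) (t + r) \<longleftrightarrow> L_le m s t"
  by (simp add: L_le_def grevlex_add lookup_add)

lemma L_le_cong:
  assumes "\<And>x. x \<in> set (L_vars m) \<Longrightarrow> lookup a x = lookup a' x"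
    "\<And>x. x \<in> set (L_vars m) \<Longrightarrow> lookup b x = lookup b' x"
  shows "L_le m a b \<longleftrightarrow> L_le m a' b'"
  using grevlex_cong[of "L_vars m" a a' b b'] assms unfolding L_le_def by simp

lemma L_le_refl: "L_le m s s"
  by (simp add: L_le_def)

lemma product_less_imp_L_le: "product_less (L_vars m) ys s t \<Longrightarrow> L_le m s t"
  by (auto simp: product_less_def L_le_def)

lemma lookup_part_L_vars: "x \<in> set (L_vars m) \<Longrightarrow> lookup (part L_all t) x = lookup t x"
  using L_vars_subset_L_all by (auto simp: lookup_part)

text \<open>The division algorithm, followed at the coefficient of \<open>t\<close> only. Each step subtracts a multiple
  \<open>q g\<close> whose \<open>\<ell>\<close>-monomials are at most \<open>t\<close>. If the coefficient of \<open>t\<close> survives specialization in the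
  remainder, the induction continues with the remainder; otherwise it must be nonzero in the
  specialization of \<open>q g\<close>, and then \<open>t\<close> comes from the leading \<open>\<ell>\<close>-monomial of \<open>g\<close>, whose coefficient is
  not destroyed. The leading coefficients of other elements of \<open>G\<close> may well vanish at \<open>u\<close>.\<close>

lemma divisor_after_specialization:
  fixes m u
  defines "X \<equiv> set (L_vars m) \<union> set (V_vars m)"
    and "lt \<equiv> product_less (L_vars m) (V_vars m)"
  assumes S: "S \<subseteq> polys X"
    and G: "groebner_basis X lt (Idl\<^bsub>poly_ring X\<^esub> S) G"
    and h: "h \<in> Idl\<^bsub>poly_ring X\<^esub> S"
    and le: "\<And>s. s \<in> keys h \<Longrightarrow> L_le m s t"
    and t: "lookup (specialize u h) t \<noteq> 0"
  shows "\<exists>g\<in>G. specialize u g \<noteq> 0 \<and>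
    monomial_dvd (leading_monomial (grevlex_less (L_vars m)) (specialize u g)) t"
proof -
  let ?I = "Idl\<^bsub>poly_ring X\<^esub> S"
  interpret O: monomial_order X lt
    unfolding X_def lt_def by (rule monomial_order_product)
  interpret OL: monomial_order "set (L_vars m)" "grevlex_less (L_vars m)"
    by (rule monomial_order_grevlex)
  interpret sp: comm_ring_hom "specialize u" by (rule comm_ring_hom_specialize)
  have I: "?I \<subseteq> polys X" by (rule idl_subset_polys[OF S])
  have GI: "G \<subseteq> ?I" and init: "initial_ideal X lt G = initial_ideal X lt ?I"
    using G unfolding groebner_basis_def by auto
  show ?thesis using h le t
  proof (induction "leading_monomial lt h" arbitrary: h rule: wfp_induct_rule[OF O.wf])
    case (1 h)
    have h0: "h \<noteq> 0" using "1.prems"(3) by (auto simp: sp.hom_zero)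
    have hX: "h \<in> polys X" using "1.prems"(1) I by blast
    have "leading_term lt h \<in> initial_ideal X lt ?I"
      unfolding leading_term_def using O.leading_monomial(1)[OF hX h0] hX
      by (intro O.leading_term_in_initial_ideal[OF I "1.prems"(1) h0])
        (auto simp: monomial_dvd_def polys_def intro: exI[of _ 0])
    then have "leading_term lt h \<in> initial_ideal X lt G" by (simp add: init)
    moreover have "leading_monomial lt h \<in> keys (leading_term lt h)"
      using O.leading_coeff_nonzero[OF hX h0] by (simp add: leading_term_def)
    ultimately have "\<exists>g\<in>G - {0}. monomial_dvd (leading_monomial lt g) (leading_monomial lt h)"
      by (intro O.initial_ideal_keys[of G]) (use GI I in auto)
    then obtain g r where g: "g \<in> G" "g \<noteq> 0" and r: "leading_monomial lt h = leading_monomial lt g + r"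
      unfolding monomial_dvd_def by blast
    have gX: "g \<in> polys X" using g(1) GI I by blast
    let ?lg = "leading_monomial lt g" and ?lh = "leading_monomial lt h"
    define q where "q = single r (leading_coeff lt h / leading_coeff lt g)"
    have "keys ?lh \<subseteq> X"
      using O.leading_monomial(1)[OF hX h0] hX unfolding polys_def by blast
    then have "keys r \<subseteq> X" unfolding r by (auto simp: in_keys_iff lookup_add)
    then have qX: "q \<in> polys X" unfolding q_def by (rule polys_single)
    have keys_qg: "\<exists>s\<in>keys g. k = r + s" if "k \<in> keys (q * g)" for k
      using keys_mult[of q g] that by (auto simp: q_def split: if_splits)
    have lookup_qg: "lookup (q * g) ?lh = leading_coeff lt h"
    proof -
      have "lookup (q * g) (r + s) = leading_coeff lt h / leading_coeff lt g * lookup g s" for s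
      proof -
        have "q * g = (\<Sum>s\<in>keys g. single (r + s) (leading_coeff lt h / leading_coeff lt g * lookup g s))"
          by (subst (1) poly_eq_sum_singles[of g]) (simp add: q_def sum_distrib_left mult_single)
        then show ?thesis by (simp add: lookup_sum lookup_single when_def in_keys_iff)
      qed
      then show ?thesis using O.leading_coeff_nonzero[OF gX g(2)]
        by (simp add: r add.commute[of ?lg] leading_coeff_def[of lt g])
    qed
    define h' where "h' = h - q * g"
    have h'I: "h' \<in> ?I" unfolding h'_def
      by (intro idl_minus[OF S] idl_mult[OF S] qX "1.prems"(1) subsetD[OF GI g(1)])
    have less: "lt s ?lh" if s: "s \<in> keys h'" for s
    proof -
      have "s \<noteq> ?lh" using s by (auto simp: h'_def in_keys_iff lookup_minus lookup_qg leading_coeff_def)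
      consider (left) "s \<in> keys h" | (right) "s \<in> keys (q * g)"
        using s keys_minus_mpoly[of h "q * g"] unfolding h'_def by blast
      then show ?thesis
      proof cases
        case left
        then show ?thesis using O.leading_monomial(2)[OF hX h0] \<open>s \<noteq> ?lh\<close> by blast
      next
        case right
        then obtain s' where s': "s' \<in> keys g" "s = r + s'" using keys_qg by blast
        then have "s' \<noteq> ?lg" using \<open>s \<noteq> ?lh\<close> by (auto simp: r add.commute)
        then have "lt (s' + r) (?lg + r)"
          using O.leading_monomial(2)[OF gX g(2) s'(1)] by (intro O.add_mono) blast
        then show ?thesis by (simp add: s'(2) r add.commute)
      qed
    qed
    have lht: "L_le m ?lh t" using "1.prems"(2) O.leading_monomial(1)[OF hX h0] by blast
    \<comment> \<open>The coefficient of \<open>t\<close> in \<open>h\<close> is split between the remainder and the subtracted \<open>q g\<close>.\<close>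
    show ?case
    proof (cases "lookup (specialize u h') t = 0")
      case False
      then have "h' \<noteq> 0" by (auto simp: sp.hom_zero)
      have "lt (leading_monomial lt h') ?lh"
        using O.leading_monomial(1)[of h'] h'I I \<open>h' \<noteq> 0\<close> less by blast
      moreover have "L_le m s t" if "s \<in> keys h'" for s
        using less[OF that] lht unfolding lt_def by (blast intro: L_le_trans product_less_imp_L_le)
      ultimately show ?thesis using "1.hyps"[OF _ h'I _ False] by blast
    next
      case True
      let ?su = "specialize u g"
      have "specialize u h = specialize u h' + specialize u q * ?su"
        by (simp add: h'_def sp.hom_minus sp.hom_mult)
      then have "lookup (specialize u q * ?su) t \<noteq> 0"
        using True "1.prems"(3) by (simp add: lookup_add)
      then have "t \<in> keys (specialize u q * ?su)" by (simp add: in_keys_iff)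
      then obtain k s where ks: "t = k + s" "k \<in> keys (specialize u q)" "s \<in> keys ?su"
        using keys_mult by blast
      have k: "k = part L_all r"
        using ks(2) by (auto simp: q_def specialize_single split: if_splits)
      obtain s0 where s0: "s0 \<in> keys g" "s = part L_all s0"
        using keys_specialize[OF ks(3)] by blast
      have "L_le m (?lg + r) (s0 + r) \<longleftrightarrow> L_le m ?lh t"
        by (rule L_le_cong) (simp_all add: r ks(1) k s0(2) lookup_add lookup_part_L_vars)
      then have lg: "L_le m ?lg s0" using lht by (simp add: L_le_add)
      have "leading_monomial (grevlex_less (L_vars m)) ?su = s"
      proof (rule OL.leading_monomial_eqI[OF ks(3)])
        fix s' assume s': "s' \<in> keys ?su" "s' \<noteq> s"
        obtain s1 where s1: "s1 \<in> keys g" "s' = part L_all s1"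
          using keys_specialize[OF s'(1)] by blast
        have "L_le m s1 ?lg"
          using O.leading_monomial(2)[OF gX g(2) s1(1)] product_less_imp_L_le L_le_refl
          unfolding lt_def by metis
        then have "L_le m s1 s0" using lg by (rule L_le_trans)
        moreover have "L_le m s1 s0 \<longleftrightarrow> L_le m s' s"
          by (rule L_le_cong) (simp_all add: s1 s0 lookup_part_L_vars)
        ultimately have "L_le m s' s" by simp
        moreover have "\<not> (\<forall>x\<in>set (L_vars m). lookup s' x = lookup s x)"
        proof
          assume eq: "\<forall>x\<in>set (L_vars m). lookup s' x = lookup s x"
          have "keys s' \<subseteq> set (L_vars m)" "keys s \<subseteq> set (L_vars m)"
            using keys_part_L_all[of g m] gX s0 s1 unfolding X_def by auto
          then have "lookup s' x = lookup s x" for x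
            using eq by (metis not_in_keys_iff_lookup_eq_zero subsetD)
          then show False using s'(2) poly_mapping_eqI[of s' s] by blast
        qed
        ultimately show "grevlex_less (L_vars m) s' s" unfolding L_le_def by blast
      qed
      moreover have "?su \<noteq> 0" using ks(3) by auto
      moreover have "monomial_dvd s t" unfolding monomial_dvd_def ks(1) by (intro exI[of _ k]) (rule add.commute)
      ultimately show ?thesis using g(1) by auto
    qed
  qed
qed

lemma specialize_genideal:
  assumes S: "S \<subseteq> polys (set (L_vars m) \<union> set (V_vars m))" and T: "T \<subseteq> polys (set (L_vars m))"
    and ST: "specialize u ` S \<subseteq> Idl\<^bsub>poly_ring (set (L_vars m))\<^esub> T"
    and p: "p \<in> Idl\<^bsub>poly_ring (set (L_vars m) \<union> set (V_vars m))\<^esub> S"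
  shows "specialize u p \<in> Idl\<^bsub>poly_ring (set (L_vars m))\<^esub> T"
proof -
  let ?X = "set (L_vars m) \<union> set (V_vars m)" and ?J = "Idl\<^bsub>poly_ring (set (L_vars m))\<^esub> T"
  interpret sp: comm_ring_hom "specialize u" by (rule comm_ring_hom_specialize)
  have "p \<in> {p \<in> polys ?X. specialize u p \<in> ?J}"
    using p
  proof (rule genideal_poly_ring_induct)
    show "S \<subseteq> {p \<in> polys ?X. specialize u p \<in> ?J}" using S ST by blast
  qed (use polys_zero polys_plus polys_times specialize_polys[of _ m u] in
      \<open>auto simp: sp.hom_zero sp.hom_add sp.hom_mult intro!: idl_zero[OF T] idl_add[OF T] idl_mult[OF T]\<close>)
  then show ?thesis by simp
qed

lemma groebner_basis_specialize:
  fixes m u T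
  defines "X \<equiv> set (L_vars m) \<union> set (V_vars m)"
    and "lt \<equiv> product_less (L_vars m) (V_vars m)"
    and "ltL \<equiv> grevlex_less (L_vars m)"
  defines "J \<equiv> Idl\<^bsub>poly_ring (set (L_vars m))\<^esub> T"
  assumes S: "S \<subseteq> polys X" and T: "T \<subseteq> polys (set (L_vars m))"
    and ST: "specialize u ` S \<subseteq> J"
    and G: "groebner_basis X lt (Idl\<^bsub>poly_ring X\<^esub> S) G"
    and lift: "\<And>f. f \<in> J \<Longrightarrow> f \<noteq> 0 \<Longrightarrow> \<exists>h t. h \<in> Idl\<^bsub>poly_ring X\<^esub> S \<and>
      (\<forall>s\<in>keys h. L_le m s t) \<and> lookup (specialize u h) t \<noteq> 0 \<and>
      monomial_dvd t (leading_monomial ltL f)"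
  shows "groebner_basis (set (L_vars m)) ltL J (specialize u ` G)"
proof -
  let ?Y = "set (L_vars m)"
  interpret OL: monomial_order ?Y ltL
    unfolding ltL_def by (rule monomial_order_grevlex)
  have J: "J \<subseteq> polys ?Y" unfolding J_def by (rule idl_subset_polys[OF T])
  have fin: "finite G" and GI: "G \<subseteq> Idl\<^bsub>poly_ring X\<^esub> S"
    using G unfolding groebner_basis_def by auto
  then have GJ: "specialize u ` G \<subseteq> J"
    using specialize_genideal[of S m T u] S T ST unfolding J_def X_def by blast
  have lts: "leading_term ltL ` (K - {0}) \<subseteq> polys ?Y" if "K \<subseteq> J" for K
    using that J OL.leading_term_polys by blast
  have "initial_ideal ?Y ltL (specialize u ` G) = initial_ideal ?Y ltL J"
  proof
    interpret cring "poly_ring ?Y" by (rule cring_poly_ring)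
    show "initial_ideal ?Y ltL (specialize u ` G) \<subseteq> initial_ideal ?Y ltL J"
      unfolding initial_ideal_def
      by (rule genideal_minimal[OF genideal_ideal])
        (use lts[of J] idl_superset[OF lts[of J]] GJ in \<open>simp, blast\<close>)
    show "initial_ideal ?Y ltL J \<subseteq> initial_ideal ?Y ltL (specialize u ` G)"
      unfolding initial_ideal_def[of _ _ J]
    proof (rule genideal_minimal)
      show "ideal (initial_ideal ?Y ltL (specialize u ` G)) (poly_ring ?Y)"
        unfolding initial_ideal_def by (rule genideal_ideal) (use lts[OF GJ] in simp)
      show "leading_term ltL ` (J - {0}) \<subseteq> initial_ideal ?Y ltL (specialize u ` G)"
      proof (rule image_subsetI)
        fix f assume "f \<in> J - {0}"
        then have f: "f \<in> J" "f \<noteq> 0" by auto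
        obtain h t where h: "h \<in> Idl\<^bsub>poly_ring X\<^esub> S" "\<forall>s\<in>keys h. L_le m s t"
          "lookup (specialize u h) t \<noteq> 0" "monomial_dvd t (leading_monomial ltL f)"
          using lift[OF f] by blast
        obtain g where g: "g \<in> G" "specialize u g \<noteq> 0" "monomial_dvd (leading_monomial ltL (specialize u g)) t"
          using divisor_after_specialization[of S m G h t u] S G h
          unfolding X_def lt_def ltL_def by blast
        have "monomial_dvd (leading_monomial ltL (specialize u g)) (leading_monomial ltL f)"
          using g(3) h(4) unfolding monomial_dvd_def by (metis add.assoc)
        moreover have "keys (leading_monomial ltL f) \<subseteq> ?Y"
          using OL.leading_monomial(1)[of f] f J unfolding polys_def by blast
        ultimately show "leading_term ltL f \<in> initial_ideal ?Y ltL (specialize u ` G)"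
          unfolding leading_term_def
          by (intro OL.leading_term_in_initial_ideal[of _ "specialize u g"]) (use g GJ J in auto)
      qed
    qed
  qed
  then show ?thesis unfolding groebner_basis_def using fin GJ by simp
qed

section \<open>Exponent patterns determined by their sums\<close>

text \<open>If at most one position is partially filled, everything on one side of it being full and
  everything on the other side empty, then the exponents are determined by their sum. The relation
  \<open>R\<close> is \<open><\<close> or \<open>>\<close>, depending on the side that is filled first.\<close>

lemma sorted_unique:
  fixes x y r :: "nat \<Rightarrow> nat"
  assumes "finite S"
    and bound: "\<And>i. i \<in> S \<Longrightarrow> x i \<le> r i" "\<And>i. i \<in> S \<Longrightarrow> y i \<le> r i"
    and R: "\<And>i j. i \<in> S \<Longrightarrow> j \<in> S \<Longrightarrow> i \<noteq> j \<Longrightarrow> R i j \<or> R j i"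
    and x: "\<And>i j. i \<in> S \<Longrightarrow> j \<in> S \<Longrightarrow> R i j \<Longrightarrow> x i > 0 \<Longrightarrow> x j = r j"
    and y: "\<And>i j. i \<in> S \<Longrightarrow> j \<in> S \<Longrightarrow> R i j \<Longrightarrow> y i > 0 \<Longrightarrow> y j = r j"
    and sum: "sum x S = sum y S"
  shows "\<forall>i\<in>S. x i = y i"
proof (rule ccontr)
  assume ne: "\<not> (\<forall>i\<in>S. x i = y i)"
  have "\<exists>i\<in>S. x i < y i"
  proof (rule ccontr)
    assume "\<not> (\<exists>i\<in>S. x i < y i)"
    then have "\<forall>i\<in>S. y i \<le> x i" by (simp add: not_less)
    moreover from this have "\<exists>i\<in>S. y i < x i" using ne by (metis le_neq_implies_less)
    ultimately have "sum y S < sum x S" using \<open>finite S\<close> by (intro sum_strict_mono_ex1)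
    then show False using sum by simp
  qed
  moreover have "\<exists>i\<in>S. y i < x i"
  proof (rule ccontr)
    assume "\<not> (\<exists>i\<in>S. y i < x i)"
    then have "\<forall>i\<in>S. x i \<le> y i" by (simp add: not_less)
    moreover from this have "\<exists>i\<in>S. x i < y i" using ne by (metis le_neq_implies_less)
    ultimately have "sum x S < sum y S" using \<open>finite S\<close> by (intro sum_strict_mono_ex1)
    then show False using sum by simp
  qed
  ultimately obtain i j where ij: "i \<in> S" "x i < y i" "j \<in> S" "y j < x j" by blast
  then have "i \<noteq> j" by auto
  then consider "R i j" | "R j i" using R ij by blast
  then show False
  proof cases
    case 1
    then show False using y[OF ij(1,3) 1] ij bound(1)[OF ij(3)] by simp
  next
    case 2
    then show False using x[OF ij(3,1) 2] ij bound(2)[OF ij(1)] by simp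
  qed
qed

lemma sum_split_at:
  fixes f :: "nat \<Rightarrow> nat"
  assumes "q < n"
  shows "(\<Sum>j<n. f j) = (\<Sum>j<q. f j) + f q + (\<Sum>j\<in>{q<..<n}. f j)"
proof -
  have "{..<n} = {..<q} \<union> ({q} \<union> {q<..<n})" using assms by auto
  then have "(\<Sum>j<n. f j) = sum f ({..<q} \<union> ({q} \<union> {q<..<n}))" by simp
  also have "\<dots> = (\<Sum>j<q. f j) + sum f ({q} \<union> {q<..<n})" by (rule sum.union_disjoint) auto
  also have "sum f ({q} \<union> {q<..<n}) = f q + sum f {q<..<n}" by simp
  finally show ?thesis by simp
qed

text \<open>Exponents \<open>a j, b j, c j\<close> of the three variables in column \<open>j\<close>, read as a word sorted by columns;
  no letter patterns \<open>b..a..a\<close>, \<open>c..a\<close>, \<open>a..c..b\<close>, \<open>c..c..b\<close> occur in increasing columns. The column \<open>q\<close>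
  contains the place that comes directly after the first \<open>\<Sum>j. a j\<close> places, and no \<open>b\<close>. Under these
  conditions the word is determined by the column sums and by the numbers of letters \<open>a\<close> and \<open>b\<close>.\<close>

locale abc_word =
  fixes a b c d :: "nat \<Rightarrow> nat" and n q :: nat
  assumes col: "j < n \<Longrightarrow> a j + b j + c j = d j"
    and baa: "i < j \<Longrightarrow> j < k \<Longrightarrow> k < n \<Longrightarrow> b i > 0 \<Longrightarrow> a j > 0 \<Longrightarrow> a k > 0 \<Longrightarrow> False"
    and ca: "i < j \<Longrightarrow> j < n \<Longrightarrow> c i > 0 \<Longrightarrow> a j > 0 \<Longrightarrow> False"
    and acb: "i < j \<Longrightarrow> j < k \<Longrightarrow> k < n \<Longrightarrow> a i > 0 \<Longrightarrow> c j > 0 \<Longrightarrow> b k > 0 \<Longrightarrow> False"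
    and ccb: "i < j \<Longrightarrow> j < k \<Longrightarrow> k < n \<Longrightarrow> c i > 0 \<Longrightarrow> c j > 0 \<Longrightarrow> b k > 0 \<Longrightarrow> False"
    and q: "q < n" "(\<Sum>j<q. d j) \<le> (\<Sum>j<n. a j)" "(\<Sum>j<n. a j) < (\<Sum>j<q. d j) + d q"
    and bq: "b q = 0"
begin

lemma not_b_at_q: "a q > 0 \<or> c q > 0"
  using q col[of q] bq by linarith

lemma exponents_le: "j < n \<Longrightarrow> a j \<le> d j" "j < n \<Longrightarrow> b j \<le> d j"
  using col[of j] by linarith+

lemma sum_a_less:
  assumes "i < q" "a i < d i"
  shows "(\<Sum>j<q. a j) < (\<Sum>j<q. d j)"
  by (rule sum_strict_mono_ex1) (use assms exponents_le q in \<open>auto intro!: bexI[of _ i]\<close>)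

text \<open>A letter \<open>c\<close> before \<open>q\<close> would force all letters \<open>a\<close> into the columns before \<open>q\<close>, where there
  would then be too little space for them.\<close>

lemma c_before: assumes "i < q" shows "c i = 0"
proof (rule ccontr)
  assume "c i \<noteq> 0"
  then have "a j = 0" if "i < j" "j < n" for j using ca[of i j] that by auto
  then have "(\<Sum>j<n. a j) = (\<Sum>j<q. a j)"
    using sum_split_at[OF q(1), of a] assms q(1) by simp
  also have "\<dots> < (\<Sum>j<q. d j)"
    using assms \<open>c i \<noteq> 0\<close> col[of i] q(1) by (intro sum_a_less) auto
  finally show False using q(2) by simp
qed

text \<open>A letter \<open>a\<close> after \<open>q\<close> would fill all columns up to \<open>q\<close> with letters \<open>a\<close>, which are too
  many.\<close>

lemma a_after: assumes "q < k" "k < n" shows "a k = 0"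
proof (rule ccontr)
  assume "a k \<noteq> 0"
  then have c0: "c j = 0" if "j \<le> q" for j using ca[of j k] that assms by auto
  then have aq: "a q > 0" using not_b_at_q by auto
  then have "b i = 0" if "i < q" for i using baa[of i q k] that \<open>a k \<noteq> 0\<close> assms by auto
  then have ad: "a j = d j" if "j \<le> q" for j
    using col[of j] c0[of j] that bq q(1) by (cases "j = q") auto
  have "(\<Sum>j<q. d j) + d q \<le> (\<Sum>j<n. a j)"
    using sum_split_at[OF q(1), of a] ad by simp
  then show False using q(3) by simp
qed

lemma sum_a: "(\<Sum>j<n. a j) = (\<Sum>j<q. a j) + a q"
  using sum_split_at[OF q(1), of a] a_after by simp

lemma b_before: assumes "i < j" "j < q" "b i > 0" shows "b j = d j"
proof (rule ccontr)
  assume "b j \<noteq> d j"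
  then have "a j > 0" using col[of j] c_before[of j] assms q(1) by simp
  then have "a q = 0" using baa[of i j q] assms q(1) by auto
  then have "(\<Sum>j<n. a j) < (\<Sum>j<q. d j)"
    using sum_a sum_a_less[of i] col[of i] assms q(1) by simp
  then show False using q(2) by simp
qed

lemma b_after: assumes "q < j" "j < k" "k < n" "b k > 0" shows "b j = d j"
proof (rule ccontr)
  assume "b j \<noteq> d j"
  then have "c j > 0" using col[of j] a_after[of j] assms by simp
  then show False using acb[of q j k] ccb[of q j k] assms not_b_at_q by auto
qed

text \<open>The number of letters \<open>b\<close> before \<open>q\<close> is as large as the counts permit: if some \<open>b\<close> comes after \<open>q\<close>
  and some \<open>a\<close> before it, then a \<open>c\<close> in column \<open>q\<close> would complete the pattern \<open>a..c..b\<close>.\<close>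

lemma sum_b_before:
  "(\<Sum>j<q. b j) = min (\<Sum>j<n. b j) (min (\<Sum>j<q. d j) ((\<Sum>j<q. d j) + d q - (\<Sum>j<n. a j)))"
proof -
  have D: "(\<Sum>j<q. d j) = (\<Sum>j<q. a j) + (\<Sum>j<q. b j)"
  proof -
    have "d j = a j + b j" if "j < q" for j
      using col[of j] c_before[of j] q(1) that by simp
    then show ?thesis by (simp add: sum.distrib)
  qed
  have B: "(\<Sum>j<n. b j) = (\<Sum>j<q. b j) + (\<Sum>j\<in>{q<..<n}. b j)"
    using sum_split_at[OF q(1), of b] bq by simp
  have aq: "a q \<le> d q" using exponents_le q(1) by blast
  have "a q = d q" if nz: "(\<Sum>j\<in>{q<..<n}. b j) \<noteq> 0" "(\<Sum>j<q. a j) \<noteq> 0"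
  proof -
    obtain k where k: "k \<in> {q<..<n}" "b k \<noteq> 0" using nz(1) by (rule sum.not_neutral_contains_not_neutral)
    obtain i where i: "i \<in> {..<q}" "a i \<noteq> 0" using nz(2) by (rule sum.not_neutral_contains_not_neutral)
    have "c q = 0" using acb[of i q k] i k by auto
    then show ?thesis using col[of q] bq q(1) by simp
  qed
  then show ?thesis using D B aq sum_a q by linarith
qed

end

text \<open>Before \<open>q\<close> the letters \<open>b\<close> come last and after \<open>q\<close> they come first, so their positions are determined
  by the number of them before \<open>q\<close>. In the remaining places all \<open>a\<close> come before all \<open>c\<close>.\<close>

lemma abc_word_unique:
  assumes 1: "abc_word a b c d n q" and 2: "abc_word a' b' c' d n q"
    and suma: "(\<Sum>j<n. a j) = (\<Sum>j<n. a' j)" and sumb: "(\<Sum>j<n. b j) = (\<Sum>j<n. b' j)"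
    and j: "j < n"
  shows "a j = a' j \<and> b j = b' j \<and> c j = c' j"
proof -
  interpret w: abc_word a b c d n q by (rule 1)
  interpret w': abc_word a' b' c' d n q by (rule 2)
  have before: "(\<Sum>j<q. b j) = (\<Sum>j<q. b' j)"
    by (simp only: w.sum_b_before w'.sum_b_before suma sumb)
  have b1: "\<forall>j\<in>{..<q}. b j = b' j"
    by (rule sorted_unique[where r = d and R = "(<)"])
      (use w.exponents_le w'.exponents_le w.q w.b_before w'.b_before before in auto)
  have after: "(\<Sum>j\<in>{q<..<n}. b j) = (\<Sum>j\<in>{q<..<n}. b' j)"
    using sumb before w.bq w'.bq sum_split_at[OF w.q(1), of b] sum_split_at[OF w.q(1), of b'] by simp
  have b2: "\<forall>j\<in>{q<..<n}. b j = b' j"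
    by (rule sorted_unique[where r = d and R = "(>)"])
      (use w.exponents_le w'.exponents_le w.q w.b_after w'.b_after after in auto)
  have b: "b j = b' j" if "j < n" for j
    using b1 b2 that w.bq w'.bq by (cases j q rule: linorder_cases) auto
  have "\<forall>j\<in>{..<n}. a j = a' j"
  proof (rule sorted_unique[where r = "\<lambda>j. d j - b j" and R = "(>)"])
    show "a j = d j - b j" if "i \<in> {..<n}" "j \<in> {..<n}" "i > j" "a i > 0" for i j
    proof -
      have "c j = 0" using that w.ca[of j i] by (metis gr0I lessThan_iff)
      then show ?thesis using w.col[of j] that by auto
    qed
    show "a' j = d j - b j" if "i \<in> {..<n}" "j \<in> {..<n}" "i > j" "a' i > 0" for i j
    proof -
      have "c' j = 0" using that w'.ca[of j i] by (metis gr0I lessThan_iff)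
      then show ?thesis using w'.col[of j] b[of j] that by auto
    qed
    show "a i \<le> d i - b i" if "i \<in> {..<n}" for i using w.col[of i] that by simp
    show "a' i \<le> d i - b i" if "i \<in> {..<n}" for i using w'.col[of i] b[of i] that by simp
  qed (use suma in auto)
  then show ?thesis using b[OF j] w.col[OF j] w'.col[OF j] j by auto
qed

section \<open>Standard monomials\<close>

text \<open>The supports of the squarefree monomials that will turn out to be leading monomials of the
  specialized ideal. The names spell the coordinates, in the order of the indices \<open>i, j, k, l\<close>.\<close>

inductive_set forbidden :: "var set set" where
  baa: "i < j \<Longrightarrow> j < k \<Longrightarrow> {L 1 i, L 0 j, L 0 k} \<in> forbidden"
| caa: "i < j \<Longrightarrow> j < k \<Longrightarrow> {L 2 i, L 0 j, L 0 k} \<in> forbidden"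
| cab: "i < j \<Longrightarrow> i < k \<Longrightarrow> j \<noteq> k \<Longrightarrow> {L 2 i, L 0 j, L 1 k} \<in> forbidden"
| ccbb: "i < j \<Longrightarrow> j < k \<Longrightarrow> k < l \<Longrightarrow> {L 2 i, L 2 j, L 1 k, L 1 l} \<in> forbidden"
| acbb: "i < j \<Longrightarrow> j < k \<Longrightarrow> k < l \<Longrightarrow> {L 0 i, L 2 j, L 1 k, L 1 l} \<in> forbidden"

definition standard :: "monomial \<Rightarrow> bool" where
  "standard t \<longleftrightarrow> (\<forall>F\<in>forbidden. \<not> F \<subseteq> keys t)"

lemma standard_mono: "standard t \<Longrightarrow> keys s \<subseteq> keys t \<Longrightarrow> standard s"
  unfolding standard_def by blast

lemma standardD:
  assumes "standard t"
  shows "i < j \<Longrightarrow> j < k \<Longrightarrow> L 1 i \<in> keys t \<Longrightarrow> L 0 j \<in> keys t \<Longrightarrow> L 0 k \<in> keys t \<Longrightarrow> False"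
    and "i < j \<Longrightarrow> j < k \<Longrightarrow> L 2 i \<in> keys t \<Longrightarrow> L 0 j \<in> keys t \<Longrightarrow> L 0 k \<in> keys t \<Longrightarrow> False"
    and "i < j \<Longrightarrow> i < k \<Longrightarrow> j \<noteq> k \<Longrightarrow> L 2 i \<in> keys t \<Longrightarrow> L 0 j \<in> keys t \<Longrightarrow> L 1 k \<in> keys t \<Longrightarrow> False"
    and "i < j \<Longrightarrow> j < k \<Longrightarrow> k < l \<Longrightarrow> L 2 i \<in> keys t \<Longrightarrow> L 2 j \<in> keys t \<Longrightarrow> L 1 k \<in> keys t \<Longrightarrow> L 1 l \<in> keys t \<Longrightarrow> False"
    and "i < j \<Longrightarrow> j < k \<Longrightarrow> k < l \<Longrightarrow> L 0 i \<in> keys t \<Longrightarrow> L 2 j \<in> keys t \<Longrightarrow> L 1 k \<in> keys t \<Longrightarrow> L 1 l \<in> keys t \<Longrightarrow> False"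
  using assms forbidden.baa[of i j k] forbidden.caa[of i j k] forbidden.cab[of i j k]
    forbidden.ccbb[of i j k l] forbidden.acbb[of i j k l]
  unfolding standard_def by (meson empty_subsetI insert_subset)+

section \<open>Linear independence of the standard monomials\<close>

lemma lookup_pos_iff: "lookup t x > 0 \<longleftrightarrow> x \<in> keys (t :: monomial)"
  by (simp add: in_keys_iff)

text \<open>The one step of every peeling argument: at a zero of the value of \<open>x\<close> only \<open>r\<close> survives, and if
  \<open>r\<close> vanishes then \<open>x\<close> can be cancelled.\<close>

lemma split_by_variable:
  fixes p :: mpoly
  obtains r s where "p = r + Var x * s"
    "\<And>t. t \<in> keys r \<Longrightarrow> t \<in> keys p \<and> x \<notin> keys t"
    "\<And>t. t \<in> keys s \<Longrightarrow> single x 1 + t \<in> keys p"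
proof -
  let ?K = "{t \<in> keys p. x \<in> keys t}"
  let ?R = "{t \<in> keys p. x \<notin> keys t}"
  let ?e = "single x (1::nat)"
  have dec: "?e + (t - ?e) = t" if "x \<in> keys t" for t :: monomial
    by (rule poly_mapping_eqI) (use that in \<open>auto simp: lookup_add lookup_minus lookup_single in_keys_iff when_def\<close>)
  define r where "r = (\<Sum>t\<in>?R. single t (lookup p t))"
  define s where "s = (\<Sum>t\<in>?K. single (t - ?e) (lookup p t))"
  have s: "Var x * s = (\<Sum>t\<in>?K. single t (lookup p t))"
    unfolding s_def sum_distrib_left Var_def mult_single
    by (rule sum.cong) (simp_all only: dec mem_Collect_eq simp_thms mult_1)
  have "p = (\<Sum>t\<in>?R \<union> ?K. single t (lookup p t))"
    by (subst poly_eq_sum_singles) (rule sum.cong, auto)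
  also have "\<dots> = r + Var x * s"
    unfolding r_def s by (rule sum.union_disjoint) auto
  finally have p: "p = r + Var x * s" .
  have "keys r \<subseteq> ?R"
    unfolding r_def by (rule order_trans[OF keys_sum]) (auto split: if_splits)
  moreover have "keys s \<subseteq> (\<lambda>t. t - ?e) ` ?K"
    unfolding s_def by (rule order_trans[OF keys_sum]) (auto split: if_splits)
  ultimately show ?thesis using that[OF p] dec by fastforce
qed

text \<open>The translation ideal is homogeneous for the degree in each column \<open>j\<close> and for the degree in each
  of the three coordinates \<open>i\<close>.\<close>

definition multidegree :: "nat \<Rightarrow> (nat \<Rightarrow> nat) \<Rightarrow> (nat \<Rightarrow> nat) \<Rightarrow> monomial \<Rightarrow> bool" where
  "multidegree n d \<tau> t \<longleftrightarrow> keys t \<subseteq> set (L_vars n) \<and>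
     (\<forall>j<n. (\<Sum>i<3. lookup t (L i j)) = d j) \<and>
     (\<forall>i<3. (\<Sum>j<n. lookup t (L i j)) = \<tau> i)"

lemma sum_lessThan_3: "(\<Sum>i<3. f i) = f 0 + f 1 + f 2" for f :: "nat \<Rightarrow> nat"
  by (simp add: numeral_eq_Suc)

lemma multidegree_col:
  "multidegree n d \<tau> t \<Longrightarrow> j < n \<Longrightarrow>
    lookup t (L 0 j) + lookup t (L 1 j) + lookup t (L 2 j) = d j"
  unfolding multidegree_def by (simp add: sum_lessThan_3)

lemma multidegree_row:
  "multidegree n d \<tau> t \<Longrightarrow> (\<Sum>j<n. lookup t (L 0 j)) = \<tau> 0"
  "multidegree n d \<tau> t \<Longrightarrow> (\<Sum>j<n. lookup t (L 1 j)) = \<tau> 1"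
  "multidegree n d \<tau> t \<Longrightarrow> (\<Sum>j<n. lookup t (L 2 j)) = \<tau> 2"
  unfolding multidegree_def by simp_all

lemma multidegree_less:
  "multidegree n d \<tau> t \<Longrightarrow> L i j \<in> keys t \<Longrightarrow> j < n \<and> i < 3"
  unfolding multidegree_def set_L_vars by blast

lemma multidegree_eqI:
  assumes "multidegree n d \<tau> t" "multidegree n d' \<tau>' t'"
    "\<And>j. j < n \<Longrightarrow> lookup t (L 0 j) = lookup t' (L 0 j) \<and>
       lookup t (L 1 j) = lookup t' (L 1 j) \<and>
       lookup t (L 2 j) = lookup t' (L 2 j)"
  shows "t = t'"
proof (rule poly_mapping_eqI)
  fix x
  show "lookup t x = lookup t' x"
  proof (cases "x \<in> set (L_vars n)")
    case True
    then obtain i j where "x = L i j" "i < 3" "j < n" unfolding set_L_vars by blast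
    moreover from this have "i = 0 \<or> i = 1 \<or> i = 2" by linarith
    ultimately show ?thesis using assms(3) by blast
  next
    case False
    then have "x \<notin> keys t" "x \<notin> keys t'"
      using assms unfolding multidegree_def by blast+
    then show ?thesis by (simp add: in_keys_iff)
  qed
qed

lemma multidegree_dec:
  assumes "multidegree n d \<tau> (single (L i j) 1 + t)"
  shows "multidegree n (d(j := d j - 1)) (\<tau>(i := \<tau> i - 1)) t" "d j > 0" "j < n"
proof -
  let ?e = "single (L i j) (1::nat)"
  have "L i j \<in> keys (?e + t)" by (simp add: in_keys_iff lookup_add)
  then have ij: "i < 3" "j < n" using multidegree_less[OF assms] by auto
  have sub: "keys t \<subseteq> keys (?e + t)" by (auto simp: in_keys_iff lookup_add)
  have col: "(\<Sum>i'<3. lookup ?e (L i' j')) = (if j' = j then 1 else 0)" for j'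
    using ij by (simp add: lookup_single when_def)
  have row: "(\<Sum>j'<n. lookup ?e (L i' j')) = (if i' = i then 1 else 0)" for i'
    using ij by (simp add: lookup_single when_def)
  have c: "(\<Sum>i'<3. lookup t (L i' j')) + (if j' = j then 1 else 0) = d j'" if "j' < n" for j'
  proof -
    have "(\<Sum>i'<3. lookup (?e + t) (L i' j')) = d j'"
      using assms that unfolding multidegree_def by blast
    then show ?thesis using col[of j'] unfolding lookup_add sum.distrib by linarith
  qed
  have r: "(\<Sum>j'<n. lookup t (L i' j')) + (if i' = i then 1 else 0) = \<tau> i'" if "i' < 3" for i'
  proof -
    have "(\<Sum>j'<n. lookup (?e + t) (L i' j')) = \<tau> i'"
      using assms that unfolding multidegree_def by blast
    then show ?thesis using row[of i'] unfolding lookup_add sum.distrib by linarith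
  qed
  show "multidegree n (d(j := d j - 1)) (\<tau>(i := \<tau> i - 1)) t"
    using c r sub assms unfolding multidegree_def by (fastforce split: if_splits)
  show "d j > 0" "j < n" using c[of j] ij by auto
qed

text \<open>The exponents left after setting \<open>y = - v m\<close> in the last column \<open>m\<close>. The extra factor \<open>b\<^sub>m\<close>
  makes the condition stable under cancelling all the powers of \<open>b\<^sub>m\<close>: it remembers that column \<open>m\<close>
  was occupied.\<close>

definition admissible :: "nat \<Rightarrow> monomial \<Rightarrow> bool" where
  "admissible m t \<longleftrightarrow> standard (t + single (L 1 m) 1) \<and> L 2 m \<notin> keys t \<and>
     (\<forall>i j. L i j \<in> keys t \<longrightarrow> j \<le> m)"

lemma keys_add_mon: "keys (s + t :: monomial) = keys s \<union> keys t"
  by (auto simp: in_keys_iff lookup_add)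

lemma admissible_mono:
  "admissible m t \<Longrightarrow> keys s \<subseteq> keys t \<Longrightarrow> admissible m s"
  unfolding admissible_def by (auto simp: keys_add_mon elim!: standard_mono)

lemma admissibleD:
  assumes "admissible m t"
  shows "i < j \<Longrightarrow> j < k \<Longrightarrow> L 1 i \<in> keys t \<Longrightarrow> L 0 j \<in> keys t \<Longrightarrow> L 0 k \<in> keys t \<Longrightarrow> False"
    and "i < j \<Longrightarrow> j < k \<Longrightarrow> L 2 i \<in> keys t \<Longrightarrow> L 0 j \<in> keys t \<Longrightarrow> L 0 k \<in> keys t \<Longrightarrow> False"
    and "i < j \<Longrightarrow> i < k \<Longrightarrow> j \<noteq> k \<Longrightarrow> L 2 i \<in> keys t \<Longrightarrow> L 0 j \<in> keys t \<Longrightarrow> L 1 k \<in> keys t \<Longrightarrow> False"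
    and "i < j \<Longrightarrow> j < m \<Longrightarrow> L 2 i \<in> keys t \<Longrightarrow> L 0 j \<in> keys t \<Longrightarrow> False"
    and "i < j \<Longrightarrow> j < k \<Longrightarrow> k < m \<Longrightarrow> L 2 i \<in> keys t \<Longrightarrow> L 2 j \<in> keys t \<Longrightarrow> L 1 k \<in> keys t \<Longrightarrow> False"
    and "i < j \<Longrightarrow> j < k \<Longrightarrow> k < m \<Longrightarrow> L 0 i \<in> keys t \<Longrightarrow> L 2 j \<in> keys t \<Longrightarrow> L 1 k \<in> keys t \<Longrightarrow> False"
proof -
  let ?t = "t + single (L 1 m) 1"
  have st: "standard ?t" using assms unfolding admissible_def by blast
  have keys: "keys ?t = insert (L 1 m) (keys t)" by (simp add: keys_add_mon)
  note D = standardD[OF st, unfolded keys]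
  show "i < j \<Longrightarrow> j < k \<Longrightarrow> L 1 i \<in> keys t \<Longrightarrow> L 0 j \<in> keys t \<Longrightarrow> L 0 k \<in> keys t \<Longrightarrow> False"
    by (rule D(1)[of i j k]) auto
  show "i < j \<Longrightarrow> j < k \<Longrightarrow> L 2 i \<in> keys t \<Longrightarrow> L 0 j \<in> keys t \<Longrightarrow> L 0 k \<in> keys t \<Longrightarrow> False"
    by (rule D(2)[of i j k]) auto
  show "i < j \<Longrightarrow> i < k \<Longrightarrow> j \<noteq> k \<Longrightarrow> L 2 i \<in> keys t \<Longrightarrow> L 0 j \<in> keys t \<Longrightarrow> L 1 k \<in> keys t \<Longrightarrow> False"
    by (rule D(3)[of i j k]) auto
  show "i < j \<Longrightarrow> j < m \<Longrightarrow> L 2 i \<in> keys t \<Longrightarrow> L 0 j \<in> keys t \<Longrightarrow> False"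
    by (rule D(3)[of i j m]) auto
  show "i < j \<Longrightarrow> j < k \<Longrightarrow> k < m \<Longrightarrow> L 2 i \<in> keys t \<Longrightarrow> L 2 j \<in> keys t \<Longrightarrow> L 1 k \<in> keys t \<Longrightarrow> False"
    by (rule D(4)[of i j k m]) auto
  show "i < j \<Longrightarrow> j < k \<Longrightarrow> k < m \<Longrightarrow> L 0 i \<in> keys t \<Longrightarrow> L 2 j \<in> keys t \<Longrightarrow> L 1 k \<in> keys t \<Longrightarrow> False"
    by (rule D(5)[of i j k m]) auto
qed

text \<open>If column \<open>m\<close> contains \<open>a\<^sub>m\<close> only, the patterns that end in \<open>b\<^sub>m\<close> are still excluded: replacing
  \<open>b\<^sub>m\<close> by \<open>a\<^sub>m\<close> in them leaves a monomial that contains another forbidden pattern.\<close>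

lemma admissibleI:
  assumes st: "standard t" and c: "L 2 m \<notin> keys t"
    and le: "\<And>i j. L i j \<in> keys t \<Longrightarrow> j \<le> m"
    and ab: "L 0 m \<in> keys t \<or> L 1 m \<in> keys t"
  shows "admissible m t"
proof -
  let ?t = "t + single (L 1 m) 1"
  have keys: "keys ?t = insert (L 1 m) (keys t)" by (simp add: keys_add_mon)
  have "standard ?t"
  proof (cases "L 1 m \<in> keys t")
    case True
    then show ?thesis using keys by (intro standard_mono[OF st]) auto
  next
    case False
    then have a: "L 0 m \<in> keys t" using ab by blast
    have "\<not> F \<subseteq> keys ?t" if F: "F \<in> forbidden" for F
    proof
      assume sub: "F \<subseteq> keys ?t"
      show False using F
      proof cases
        case (baa i j k)
        then show False using sub le[of 0 k] standardD(1)[OF st, of i j k] unfolding keys by auto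
      next
        case (caa i j k)
        then show False using sub standardD(2)[OF st, of i j k] unfolding keys by auto
      next
        case (cab i j k)
        then show False
          using sub le[of 0 j] standardD(3)[OF st, of i j k] standardD(2)[OF st, of i j m] a
          unfolding keys by (cases "k = m") auto
      next
        case (ccbb i j k l)
        have "l = m" using ccbb sub le[of 1 l] standardD(4)[OF st, of i j k l] unfolding keys by auto
        then show False using ccbb sub standardD(3)[OF st, of i m k] a unfolding keys by auto
      next
        case (acbb i j k l)
        have "l = m" using acbb sub le[of 1 l] standardD(5)[OF st, of i j k l] unfolding keys by auto
        then show False using acbb sub standardD(3)[OF st, of j m k] a unfolding keys by auto
      qed
    qed
    then show ?thesis unfolding standard_def by blast
  qed
  then show ?thesis using c le unfolding admissible_def by blast
qed

text \<open>Without \<open>b\<^sub>m\<close> the last column is filled with \<open>a\<^sub>m\<close>. This rules out the patterns \<open>b..a\<close>, \<open>c..a\<close> and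
  \<open>c..b\<close> in the columns before \<open>m\<close>, so that these form a sorted word.\<close>

lemma admissible_unique_last:
  assumes t: "multidegree n d \<tau> t" "admissible m t" "L 1 m \<notin> keys t"
    and t': "multidegree n d \<tau> t'" "admissible m t'" "L 1 m \<notin> keys t'"
    and m: "m < n" "d m > 0"
  shows "t = t'"
proof (rule multidegree_eqI[OF t(1) t'(1)])
  let ?a = "\<lambda>t j. lookup t (L 0 j)" and ?b = "\<lambda>t j. lookup t (L 1 j)"
    and ?c = "\<lambda>t j. lookup t (L 2 j)"
  have *: "?a s m = d m \<and> (\<forall>j. m < j \<longrightarrow> ?a s j = 0 \<and> ?b s j = 0 \<and> ?c s j = 0) \<and> ?b s m = 0 \<and> ?c s m = 0 \<and>
      (\<forall>i j. i < j \<and> j < m \<and> 0 < ?c s i \<longrightarrow> ?c s j = d j) \<and>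
      (\<forall>i j. j < i \<and> i < m \<and> 0 < ?a s i \<longrightarrow> ?a s j = d j)"
    if s: "multidegree n d \<tau> s" "admissible m s" "L 1 m \<notin> keys s" for s
  proof -
    note col = multidegree_col[OF s(1)] and D = admissibleD[OF s(2)]
    have z: "?b s m = 0" "?c s m = 0"
      using s(2,3) unfolding admissible_def by (auto simp: in_keys_iff)
    then have am: "?a s m = d m" using col[of m] m by simp
    then have a: "L 0 m \<in> keys s" using m by (simp add: in_keys_iff)
    have "?a s j = 0 \<and> ?b s j = 0 \<and> ?c s j = 0" if "m < j" for j
      using s(2) that unfolding admissible_def by (metis leD not_in_keys_iff_lookup_eq_zero)
    moreover have "?c s j = d j" if "i < j" "j < m" "0 < ?c s i" for i j
    proof -
      have "L 0 j \<notin> keys s" "L 1 j \<notin> keys s"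
        using D(2)[of i j m] D(3)[of i m j] a that by (auto simp: in_keys_iff)
      then show ?thesis using col[of j] that m by (simp add: in_keys_iff)
    qed
    moreover have "?a s j = d j" if "j < i" "i < m" "0 < ?a s i" for i j
    proof -
      have "L 2 j \<notin> keys s" "L 1 j \<notin> keys s"
        using D(2)[of j i m] D(1)[of j i m] a that by (auto simp: in_keys_iff)
      then show ?thesis using col[of j] that m by (simp add: in_keys_iff)
    qed
    ultimately show ?thesis using z am by blast
  qed
  note T = *[OF t] and T' = *[OF t']
  have sum: "(\<Sum>j<n. f j) = (\<Sum>j<m. f j) + f m" if "\<forall>j. m < j \<longrightarrow> f j = 0" for f :: "nat \<Rightarrow> nat"
    using that sum_split_at[OF m(1), of f] by simp
  have c: "\<forall>j\<in>{..<m}. ?c t j = ?c t' j"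
  proof (rule sorted_unique[where r = d and R = "(<)"])
    show "?c t j \<le> d j" "?c t' j \<le> d j" if "j \<in> {..<m}" for j
      using multidegree_col[OF t(1), of j] multidegree_col[OF t'(1), of j] that m by auto
    show "(\<Sum>j<m. ?c t j) = (\<Sum>j<m. ?c t' j)"
      using sum[of "?c t"] sum[of "?c t'"] T T' multidegree_row(3)[OF t(1)] multidegree_row(3)[OF t'(1)] by simp
  qed (use T T' in auto)
  have a: "\<forall>j\<in>{..<m}. ?a t j = ?a t' j"
  proof (rule sorted_unique[where r = d and R = "(>)"])
    show "?a t j \<le> d j" "?a t' j \<le> d j" if "j \<in> {..<m}" for j
      using multidegree_col[OF t(1), of j] multidegree_col[OF t'(1), of j] that m by auto
    show "(\<Sum>j<m. ?a t j) = (\<Sum>j<m. ?a t' j)"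
      using sum[of "?a t"] sum[of "?a t'"] T T' multidegree_row(1)[OF t(1)] multidegree_row(1)[OF t'(1)] by simp
  qed (use T T' in auto)
  show "?a t j = ?a t' j \<and> ?b t j = ?b t' j \<and> ?c t j = ?c t' j" if "j < n" for j
  proof -
    consider "j < m" | "j = m" | "m < j" by linarith
    then show ?thesis
    proof cases
      case 1
      then show ?thesis
        using a c multidegree_col[OF t(1), of j] multidegree_col[OF t'(1), of j] that by auto
    qed (use T T' in simp_all)
  qed
qed

text \<open>Once column \<open>m\<close> is exhausted, the condition on the extra factor \<open>b\<^sub>m\<close> becomes a condition on the
  columns before \<open>m\<close>, namely the one of \<open>abc_word\<close>. If \<open>\<tau> 0\<close> is at least the whole degree there is no column
  \<open>q\<close> as required there, but then every letter is an \<open>a\<close>.\<close>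

lemma admissible_unique_middle:
  assumes m: "m < n" "d m = 0"
  shows "\<exists>q<n. \<forall>t t'. multidegree n d \<tau> t \<and> admissible m t \<and> L 1 q \<notin> keys t \<and>
    multidegree n d \<tau> t' \<and> admissible m t' \<and> L 1 q \<notin> keys t' \<longrightarrow> t = t'"
proof (cases "\<exists>q<n. \<tau> 0 < (\<Sum>j\<le>q. d j)")
  case True
  define q where "q = (LEAST q. \<tau> 0 < (\<Sum>j\<le>q. d j))"
  obtain q' where q': "q' < n" "\<tau> 0 < (\<Sum>j\<le>q'. d j)" using True by blast
  have q1: "\<tau> 0 < (\<Sum>j\<le>q. d j)" unfolding q_def by (rule LeastI[of _ q']) (rule q')
  have qn: "q < n" using q' Least_le[of "\<lambda>q. \<tau> 0 < (\<Sum>j\<le>q. d j)" q'] unfolding q_def by simp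
  have q2: "(\<Sum>j<q. d j) \<le> \<tau> 0"
  proof (cases q)
    case (Suc r)
    then have "\<not> \<tau> 0 < (\<Sum>j\<le>r. d j)"
      using not_less_Least[of r "\<lambda>q. \<tau> 0 < (\<Sum>j\<le>q. d j)"] unfolding q_def[symmetric] by simp
    then show ?thesis by (simp add: Suc lessThan_Suc_atMost)
  qed simp
  have word: "abc_word (\<lambda>j. lookup t (L 0 j)) (\<lambda>j. lookup t (L 1 j))
      (\<lambda>j. lookup t (L 2 j)) d n q"
    if t: "multidegree n d \<tau> t" "admissible m t" "L 1 q \<notin> keys t" for t
  proof -
    have lt: "j < m" if "L i j \<in> keys t" for i j
    proof -
      have "j \<le> m" using t(2) that unfolding admissible_def by blast
      moreover have "j \<noteq> m"
      proof
        assume "j = m"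
        moreover have "i = 0 \<or> i = 1 \<or> i = 2" using multidegree_less[OF t(1) that] by linarith
        ultimately show False
          using multidegree_col[OF t(1) m(1)] m(2) that by (auto simp: in_keys_iff)
      qed
      ultimately show ?thesis by simp
    qed
    note D = admissibleD[OF t(2)]
    show ?thesis
    proof
      show "lookup t (L 1 q) = 0" using t(3) by (simp add: in_keys_iff)
      show "(\<Sum>j<n. lookup t (L 0 j)) < (\<Sum>j<q. d j) + d q"
        using q1 multidegree_row(1)[OF t(1)] by (simp add: lessThan_Suc_atMost[symmetric])
    qed (use D lt multidegree_col[OF t(1)] multidegree_row(1)[OF t(1)] q2 qn in
        \<open>auto simp: lookup_pos_iff\<close>)
  qed
  have "t = t'"
    if "multidegree n d \<tau> t" "admissible m t" "L 1 q \<notin> keys t"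
      "multidegree n d \<tau> t'" "admissible m t'" "L 1 q \<notin> keys t'" for t t'
    by (rule multidegree_eqI[OF that(1,4)])
      (rule abc_word_unique[OF word[OF that(1-3)] word[OF that(4-6)]],
        use multidegree_row[OF that(1)] multidegree_row[OF that(4)] in auto)
  then show ?thesis using qn by blast
next
  case False
  have le: "(\<Sum>j<n. d j) \<le> \<tau> 0"
  proof -
    obtain N where N: "n = Suc N" using m(1) by (cases n) auto
    then have "\<not> \<tau> 0 < (\<Sum>j\<le>N. d j)" using False by blast
    then show ?thesis by (simp add: N lessThan_Suc_atMost)
  qed
  have "lookup t (L 0 j) = d j" "lookup t (L 1 j) = 0" "lookup t (L 2 j) = 0"
    if t: "multidegree n d \<tau> t" and j: "j < n" for t j
  proof -
    have le1: "lookup t (L 0 j) \<le> d j" if "j < n" for j using multidegree_col[OF t that] by simp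
    show "lookup t (L 0 j) = d j"
    proof (rule ccontr)
      assume "lookup t (L 0 j) \<noteq> d j"
      then have "(\<Sum>j<n. lookup t (L 0 j)) < (\<Sum>j<n. d j)"
        using le1 j by (intro sum_strict_mono_ex1) (auto intro!: bexI[of _ j] simp: le_neq_implies_less)
      then show False using le multidegree_row(1)[OF t] by simp
    qed
    then show "lookup t (L 1 j) = 0" "lookup t (L 2 j) = 0"
      using multidegree_col[OF t j] by auto
  qed
  then have "t = t'" if "multidegree n d \<tau> t" "multidegree n d \<tau> t'" for t t'
    using multidegree_eqI[OF that] that by simp
  then show ?thesis using m(1) by blast
qed

lemma comm_ring_hom_const_poly: "comm_ring_hom (\<lambda>c::'a::comm_ring_1. [:c:])"
  by unfold_locales (simp_all add: one_pCons)

lemma comm_ring_hom_poly: "comm_ring_hom (\<lambda>p. poly p (x::'a::comm_ring_1))"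
  by unfold_locales simp_all

lemma comm_ring_hom_comp: "comm_ring_hom f \<Longrightarrow> comm_ring_hom g \<Longrightarrow> comm_ring_hom (\<lambda>x. g (f x))"
proof -
  assume "comm_ring_hom f" "comm_ring_hom g"
  then interpret f: comm_ring_hom f + g: comm_ring_hom g .
  show ?thesis by unfold_locales (simp_all add: f.hom_add f.hom_mult g.hom_add g.hom_mult)
qed

locale distinct_values =
  fixes v :: "nat \<Rightarrow> complex" and n :: nat
  assumes distinct: "i < n \<Longrightarrow> j < n \<Longrightarrow> i \<noteq> j \<Longrightarrow> v i \<noteq> v j"
begin

text \<open>The parametrization with all scaling parameters set to \<open>1\<close>: \<open>a\<^sub>j = 1\<close>, \<open>b\<^sub>j = x + v\<^sub>j\<close>, \<open>c\<^sub>j = y + v\<^sub>j\<close>. The outer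
  polynomial variable is \<open>y\<close>, the inner one \<open>x\<close>.\<close>

definition val_xy :: "var \<Rightarrow> complex poly poly" where
  "val_xy x = (case x of V j \<Rightarrow> 1
     | L i j \<Rightarrow> if i = 0 then 1 else if i = 1 then [:[:v j, 1:]:] else [:[:v j:], 1:])"

text \<open>Its restriction to \<open>y = - v\<^sub>m\<close>, where \<open>c\<^sub>j\<close> becomes a constant that is nonzero for \<open>j \<noteq> m\<close>.\<close>

definition val_x :: "nat \<Rightarrow> var \<Rightarrow> complex poly" where
  "val_x m x = (case x of V j \<Rightarrow> 1
     | L i j \<Rightarrow> if i = 0 then 1 else if i = 1 then [:v j, 1:] else [:v j - v m:])"

abbreviation eval_xy :: "mpoly \<Rightarrow> complex poly poly" where
  "eval_xy \<equiv> subst (\<lambda>c. [:[:c:]:]) val_xy"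

abbreviation eval_x :: "nat \<Rightarrow> mpoly \<Rightarrow> complex poly" where
  "eval_x m \<equiv> subst (\<lambda>c. [:c:]) (val_x m)"

lemma hom_xy: "comm_ring_hom (\<lambda>c::complex. [:[:c:]:])"
  by (rule comm_ring_hom_comp[OF comm_ring_hom_const_poly comm_ring_hom_const_poly])

lemma eval_x_monomial_nonzero:
  assumes t: "multidegree n d \<tau> t" "L 2 m \<notin> keys t" "L 1 q \<notin> keys t"
    and m: "m < n" "q < n"
  shows "poly (subst_mon (val_x m) t) (- v q) \<noteq> 0"
proof -
  have "poly (val_x m x) (- v q) \<noteq> 0" if x: "x \<in> keys t" for x
  proof -
    obtain i j where ij: "x = L i j" "i < 3" "j < n"
      using t(1) x unfolding multidegree_def set_L_vars by blast
    then consider "i = 0" | "i = 1" | "i = 2" by linarith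
    then show ?thesis
    proof cases
      case 2
      then have "j \<noteq> q" using t(3) x ij(1) by blast
      then show ?thesis using distinct[of j q] ij 2 m by (simp add: val_x_def)
    next
      case 3
      then have "j \<noteq> m" using t(2) x ij(1) by blast
      then show ?thesis using distinct[of j m] ij 3 m by (simp add: val_x_def)
    qed (simp add: val_x_def ij(1))
  qed
  then show ?thesis unfolding subst_mon_def by (simp add: poly_prod)
qed

text \<open>Choose \<open>q\<close> such that at most one monomial of the multidegree lacks \<open>b\<^sub>q\<close>. At \<open>x = - v\<^sub>q\<close> this monomial
  has a nonzero value and all others vanish, so it does not occur in \<open>p\<close>, and \<open>b\<^sub>q\<close> divides \<open>p\<close>.\<close>

lemma admissible_independent:
  assumes m: "m < n"
    and keys: "\<And>t. t \<in> keys p \<Longrightarrow> multidegree n d \<tau> t \<and> admissible m t"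
    and zero: "eval_x m p = 0"
  shows "p = 0"
  using keys zero
proof (induction "\<Sum>j<n. d j" arbitrary: d \<tau> p rule: less_induct)
  case less
  interpret ev: comm_ring_hom "eval_x m" by (rule comm_ring_hom_subst[OF comm_ring_hom_const_poly])
  obtain q where q: "q < n" and unique: "\<And>t t'. multidegree n d \<tau> t \<Longrightarrow> admissible m t \<Longrightarrow>
      L 1 q \<notin> keys t \<Longrightarrow> multidegree n d \<tau> t' \<Longrightarrow> admissible m t' \<Longrightarrow>
      L 1 q \<notin> keys t' \<Longrightarrow> t = t'"
  proof (cases "d m = 0")
    case True
    then show ?thesis using that admissible_unique_middle[of m n d \<tau>] m by blast
  next
    case False
    then show ?thesis using that[of m] admissible_unique_last[of n d \<tau> _ m] m by blast
  qed
  obtain r s where p: "p = r + Var (L 1 q) * s"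
    and r: "\<And>t. t \<in> keys r \<Longrightarrow> t \<in> keys p \<and> L 1 q \<notin> keys t"
    and s: "\<And>t. t \<in> keys s \<Longrightarrow> single (L 1 q) 1 + t \<in> keys p"
    using split_by_variable[of p "L 1 q"] by metis
  have ep: "eval_x m p = eval_x m r + [:v q, 1:] * eval_x m s"
    by (simp add: p ev.hom_add ev.hom_mult subst_Var[OF comm_ring_hom_const_poly] val_x_def)
  have "r = 0"
  proof (rule ccontr)
    assume "r \<noteq> 0"
    then obtain t where t: "t \<in> keys r" by (metis keys_eq_empty ex_in_conv)
    then have tp: "multidegree n d \<tau> t" "admissible m t" "L 1 q \<notin> keys t"
      using r less.prems(1) by blast+
    have "keys r \<subseteq> {t}"
      using r less.prems(1) unique[OF tp] by fastforce
    then have "keys r = {t}" using t by blast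
    then have "r = single t (lookup r t)"
      using poly_eq_sum_singles[of r] by simp
    then have "eval_x m r = [:lookup r t:] * subst_mon (val_x m) t"
      using subst_single[OF comm_ring_hom_const_poly] by metis
    moreover have "poly (eval_x m r) (- v q) = 0"
      using arg_cong[OF less.prems(2), of "\<lambda>p. poly p (- v q)"] by (simp add: ep)
    moreover have "poly (subst_mon (val_x m) t) (- v q) \<noteq> 0"
      using tp m q unfolding admissible_def by (intro eval_x_monomial_nonzero) auto
    ultimately show False using t by (simp add: in_keys_iff)
  qed
  then have "[:v q, 1:] * eval_x m s = 0" using ep less.prems(2) ev.hom_zero by simp
  then have es: "eval_x m s = 0" by (metis mult_eq_0_iff one_neq_zero pCons_eq_0_iff)
  have "s = 0"
  proof (rule ccontr)
    assume "s \<noteq> 0"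
    have sk: "multidegree n (d(q := d q - 1)) (\<tau>(1 := \<tau> 1 - 1)) t \<and> admissible m t \<and> d q > 0"
      if "t \<in> keys s" for t
      using multidegree_dec[of n d \<tau> 1 q t] less.prems(1)[OF s[OF that]] 
        admissible_mono[of m "single (L 1 q) 1 + t" t]
      by (auto simp: keys_add_mon)
    obtain t where "t \<in> keys s" using \<open>s \<noteq> 0\<close> by (metis keys_eq_empty ex_in_conv)
    then have "d q > 0" using sk by blast
    then have "(\<Sum>j<n. (d(q := d q - 1)) j) < (\<Sum>j<n. d j)"
      using q by (intro sum_strict_mono_ex1) (auto intro!: bexI[of _ q])
    then have "s = 0" using less.hyps[of "d(q := d q - 1)" s "\<tau>(1 := \<tau> 1 - 1)"] sk es by blast
    then show False using \<open>s \<noteq> 0\<close> by blast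
  qed
  then show ?case using p \<open>r = 0\<close> by simp
qed

lemma poly_eval_xy: "poly (eval_xy p) [:- v m:] = eval_x m p"
proof -
  have "poly (eval_xy p) [:- v m:] =
      subst (\<lambda>c. poly [:[:c:]:] [:- v m:]) (\<lambda>x. poly (val_xy x) [:- v m:]) p"
    by (rule hom_subst[OF hom_xy comm_ring_hom_poly])
  also have "(\<lambda>x. poly (val_xy x) [:- v m:]) = val_x m"
    by (rule ext) (simp add: val_xy_def val_x_def split: var.split)
  finally show ?thesis by simp
qed

text \<open>At \<open>y = - v\<^sub>m\<close>, with \<open>m\<close> the last occupied column, the monomials without \<open>c\<^sub>m\<close> survive and are
  admissible. Hence they do not occur in \<open>p\<close>, and \<open>c\<^sub>m\<close> divides \<open>p\<close>.\<close>

lemma standard_independent: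
  assumes keys: "\<And>t. t \<in> keys p \<Longrightarrow> multidegree n d \<tau> t \<and> standard t"
    and zero: "eval_xy p = 0"
  shows "p = 0"
  using keys zero
proof (induction "\<Sum>j<n. d j" arbitrary: d \<tau> p rule: less_induct)
  case less
  interpret ev: comm_ring_hom eval_xy by (rule comm_ring_hom_subst[OF hom_xy])
  show ?case
  proof (cases "\<forall>j<n. d j = 0")
    case True
    have "keys p \<subseteq> {0}"
    proof
      fix t assume t: "t \<in> keys p"
      have "multidegree n d \<tau> t" using less.prems(1)[OF t] by blast
      then have "lookup t (L 0 j) = 0 \<and> lookup t (L 1 j) = 0 \<and>
          lookup t (L 2 j) = 0" if "j < n" for j
        using multidegree_col[of n d \<tau> t j] True that by simp
      moreover have "multidegree n (\<lambda>_. 0) (\<lambda>_. 0) 0" by (simp add: multidegree_def)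
      ultimately have "t = 0"
        using \<open>multidegree n d \<tau> t\<close> by (intro multidegree_eqI[of n d \<tau> t "\<lambda>_. 0" "\<lambda>_. 0" 0]) simp_all
      then show "t \<in> {0}" by simp
    qed
    then have "p = single 0 (lookup p 0)"
      using poly_eq_sum_singles[of p] by (cases "p = 0") (auto simp: subset_singleton_iff)
    moreover from this have "eval_xy p = [:[:lookup p 0:]:]"
      using subst_single[OF hom_xy, of val_xy 0 "lookup p 0"] by simp
    ultimately show ?thesis using less.prems(2) by (metis pCons_eq_0_iff single_zero)
  next
    case False
    define m where "m = Max {j. j < n \<and> d j > 0}"
    have "m \<in> {j. j < n \<and> d j > 0}" unfolding m_def by (rule Max_in) (use False in auto)
    then have m: "m < n" "d m > 0" by auto
    have last: "j \<le> m" if "j < n" "d j > 0" for j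
      unfolding m_def by (rule Max_ge) (use that in auto)
    obtain r s where p: "p = r + Var (L 2 m) * s"
      and r: "\<And>t. t \<in> keys r \<Longrightarrow> t \<in> keys p \<and> L 2 m \<notin> keys t"
      and s: "\<And>t. t \<in> keys s \<Longrightarrow> single (L 2 m) 1 + t \<in> keys p"
      using split_by_variable[of p "L 2 m"] by metis
    have ep: "eval_xy p = eval_xy r + [:[:v m:], 1:] * eval_xy s"
      by (simp add: p ev.hom_add ev.hom_mult subst_Var[OF hom_xy] val_xy_def)
    have "poly (eval_xy p) [:- v m:] = poly (eval_xy r) [:- v m:]"
      unfolding ep by simp
    then have "eval_x m r = 0" using less.prems(2) by (simp add: poly_eval_xy)
    moreover have "multidegree n d \<tau> t \<and> admissible m t" if t: "t \<in> keys r" for t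
    proof -
      have mt: "multidegree n d \<tau> t" and st: "standard t" and c: "L 2 m \<notin> keys t"
        using r[OF t] less.prems(1) by blast+
      have "j \<le> m" if "L i j \<in> keys t" for i j
      proof (rule last)
        have "i = 0 \<or> i = 1 \<or> i = 2" using multidegree_less[OF mt that] by linarith
        then show "d j > 0"
          using multidegree_col[OF mt, of j] multidegree_less[OF mt that] that
          by (auto simp: in_keys_iff)
      qed (use multidegree_less[OF mt that] in blast)
      moreover have "L 0 m \<in> keys t \<or> L 1 m \<in> keys t"
        using multidegree_col[OF mt, of m] m c by (auto simp: in_keys_iff)
      ultimately show ?thesis using mt admissibleI[OF st c] by blast
    qed
    ultimately have "r = 0" using admissible_independent[OF m(1), of r d \<tau>] by blast
    then have "[:[:v m:], 1:] * eval_xy s = 0" using ep less.prems(2) ev.hom_zero by simp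
    then have es: "eval_xy s = 0" by (metis mult_eq_0_iff one_neq_zero pCons_eq_0_iff)
    have sk: "multidegree n (d(m := d m - 1)) (\<tau>(2 := \<tau> 2 - 1)) t \<and> standard t"
      if "t \<in> keys s" for t
      using multidegree_dec[of n d \<tau> 2 m t] less.prems(1)[OF s[OF that]] 
        standard_mono[of "single (L 2 m) 1 + t" t]
      by (auto simp: keys_add_mon)
    have "(\<Sum>j<n. (d(m := d m - 1)) j) < (\<Sum>j<n. d j)"
      using m by (intro sum_strict_mono_ex1) (auto intro!: bexI[of _ m])
    then have "s = 0" using less.hyps[of "d(m := d m - 1)" s "\<tau>(2 := \<tau> 2 - 1)"] sk es by blast
    then show ?thesis using p \<open>r = 0\<close> by simp
  qed
qed

end

section \<open>The determinants defining the ideal\<close>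

lemma det_mat_Suc:
  fixes f :: "nat \<times> nat \<Rightarrow> 'a::comm_ring_1"
  shows "det (mat (Suc n) (Suc n) f) = (\<Sum>i<Suc n. f (i, 0) * ((-1) ^ i *
    det (mat n n (\<lambda>(i', j'). f (if i' < i then i' else Suc i', Suc j')))))"
proof -
  have "mat_delete (mat (Suc n) (Suc n) f) i 0 = mat n n (\<lambda>(i', j'). f (if i' < i then i' else Suc i', Suc j'))" for i
    by (rule eq_matI) (auto simp: mat_delete_def)
  then show ?thesis
    by (subst laplace_expansion_column[of _ "Suc n" 0]) (simp_all add: cofactor_def)
qed

lemma det_mat_3:
  fixes f :: "nat \<times> nat \<Rightarrow> 'a::comm_ring_1"
  shows "det (mat 3 3 f) =
    f (0, 0) * (f (1, 1) * f (2, 2) - f (2, 1) * f (1, 2)) -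
    f (1, 0) * (f (0, 1) * f (2, 2) - f (2, 1) * f (0, 2)) +
    f (2, 0) * (f (0, 1) * f (1, 2) - f (1, 1) * f (0, 2))"
  by (simp add: numeral_eq_Suc det_mat_Suc algebra_simps)

lemma det_mat_4:
  fixes f :: "nat \<times> nat \<Rightarrow> 'a::comm_ring_1"
  shows "det (mat 4 4 f) =
    (\<Sum>i<4. f (i, 0) * ((-1) ^ i * det (mat 3 3 (\<lambda>(i', j'). f (if i' < i then i' else Suc i', Suc j')))))"
  using det_mat_Suc[of 3 f] by (simp add: numeral_eq_Suc)

lemma det_unit_column:
  fixes f :: "nat \<times> nat \<Rightarrow> 'a::comm_ring_1"
  assumes "r \<le> n" "\<And>i. i \<le> n \<Longrightarrow> f (i, 0) = (if i = r then 1 else 0)"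
  shows "det (mat (Suc n) (Suc n) f) =
    (-1) ^ r * det (mat n n (\<lambda>(i, j). f (if i < r then i else Suc i, Suc j)))"
proof -
  have "det (mat (Suc n) (Suc n) f) = (\<Sum>i<Suc n. if i = r then (-1) ^ i *
    det (mat n n (\<lambda>(i', j'). f (if i' < i then i' else Suc i', Suc j'))) else 0)"
    unfolding det_mat_Suc by (rule sum.cong) (auto simp: assms)
  then show ?thesis using assms(1) by simp
qed

definition det3 :: "(nat \<Rightarrow> 'a::comm_ring_1) \<Rightarrow> (nat \<Rightarrow> 'a) \<Rightarrow> (nat \<Rightarrow> 'a) \<Rightarrow> nat \<Rightarrow> nat \<Rightarrow> nat \<Rightarrow> 'a" where
  "det3 f g h i j k = f i * (g j * h k - g k * h j) - f j * (g i * h k - g k * h i) + f k * (g i * h j - g j * h i)"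

text \<open>The determinant of the matrix with rows \<open>b, c, w b, w c\<close> and columns \<open>i, j, k, l\<close>, by Laplace
  expansion along the pairs of rows \<open>b, w b\<close> and \<open>c, w c\<close>. In this form the leading monomial is visible.\<close>

definition det4 :: "(nat \<Rightarrow> 'a::comm_ring_1) \<Rightarrow> (nat \<Rightarrow> 'a) \<Rightarrow> (nat \<Rightarrow> 'a) \<Rightarrow> nat \<Rightarrow> nat \<Rightarrow> nat \<Rightarrow> nat \<Rightarrow> 'a" where
  "det4 b c w i j k l =
     (let B = (\<lambda>p q. b p * b q * (w q - w p)); C = (\<lambda>p q. c p * c q * (w q - w p)) in
      - (B i j * C k l - B i k * C j l + B i l * C j k + B j k * C i l - B j l * C i k + B k l * C i j))"

abbreviation va :: "nat \<Rightarrow> mpoly" where "va j \<equiv> Var (L 0 j)"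
abbreviation vb :: "nat \<Rightarrow> mpoly" where "vb j \<equiv> Var (L 1 j)"
abbreviation vc :: "nat \<Rightarrow> mpoly" where "vc j \<equiv> Var (L 2 j)"

definition plane_row :: "(nat \<Rightarrow> mpoly) \<Rightarrow> nat \<Rightarrow> nat \<Rightarrow> mpoly" where
  "plane_row w r = [va, vb, vc, \<lambda>p. w p * va p] ! r"

lemma planes_entry:
  assumes "j < m" "r < 4"
  shows "back_projected_planes m w $$ (r, j) = plane_row w r j"
proof -
  have "r = 0 \<or> r = 1 \<or> r = 2 \<or> r = 3" using assms by linarith
  then show ?thesis using assms
    by (auto simp: back_projected_planes_def mat_of_cols_index camera_def mat_of_rows_list_def L_vec_def
        scalar_prod_def numeral_eq_Suc plane_row_def)
qed

lemma planes_dim: "dim_row (back_projected_planes m w) = 4" "dim_col (back_projected_planes m w) = m"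
  by (simp_all add: back_projected_planes_def)

lemma pick_3:
  assumes "i < j" "j < (k :: nat)"
  shows "pick {i, j, k} 0 = i" "pick {i, j, k} (Suc 0) = j" "pick {i, j, k} (Suc (Suc 0)) = k"
proof -
  show 0: "pick {i, j, k} 0 = i" by (simp, rule Least_equality) (use assms in auto)
  show 1: "pick {i, j, k} (Suc 0) = j"
    using 0 by (simp, intro Least_equality) (use assms in auto)
  show "pick {i, j, k} (Suc (Suc 0)) = k"
    using 1 by (simp, intro Least_equality) (use assms in auto)
qed

lemma det_submatrix_3:
  assumes "i < j" "j < k" "k < dim_row A" "i' < j'" "j' < k'" "k' < dim_col A"
  shows "det (submatrix A {i, j, k} {i', j', k'}) =
    det3 (\<lambda>p. A $$ (i, p)) (\<lambda>p. A $$ (j, p)) (\<lambda>p. A $$ (k, p)) i' j' k'"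
proof -
  have "{p. p < dim_row A \<and> p \<in> {i, j, k}} = {i, j, k}" "{p. p < dim_col A \<and> p \<in> {i', j', k'}} = {i', j', k'}"
    using assms by auto
  moreover have "card {i, j, k} = 3" "card {i', j', k'} = 3" using assms by auto
  ultimately show ?thesis
    unfolding submatrix_def
    by (simp only: det_mat_3)
      (simp add: det3_def pick_3 assms numeral_2_eq_2 One_nat_def algebra_simps del: pick.simps)
qed

lemma det3_cong:
  assumes "\<And>p. p \<in> {i, j, k} \<Longrightarrow> f p = f' p \<and> g p = g' p \<and> h p = h' p"
  shows "det3 f g h i j k = det3 f' g' h' i j k"
  using assms by (simp add: det3_def)

lemma det_submatrix_planes:
  assumes "r < s" "s < t" "t < 4" "i < j" "j < k" "k < m"
  shows "det (submatrix (back_projected_planes m w) {r, s, t} {i, j, k}) =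
    det3 (plane_row w r) (plane_row w s) (plane_row w t) i j k"
proof -
  have "det (submatrix (back_projected_planes m w) {r, s, t} {i, j, k}) =
      det3 (\<lambda>p. back_projected_planes m w $$ (r, p)) (\<lambda>p. back_projected_planes m w $$ (s, p))
        (\<lambda>p. back_projected_planes m w $$ (t, p)) i j k"
    by (rule det_submatrix_3) (use assms in \<open>auto simp: planes_dim\<close>)
  also have "\<dots> = det3 (plane_row w r) (plane_row w s) (plane_row w t) i j k"
    by (rule det3_cong) (use assms planes_entry in auto)
  finally show ?thesis .
qed

text \<open>Here \<open>rs\<close> lists the rows and \<open>c\<close> is the first column that have not yet been removed.\<close>

lemma det_drop_column:
  fixes g :: "nat \<Rightarrow> nat \<Rightarrow> 'a::comm_ring_1"
  assumes rs: "rs = xs @ y # zs" "rs' = xs @ zs" and dims: "N = Suc n" "n = length rs'" "c' = Suc c"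
    and ev: "even (length xs)"
    and one: "g c y = 1" and zero: "\<And>x. x \<in> set xs \<union> set zs \<Longrightarrow> g c x = 0"
  shows "det (mat N N (\<lambda>(r, s). g (c + s) (rs ! r))) = det (mat n n (\<lambda>(r, s). g (c' + s) (rs' ! r)))"
proof -
  have "rs ! i \<in> set xs \<union> set zs" if "i \<le> n" "i \<noteq> length xs" for i
    using that by (auto simp: rs dims nth_append nth_Cons split: nat.split)
  moreover have "rs ! length xs = y" by (simp add: rs)
  ultimately have col: "g (c + 0) (rs ! i) = (if i = length xs then 1 else 0)" if "i \<le> n" for i
    using one zero that by auto
  have "det (mat (Suc n) (Suc n) (\<lambda>(r, s). g (c + s) (rs ! r))) = (-1) ^ length xs *
    det (mat n n (\<lambda>(i, j). (\<lambda>(r, s). g (c + s) (rs ! r)) (if i < length xs then i else Suc i, Suc j)))"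
    by (rule det_unit_column) (use col in \<open>auto simp: dims rs\<close>)
  also have "mat n n (\<lambda>(i, j). (\<lambda>(r, s). g (c + s) (rs ! r)) (if i < length xs then i else Suc i, Suc j)) =
      mat n n (\<lambda>(r, s). g (c' + s) (rs' ! r))"
    by (rule eq_matI) (auto simp: rs dims nth_append)
  finally show ?thesis using ev unfolding dims(1) by simp
qed

definition Phi_column :: "(nat \<Rightarrow> mpoly) \<Rightarrow> nat \<Rightarrow> mpoly list" where
  "Phi_column w i = [w i * w i, vc i * vc i, vb i * vb i, 1, - (w i * vc i), w i * vb i, - w i, - (vc i * vb i), vc i, - vb i]"

text \<open>The six fixed points make the first six columns unit vectors, modulo earlier ones. Removing
  them leaves the rows of \<open>x y, x z, y w, z w\<close>, on which \<open>e\<^sub>p\<close> takes the values \<open>- w\<^sub>p c\<^sub>p, w\<^sub>p b\<^sub>p, c\<^sub>p, - b\<^sub>p\<close>.\<close>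

lemma det_Phi:
  assumes "sorted_list_of_set \<sigma> = [i, j, k, l]"
  shows "det (Phi w \<sigma>) = det4 vb vc w i j k l"
proof -
  let ?M = "[[1, 0, 0, 0, 0, 0, 0, 0, 0, 0],
     [0, 0, 0, 1, 0, 0, 0, 0, 0, 0],
     [1, 0, 0, 1, 0, 0, 1, 0, 0, 0],
     [0, 1, 0, 0, 0, 0, 0, 0, 0, 0],
     [0, 0, 1, 0, 0, 0, 0, 0, 0, 0],
     [0, 1, 1, 0, 0, 0, 0, 1, 0, 0],
     Phi_column w i, Phi_column w j, Phi_column w k, Phi_column w l]"
  define g where "g c r = ?M ! c ! r" for c r
  have e: "veronese (e_vec w p) = vec_of_list (Phi_column w p)" for p
    by (simp add: veronese_def e_vec_def Phi_column_def power2_eq_square numeral_eq_Suc Let_def)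
  have M: "map veronese (map vec_of_list
       [[1, 0, 0, 0], [0, 0, 0, 1], [1, 0, 0, 1],
        [0, 1, 0, 0], [0, 0, 1, 0], [0, 1, 1, 0]]
      @ map (e_vec w) [i, j, k, l]) = map vec_of_list ?M"
    by (simp add: e) (simp add: veronese_def numeral_eq_Suc)
  have "Phi w \<sigma> = mat 10 10 (\<lambda>(r, s). g (0 + s) ([0, 1, 2, 3, 4, 5, 6, 7, 8, 9] ! r))"
  proof -
    have "length ?M = 10" by simp
    then have "Phi w \<sigma> = mat 10 10 (\<lambda>(r, s). ?M ! s ! r)"
      unfolding Phi_def assms M by (intro eq_matI) (auto simp only: mat_of_cols_def dim_row_mat dim_col_mat
          index_mat length_map nth_map vec_of_list_index split_conv)
    moreover have "[0, 1, 2, 3, 4, 5, 6, 7, 8, 9] ! r = r" if "r < 10" for r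
    proof -
      have "[0, 1, 2, 3, 4, 5, 6, 7, 8, 9] = [0..<10]" by (simp add: upt_rec)
      then show ?thesis using that by simp
    qed
    ultimately show ?thesis unfolding g_def by (intro eq_matI) simp_all
  qed
  moreover have "det (mat 10 10 (\<lambda>(r, s). g (0 + s) ([0, 1, 2, 3, 4, 5, 6, 7, 8, 9] ! r))) =
      det (mat 9 9 (\<lambda>(r, s). g (1 + s) ([1, 2, 3, 4, 5, 6, 7, 8, 9] ! r)))"
    by (rule det_drop_column[where xs = "[]" and y = 0 and zs = "[1, 2, 3, 4, 5, 6, 7, 8, 9]"]) (auto simp: g_def)
  moreover have "\<dots> = det (mat 8 8 (\<lambda>(r, s). g (2 + s) ([1, 2, 4, 5, 6, 7, 8, 9] ! r)))"
    by (rule det_drop_column[where xs = "[1, 2]" and y = 3 and zs = "[4, 5, 6, 7, 8, 9]"]) (auto simp: g_def)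
  moreover have "\<dots> = det (mat 7 7 (\<lambda>(r, s). g (3 + s) ([1, 2, 4, 5, 7, 8, 9] ! r)))"
    by (rule det_drop_column[where xs = "[1, 2, 4, 5]" and y = 6 and zs = "[7, 8, 9]"]) (auto simp: g_def)
  moreover have "\<dots> = det (mat 6 6 (\<lambda>(r, s). g (4 + s) ([2, 4, 5, 7, 8, 9] ! r)))"
    by (rule det_drop_column[where xs = "[]" and y = 1 and zs = "[2, 4, 5, 7, 8, 9]"]) (auto simp: g_def)
  moreover have "\<dots> = det (mat 5 5 (\<lambda>(r, s). g (5 + s) ([4, 5, 7, 8, 9] ! r)))"
    by (rule det_drop_column[where xs = "[]" and y = 2 and zs = "[4, 5, 7, 8, 9]"]) (auto simp: g_def)
  moreover have "\<dots> = det (mat 4 4 (\<lambda>(r, s). g (6 + s) ([4, 5, 8, 9] ! r)))"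
    by (rule det_drop_column[where xs = "[4, 5]" and y = 7 and zs = "[8, 9]"]) (auto simp: g_def)
  moreover have "\<dots> = det4 vb vc w i j k l"
  proof -
    define e where "e s r = g (6 + s) ([4, 5, 8, 9] ! r)" for s r
    have e: "e 0 r = Phi_column w i ! ([4, 5, 8, 9] ! r)" "e 1 r = Phi_column w j ! ([4, 5, 8, 9] ! r)"
      "e 2 r = Phi_column w k ! ([4, 5, 8, 9] ! r)" "e 3 r = Phi_column w l ! ([4, 5, 8, 9] ! r)" for r
      by (simp_all add: e_def g_def)
    have rows: "Phi_column w p ! ([4, 5, 8, 9] ! 0) = - (w p * vc p)" "Phi_column w p ! ([4, 5, 8, 9] ! 1) = w p * vb p"
      "Phi_column w p ! ([4, 5, 8, 9] ! 2) = vc p" "Phi_column w p ! ([4, 5, 8, 9] ! 3) = - vb p" for p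
      by (simp_all add: Phi_column_def)
    have "det (mat 4 4 (\<lambda>(r, s). e s r)) = 
       e 0 0 * det3 (\<lambda>r. e 1 r) (\<lambda>r. e 2 r) (\<lambda>r. e 3 r) 1 2 3
       - e 0 1 * det3 (\<lambda>r. e 1 r) (\<lambda>r. e 2 r) (\<lambda>r. e 3 r) 0 2 3
       + e 0 2 * det3 (\<lambda>r. e 1 r) (\<lambda>r. e 2 r) (\<lambda>r. e 3 r) 0 1 3
       - e 0 3 * det3 (\<lambda>r. e 1 r) (\<lambda>r. e 2 r) (\<lambda>r. e 3 r) 0 1 2"
      unfolding det_mat_4 det_mat_3 det3_def by (simp add: numeral_eq_Suc algebra_simps)
    also have "\<dots> = det4 vb vc w i j k l"
      unfolding det3_def e rows det4_def Let_def by (simp add: algebra_simps)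
    finally show ?thesis by (simp add: e_def)
  qed
  ultimately show ?thesis by simp
qed


section \<open>Generators of the translation ideals\<close>

lemma det3_generator:
  assumes "r < s" "s < t" "t < 4" "i < j" "j < k" "k < m"
  shows "det3 (plane_row w r) (plane_row w s) (plane_row w t) i j k \<in> translation_generators m w"
proof -
  have "det (submatrix (back_projected_planes m w) {r, s, t} {i, j, k}) \<in> minors 3 (back_projected_planes m w)"
    unfolding minors_def
    by (rule CollectI, rule exI[of _ "{r, s, t}"], rule exI[of _ "{i, j, k}"])
      (use assms in \<open>auto simp: planes_dim\<close>)
  then show ?thesis
    unfolding translation_generators_def det_submatrix_planes[OF assms] by blast
qed

lemma det4_generator:
  assumes "i < j" "j < k" "k < l" "l < m"
  shows "det4 vb vc w i j k l \<in> translation_generators m w"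
proof -
  have "sorted_list_of_set {i, j, k, l} = [i, j, k, l]"
    using assms sorted_list_of_set.idem_if_sorted_distinct[of "[i, j, k, l]"] by simp
  then have "det4 vb vc w i j k l = det (Phi w {i, j, k, l})" by (rule det_Phi[symmetric])
  moreover have "{i, j, k, l} \<subseteq> {..<m} \<and> card {i, j, k, l} = 4" using assms by auto
  ultimately show ?thesis unfolding translation_generators_def by blast
qed

lemma length_3E: assumes "length xs = 3" obtains i j k where "xs = [i, j, k]"
  using assms by (auto simp: numeral_eq_Suc length_Suc_conv)

lemma length_4E: assumes "length xs = 4" obtains i j k l where "xs = [i, j, k, l]"
  using assms by (auto simp: numeral_eq_Suc length_Suc_conv)

lemma sorted_triple:
  assumes "card (I :: nat set) = 3"
  obtains i j k where "I = {i, j, k}" "i < j" "j < k"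
proof -
  have fin: "finite I" using assms card.infinite by fastforce
  have "length (sorted_list_of_set I) = 3" using assms by simp
  then obtain i j k where l: "sorted_list_of_set I = [i, j, k]"
    by (rule length_3E)
  have "I = {i, j, k}" using l set_sorted_list_of_set[OF fin] by auto
  moreover have "i \<le> j" "j \<le> k" "i \<noteq> j" "j \<noteq> k"
    using sorted_list_of_set.sorted_sorted_key_list_of_set[of I] sorted_list_of_set.distinct_sorted_key_list_of_set[of I] l by auto
  ultimately show ?thesis using that by simp
qed

text \<open>Explicit polynomials in place of determinants of submatrices: this is the form in which the
  generators are specialized, parametrized and combined below.\<close>

lemma generator_cases:
  assumes "g \<in> translation_generators m w"
  obtains (minor) r s t i j k where "r < s" "s < t" "t < 4" "i < j" "j < k" "k < m"
      "g = det3 (plane_row w r) (plane_row w s) (plane_row w t) i j k"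
  | (quad) i j k l where "i < j" "j < k" "k < l" "l < m" "g = det4 vb vc w i j k l"
proof -
  consider "g \<in> minors 3 (back_projected_planes m w)" |
    \<sigma> where "\<sigma> \<subseteq> {..<m}" "card \<sigma> = 4" "g = det (Phi w \<sigma>)"
    using assms unfolding translation_generators_def by blast
  then show ?thesis
  proof cases
    case 1
    then obtain I J where IJ: "I \<subseteq> {..<4}" "J \<subseteq> {..<m}" "card I = 3" "card J = 3"
      "g = det (submatrix (back_projected_planes m w) I J)"
      unfolding minors_def planes_dim by blast
    obtain r s t where I: "I = {r, s, t}" "r < s" "s < t" using sorted_triple[OF IJ(3)] by metis
    obtain i j k where J: "J = {i, j, k}" "i < j" "j < k" using sorted_triple[OF IJ(4)] by metis
    show ?thesis
      by (rule minor[OF I(2,3) _ J(2,3)]) (use IJ I J det_submatrix_planes in auto)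
  next
    case (2 \<sigma>)
    have fin: "finite \<sigma>" using 2(1) finite_subset by blast
    have "length (sorted_list_of_set \<sigma>) = 4" using 2 by simp
    then obtain i j k l where l: "sorted_list_of_set \<sigma> = [i, j, k, l]"
      by (rule length_4E)
    have "\<sigma> = {i, j, k, l}" using l set_sorted_list_of_set[OF fin] by auto
    moreover have "i \<le> j" "j \<le> k" "k \<le> l" "i \<noteq> j" "j \<noteq> k" "k \<noteq> l"
      using sorted_list_of_set.sorted_sorted_key_list_of_set[of \<sigma>] sorted_list_of_set.distinct_sorted_key_list_of_set[of \<sigma>] l by auto
    ultimately show ?thesis using quad[of i j k l] 2 det_Phi[OF l, of w] by auto
  qed
qed

lemma plane_row_polys:
  assumes "r < 4" "p < m" "w p \<in> polys X" "set (L_vars m) \<subseteq> X"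
  shows "plane_row w r p \<in> polys X"
proof -
  have "L i p \<in> X" if "i < 3" for i using assms that by (auto simp: set_L_vars)
  moreover have "r = 0 \<or> r = 1 \<or> r = 2 \<or> r = 3" using assms by linarith
  ultimately show ?thesis using assms(3)
    by (auto simp: plane_row_def intro!: polys_intros)
qed

lemma translation_generators_polys:
  assumes w: "\<And>p. p < m \<Longrightarrow> w p \<in> polys X" and X: "set (L_vars m) \<subseteq> X"
  shows "translation_generators m w \<subseteq> polys X"
proof
  fix g assume "g \<in> translation_generators m w"
  then show "g \<in> polys X"
  proof (cases rule: generator_cases)
    case (minor r s t i j k)
    have "plane_row w a b \<in> polys X" if "a \<in> {r, s, t}" "b \<in> {i, j, k}" for a b
      using that minor w by (intro plane_row_polys[OF _ _ _ X]) auto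
    then show ?thesis unfolding minor(7) det3_def by (intro polys_plus polys_minus polys_times) auto
  next
    case (quad i j k l)
    have "L a b \<in> X" if "a < 3" "b \<in> {i, j, k, l}" for a b
      using that quad X by (auto simp: set_L_vars)
    then have v: "vb b \<in> polys X" "vc b \<in> polys X" "w b \<in> polys X" if "b \<in> {i, j, k, l}" for b
      using that quad w by (auto intro!: polys_Var)
    show ?thesis unfolding quad(5) det4_def Let_def
      by (intro polys_plus polys_minus polys_times polys_uminus v) auto
  qed
qed

lemma specialize_Var [simp]:
  "specialize u (Var (L i j)) = Var (L i j)" "specialize u (Var (V j)) = Const (u $ j)"
  by (simp_all add: specialize_eq_subst subst_Var[OF comm_ring_hom_Const] specialize_var_def)

lemma specialize_generators:
  "specialize u ` translation_generators m (\<lambda>j. Var (V j)) \<subseteq> translation_generators m (\<lambda>j. Const (u $ j))"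
proof safe
  interpret sp: comm_ring_hom "specialize u" by (rule comm_ring_hom_specialize)
  fix g assume "g \<in> translation_generators m (\<lambda>j. Var (V j))"
  then show "specialize u g \<in> translation_generators m (\<lambda>j. Const (u $ j))"
  proof (cases rule: generator_cases)
    case (minor r s t i j k)
    have row: "specialize u (plane_row (\<lambda>j. Var (V j)) a p) = plane_row (\<lambda>j. Const (u $ j)) a p" if "a < 4" for a p
    proof -
      have "a = 0 \<or> a = 1 \<or> a = 2 \<or> a = 3" using that by linarith
      then show ?thesis by (auto simp: plane_row_def sp.hom_mult)
    qed
    have "specialize u g = det3 (plane_row (\<lambda>j. Const (u $ j)) r) (plane_row (\<lambda>j. Const (u $ j)) s)
        (plane_row (\<lambda>j. Const (u $ j)) t) i j k"
      unfolding minor(7) det3_def using minor(1-3)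
      by (simp add: sp.hom_add sp.hom_minus sp.hom_mult row)
    then show ?thesis using det3_generator[OF minor(1-6)] by simp
  next
    case (quad i j k l)
    have "specialize u g = det4 vb vc (\<lambda>j. Const (u $ j)) i j k l"
      unfolding quad(5) det4_def Let_def
      by (simp add: sp.hom_add sp.hom_minus sp.hom_mult sp.hom_uminus)
    then show ?thesis using det4_generator[OF quad(1-4)] by simp
  qed
qed

section \<open>Leading monomials with invertible coefficients\<close>

definition vprod :: "var list \<Rightarrow> monomial" where
  "vprod xs = (\<Sum>x\<leftarrow>xs. single x 1)"

lemma vprod_simps [simp]: "vprod [] = 0" "vprod (x # xs) = single x 1 + vprod xs"
  by (simp_all add: vprod_def)

lemma lookup_vprod: "lookup (vprod xs) x = count_list xs x"
  by (induction xs) (simp_all add: lookup_add lookup_single when_def)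

lemma prod_list_Var: "prod_list (map Var xs) = single (vprod xs) 1"
  by (induction xs) (simp_all add: Var_def mult_single)

lemma L_vars_append: "L_vars m = map (L 0) [0..<m] @ map (L 1) [0..<m] @ map (L 2) [0..<m]"
proof -
  have "[0..<3] = [0, 1, 2]" by (simp add: upt_rec)
  then show ?thesis by (simp add: L_vars_def)
qed

lemma distinct_L_vars: "distinct (L_vars m)"
  unfolding L_vars_append by (auto simp: distinct_map inj_on_def)

lemma length_L_vars: "length (L_vars m) = 3 * m"
  by (simp add: L_vars_append)

text \<open>The variables are listed coordinate by coordinate.\<close>

lemma nth_L_vars: "k < 3 * m \<Longrightarrow> L_vars m ! k = L (k div m) (k mod m)"
proof -
  assume k: "k < 3 * m"
  consider "k < m" | "m \<le> k" "k < 2 * m" | "2 * m \<le> k" by linarith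
  then show ?thesis
  proof cases
    case 2
    then have "k div m = 1" "k mod m = k - m"
      by (simp_all add: div_nat_eqI mod_if)
    moreover have "k - m < m" using 2 by linarith
    ultimately show ?thesis using 2 by (simp add: L_vars_append nth_append)
  next
    case 3
    then have "k div m = 2" using k by (intro div_nat_eqI) auto
    moreover from this have "k mod m = k - (m + m)" by (simp add: modulo_nat_def)
    moreover have "\<not> k - m < m" "\<not> k < m" "k - (m + m) < m" using 3 k by linarith+
    ultimately show ?thesis by (simp add: L_vars_append nth_append)
  qed (simp add: L_vars_append nth_append)
qed

lemma degree_vprod:
  "set ys \<subseteq> set (L_vars m) \<Longrightarrow> (\<Sum>x\<leftarrow>L_vars m. lookup (vprod ys) x) = length ys"
proof (induction ys)
  case (Cons y ys)
  have "(\<Sum>x\<leftarrow>L_vars m. lookup (single y (1::nat)) x) = 1"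
    using Cons.prems by (simp add: sum_list_distinct_conv_sum_set[OF distinct_L_vars] lookup_single when_def)
  then show ?case using Cons by (simp add: lookup_add sum_list_addf)
qed simp

text \<open>The reverse lexicographic comparison: the monomial with more of the last variable in which
  the two differ is the smaller one.\<close>

lemma grevlex_vprod:
  assumes "length xs = length ys" "set xs \<subseteq> set (L_vars m)" "set ys \<subseteq> set (L_vars m)"
    and r: "r < 3" "j < m" "count_list ys (L r j) < count_list xs (L r j)"
    and eq: "\<And>r' j'. r < r' \<or> r = r' \<and> j < j' \<Longrightarrow> count_list ys (L r' j') = count_list xs (L r' j')"
  shows "grevlex_less (L_vars m) (vprod xs) (vprod ys)"
proof -
  have "r * m + m \<le> 3 * m" using mult_le_mono1[of "Suc r" 3 m] r(1) by simp
  then have "r * m + j < length (L_vars m)" using r(2) unfolding length_L_vars by linarith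
  moreover from this have "L_vars m ! (r * m + j) = L r j"
    using r(2) by (simp add: length_L_vars nth_L_vars)
  moreover have "count_list ys (L_vars m ! k) = count_list xs (L_vars m ! k)"
    if "r * m + j < k" "k < length (L_vars m)" for k
  proof -
    have "r \<le> k div m" using that(1) r(2) div_le_mono[of "r * m + j" k m] by simp
    moreover have "j < k mod m" if "r = k div m"
    proof -
      have "k div m * m + j < k div m * m + k mod m" using that \<open>r * m + j < k\<close> by simp
      then show ?thesis by linarith
    qed
    ultimately show ?thesis
      using eq[of "k div m" "k mod m"] that(2) by (cases "r = k div m") (simp_all add: length_L_vars nth_L_vars)
  qed
  ultimately show ?thesis
    unfolding grevlex_less_def lookup_vprod[symmetric] degree_vprod[OF assms(2)] degree_vprod[OF assms(3)] assms(1)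
    using r(3) by (intro disjI2 conjI refl exI[of _ "r * m + j"]) (simp_all add: lookup_vprod)
qed

definition below :: "nat \<Rightarrow> monomial \<Rightarrow> mpoly \<Rightarrow> bool" where
  "below m t p \<longleftrightarrow> (\<forall>s\<in>keys p. grevlex_less (L_vars m) s t)"

lemma below_add: "below m t p \<Longrightarrow> below m t q \<Longrightarrow> below m t (p + q)"
  using keys_add[of p q] unfolding below_def by blast

lemma below_uminus: "below m t p \<Longrightarrow> below m t (- p)"
  unfolding below_def by simp

lemma below_minus: "below m t p \<Longrightarrow> below m t q \<Longrightarrow> below m t (p - q)"
  using below_add[of m t p "- q"] below_uminus[of m t q] by simp

lemma below_coeff:
  assumes "\<kappa> \<in> polys (set (V_vars m))" "grevlex_less (L_vars m) s t"
  shows "below m t (\<kappa> * single s 1)"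
  unfolding below_def
proof
  fix r assume "r \<in> keys (\<kappa> * single s 1)"
  then obtain k where k: "k \<in> keys \<kappa>" "r = k + s"
    using keys_mult[of \<kappa> "single s 1"] by auto
  have "keys k \<subseteq> set (V_vars m)" using k(1) assms(1) unfolding polys_def by blast
  then have "lookup k x = 0" if "x \<in> set (L_vars m)" for x
    using that by (auto simp: set_V_vars set_L_vars in_keys_iff)
  then have "grevlex_less (L_vars m) r t \<longleftrightarrow> grevlex_less (L_vars m) s t"
    by (intro grevlex_cong) (simp_all add: k(2) lookup_add)
  then show "grevlex_less (L_vars m) r t" using assms(2) by simp
qed

text \<open>\<open>h\<close> has leading \<open>\<ell>\<close>-monomial \<open>t\<close>, and its coefficient, a polynomial in \<open>v\<close>, is nonzero at \<open>u\<close>.\<close>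

definition lifted_leader :: "nat \<Rightarrow> complex vec \<Rightarrow> monomial \<Rightarrow> mpoly \<Rightarrow> bool" where
  "lifted_leader m u t h \<longleftrightarrow> (\<exists>\<kappa> k r. h = \<kappa> * single t 1 + r \<and>
     \<kappa> \<in> polys (set (V_vars m)) \<and> specialize u \<kappa> = Const k \<and> k \<noteq> 0 \<and> below m t r)"

lemma specialize_below:
  assumes "below m t r"
  shows "below m t (specialize u r)"
  unfolding below_def
proof
  fix s assume "s \<in> keys (specialize u r)"
  then obtain s' where s': "s' \<in> keys r" "s = part L_all s'"
    using keys_specialize by blast
  have "grevlex_less (L_vars m) s t \<longleftrightarrow> grevlex_less (L_vars m) s' t"
    by (rule grevlex_cong) (simp_all add: s'(2) lookup_part_L_vars)
  then show "grevlex_less (L_vars m) s t" using s'(1) assms unfolding below_def by blast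
qed

lemma lifted_leader_specialize:
  assumes h: "lifted_leader m u t h" and t: "keys t \<subseteq> set (L_vars m)"
  shows "\<exists>k r. k \<noteq> 0 \<and> specialize u h = single t k + r \<and> below m t r"
    and "lookup (specialize u h) t \<noteq> 0"
    and "\<forall>s\<in>keys h. L_le m s t"
proof -
  interpret sp: comm_ring_hom "specialize u" by (rule comm_ring_hom_specialize)
  obtain \<kappa> k r where h: "h = \<kappa> * single t 1 + r" and \<kappa>: "\<kappa> \<in> polys (set (V_vars m))"
    and k: "specialize u \<kappa> = Const k" "k \<noteq> 0" and r: "below m t r"
    using h unfolding lifted_leader_def by blast
  have "part L_all t = t" using t L_vars_subset_L_all by (intro part_ident) blast
  moreover have "subst_mon (camera_value u) t = 1"
    unfolding subst_mon_def using t by (intro prod.neutral) (auto simp: camera_value_def set_L_vars)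
  ultimately have sp: "specialize u h = single t k + specialize u r"
    by (simp add: h sp.hom_add sp.hom_mult k(1) specialize_single Const_def mult_single)
  moreover have ru: "below m t (specialize u r)" by (rule specialize_below[OF r])
  ultimately show "\<exists>k r. k \<noteq> 0 \<and> specialize u h = single t k + r \<and> below m t r"
    using k(2) by blast
  have "t \<notin> keys (specialize u r)" using ru grevlex_irrefl unfolding below_def by blast
  then show "lookup (specialize u h) t \<noteq> 0"
    by (simp add: sp lookup_add in_keys_iff k(2))
  show "\<forall>s\<in>keys h. L_le m s t"
  proof
    fix s assume "s \<in> keys h"
    then consider "s \<in> keys r" | "s \<in> keys (\<kappa> * single t 1)"
      using keys_add[of "\<kappa> * single t 1" r] unfolding h by blast
    then show "L_le m s t"
    proof cases
      case 1
      then show ?thesis using r unfolding below_def L_le_def by blast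
    next
      case 2
      then obtain q where q: "q \<in> keys \<kappa>" "s = q + t"
        using keys_mult[of \<kappa> "single t 1"] by auto
      have "keys q \<subseteq> set (V_vars m)" using q(1) \<kappa> unfolding polys_def by blast
      then have "lookup q x = 0" if "x \<in> set (L_vars m)" for x
        using that by (auto simp: set_V_vars set_L_vars in_keys_iff)
      then show ?thesis unfolding L_le_def by (simp add: q(2) lookup_add)
    qed
  qed
qed

text \<open>The variables up to \<open>L r j\<close> in the order of the coordinates, and of the columns inside a
  coordinate.\<close>

fun var_upto :: "nat \<Rightarrow> nat \<Rightarrow> var \<Rightarrow> bool" where
  "var_upto r j (L r' j') \<longleftrightarrow> r' < r \<or> r' = r \<and> j' \<le> j"
| "var_upto r j (V j') \<longleftrightarrow> False"

lemma L_in_L_vars [simp]: "L r j \<in> set (L_vars m) \<longleftrightarrow> r < 3 \<and> j < m"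
  by (simp add: set_L_vars)

text \<open>In all the combinations of generators that follow, a lower term contains a variable that is later
  in the list than every variable of the leading monomial.\<close>

lemma below_term:
  assumes \<kappa>: "\<kappa> \<in> polys (set (V_vars m))" and len: "length xs = length ys"
    and L: "\<forall>x\<in>set (xs @ ys). x \<in> set (L_vars m) \<and> var_upto r j x"
    and witness: "L r j \<in> set xs" "L r j \<notin> set ys"
  shows "below m (vprod ys) (\<kappa> * prod_list (map Var xs))"
  unfolding prod_list_Var
proof (rule below_coeff[OF \<kappa>], rule grevlex_vprod[OF len])
  show "count_list ys (L r' j') = count_list xs (L r' j')" if "r < r' \<or> r = r' \<and> j < j'" for r' j'
  proof -
    have "L r' j' \<notin> set (xs @ ys)" using L that by fastforce
    then show ?thesis by (simp add: count_list_0_iff)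
  qed
  show "count_list ys (L r j) < count_list xs (L r j)"
    using witness by (metis count_list_0_iff gr0I)
  have "L r j \<in> set (xs @ ys)" using witness(1) by simp
  then have "L r j \<in> set (L_vars m)" using L by blast
  then show "r < 3" "j < m" by simp_all
qed (use L in auto)

lemma lifted_leaderI:
  assumes "h = \<kappa> * prod_list (map Var ys) + r" "distinct ys" "F = set ys"
    "\<kappa> \<in> polys (set (V_vars m))" "specialize u \<kappa> = Const k" "k \<noteq> 0" "below m (vprod ys) r"
  shows "lifted_leader m u (\<Sum>x\<in>F. single x 1) h"
proof -
  have "(\<Sum>x\<in>F. single x 1) = vprod ys"
    unfolding vprod_def assms(3) using assms(2) by (simp add: sum_list_distinct_conv_sum_set)
  then show ?thesis
    unfolding lifted_leader_def
    by (intro exI[of _ \<kappa>] exI[of _ k] exI[of _ r] conjI) (use assms in \<open>simp_all add: prod_list_Var\<close>)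
qed

lemma generators_polys:
  "translation_generators m (\<lambda>j. Var (V j)) \<subseteq> polys (set (L_vars m) \<union> set (V_vars m))"
  "translation_generators m (\<lambda>j. Const (u $ j)) \<subseteq> polys (set (L_vars m))"
  by (rule translation_generators_polys; auto simp: set_V_vars intro: polys_Var polys_Const)+

lemma indeterminate_ideal_closed:
  fixes m
  defines "I \<equiv> indeterminate_translation_ideal m"
  shows "g \<in> translation_generators m (\<lambda>j. Var (V j)) \<Longrightarrow> g \<in> I"
    and "p \<in> I \<Longrightarrow> q \<in> I \<Longrightarrow> p + q \<in> I" and "p \<in> I \<Longrightarrow> q \<in> I \<Longrightarrow> p - q \<in> I"
    and "q \<in> polys (set (L_vars m) \<union> set (V_vars m)) \<Longrightarrow> p \<in> I \<Longrightarrow> q * p \<in> I"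
  unfolding I_def indeterminate_translation_ideal_def
  using idl_superset[OF generators_polys(1)] idl_add[OF generators_polys(1)] idl_minus[OF generators_polys(1)]
    idl_mult[OF generators_polys(1)] by blast+

text \<open>The first two and the fourth pattern are leading monomials of generators. For the third one,
  \<open>N e\<close> is the 3-minor of the rows \<open>(v - v\<^sub>e) a, b, c\<close>: the choice \<open>e = k\<close> deletes all terms that contain \<open>a\<^sub>k\<close>,
  among them the one that would otherwise compete with \<open>c\<^sub>i a\<^sub>j b\<^sub>k\<close>. For the last one, three such
  minors are combined so that the terms with \<open>c\<^sub>i\<close> cancel, and of those with \<open>c\<^sub>j\<close> only one is left.\<close>

lemma forbidden_lift:
  assumes F: "F \<in> forbidden" "F \<subseteq> set (L_vars m)"
    and distinct: "\<forall>i<m. \<forall>j<m. i \<noteq> j \<longrightarrow> u $ i \<noteq> u $ j"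
  shows "\<exists>h\<in>indeterminate_translation_ideal m. lifted_leader m u (\<Sum>x\<in>F. single x 1) h"
proof -
  let ?I = "indeterminate_translation_ideal m" and ?w = "\<lambda>j. Var (V j)"
  interpret sp: comm_ring_hom "specialize u" by (rule comm_ring_hom_specialize)
  interpret C: comm_ring_hom Const by (rule comm_ring_hom_Const)
  define \<delta> where "\<delta> p q = ?w p - ?w q" for p q
  have \<delta>V: "\<delta> p q \<in> polys (set (V_vars m))" if "p < m" "q < m" for p q
    unfolding \<delta>_def by (intro polys_minus polys_Var) (use that in \<open>auto simp: set_V_vars\<close>)
  have \<delta>\<delta>V: "\<delta> p q * \<delta> r s \<in> polys (set (V_vars m))" if "p < m" "q < m" "r < m" "s < m" for p q r s
    using that by (intro polys_times \<delta>V)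
  have \<delta>u: "specialize u (\<delta> p q) = Const (u $ p - u $ q)" for p q
    by (simp add: \<delta>_def sp.hom_minus C.hom_minus)
  have \<delta>\<delta>u: "specialize u (\<delta> p q * \<delta> r s) = Const ((u $ p - u $ q) * (u $ r - u $ s))" for p q r s
    by (simp add: sp.hom_mult \<delta>u C.hom_mult)
  define N where "N e i j k = det3 (plane_row ?w 1) (plane_row ?w 2) (plane_row ?w 3) i j k -
      ?w e * det3 (plane_row ?w 0) (plane_row ?w 1) (plane_row ?w 2) i j k" for e i j k
  have N: "N e i j k \<in> ?I" if "i < j" "j < k" "k < m" "e < m" for e i j k
    unfolding N_def using that
    by (intro indeterminate_ideal_closed(3) indeterminate_ideal_closed(4) indeterminate_ideal_closed(1)
        det3_generator polys_Var) (auto simp: set_V_vars)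
  have rows: "plane_row ?w 0 = va" "plane_row ?w 1 = vb" "plane_row ?w 2 = vc" "plane_row ?w 3 = (\<lambda>p. ?w p * va p)"
    by (simp_all add: plane_row_def)
  show ?thesis using F(1)
  proof cases
    case (baa i j k)
    have k: "i < m" "j < m" "k < m" using F(2) baa by (auto simp: set_L_vars)
    have "lifted_leader m u (\<Sum>x\<in>F. single x 1) (det3 (plane_row ?w 0) (plane_row ?w 1) (plane_row ?w 3) i j k)"
    proof (rule lifted_leaderI)
      show "det3 (plane_row ?w 0) (plane_row ?w 1) (plane_row ?w 3) i j k =
        \<delta> j k * prod_list (map Var [L 1 i, L 0 j, L 0 k]) + 
        (\<delta> k i * prod_list (map Var [L 1 j, L 0 i, L 0 k]) + \<delta> i j * prod_list (map Var [L 1 k, L 0 i, L 0 j]))"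
        unfolding rows by (simp add: det3_def \<delta>_def algebra_simps)
      show "below m (vprod [L 1 i, L 0 j, L 0 k])
        (\<delta> k i * prod_list (map Var [L 1 j, L 0 i, L 0 k]) + \<delta> i j * prod_list (map Var [L 1 k, L 0 i, L 0 j]))"
        by (intro below_add, rule below_term[where r = 1 and j = j], (use baa(2-) k in \<open>simp_all add: \<delta>V\<close>)[5],
            rule below_term[where r = 1 and j = k], (use baa(2-) k in \<open>simp_all add: \<delta>V\<close>)[5])
    qed (use baa k distinct \<delta>V \<delta>u in auto)
    moreover have "det3 (plane_row ?w 0) (plane_row ?w 1) (plane_row ?w 3) i j k \<in> ?I"
      using baa k by (intro indeterminate_ideal_closed(1) det3_generator) auto
    ultimately show ?thesis by blast
  next
    case (caa i j k)
    have k: "i < m" "j < m" "k < m" using F(2) caa by (auto simp: set_L_vars)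
    have "lifted_leader m u (\<Sum>x\<in>F. single x 1) (det3 (plane_row ?w 0) (plane_row ?w 2) (plane_row ?w 3) i j k)"
    proof (rule lifted_leaderI)
      show "det3 (plane_row ?w 0) (plane_row ?w 2) (plane_row ?w 3) i j k =
        \<delta> j k * prod_list (map Var [L 2 i, L 0 j, L 0 k]) + 
        (\<delta> k i * prod_list (map Var [L 2 j, L 0 i, L 0 k]) + \<delta> i j * prod_list (map Var [L 2 k, L 0 i, L 0 j]))"
        unfolding rows by (simp add: det3_def \<delta>_def algebra_simps)
      show "below m (vprod [L 2 i, L 0 j, L 0 k])
        (\<delta> k i * prod_list (map Var [L 2 j, L 0 i, L 0 k]) + \<delta> i j * prod_list (map Var [L 2 k, L 0 i, L 0 j]))"
        by (intro below_add, rule below_term[where r = 2 and j = j], (use caa(2-) k in \<open>simp_all add: \<delta>V\<close>)[5],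
            rule below_term[where r = 2 and j = k], (use caa(2-) k in \<open>simp_all add: \<delta>V\<close>)[5])
    qed (use caa k distinct \<delta>V \<delta>u in auto)
    moreover have "det3 (plane_row ?w 0) (plane_row ?w 2) (plane_row ?w 3) i j k \<in> ?I"
      using caa k by (intro indeterminate_ideal_closed(1) det3_generator) auto
    ultimately show ?thesis by blast
  next
    case (cab i j k)
    have k: "i < m" "j < m" "k < m" using F(2) cab by (auto simp: set_L_vars)
    let ?h = "N k i j k"
    have h: "lifted_leader m u (\<Sum>x\<in>F. single x 1) ?h"
    proof (rule lifted_leaderI)
      show "?h = \<delta> j k * prod_list (map Var [L 2 i, L 0 j, L 1 k]) + 
        (\<delta> i k * prod_list (map Var [L 0 i, L 1 j, L 2 k]) - \<delta> i k * prod_list (map Var [L 0 i, L 1 k, L 2 j])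
         - \<delta> j k * prod_list (map Var [L 0 j, L 1 i, L 2 k]))"
        unfolding N_def rows by (simp add: det3_def \<delta>_def algebra_simps)
      show "below m (vprod [L 2 i, L 0 j, L 1 k])
        (\<delta> i k * prod_list (map Var [L 0 i, L 1 j, L 2 k]) - \<delta> i k * prod_list (map Var [L 0 i, L 1 k, L 2 j])
         - \<delta> j k * prod_list (map Var [L 0 j, L 1 i, L 2 k]))"
        by (intro below_minus, rule below_term[where r = 2 and j = k], (use cab(2-) k in \<open>simp_all add: \<delta>V\<close>)[5],
            rule below_term[where r = 2 and j = j], (use cab(2-) k in \<open>simp_all add: \<delta>V\<close>)[5],
            rule below_term[where r = 2 and j = k], (use cab(2-) k in \<open>simp_all add: \<delta>V\<close>)[5])
    qed (use cab k distinct \<delta>V \<delta>u in auto)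
    have "?h \<in> ?I"
    proof (cases "j < k")
      case True
      then show ?thesis using N cab k by blast
    next
      case False
      then have "N k i k j \<in> ?I" using N[of i k j k] cab k by simp
      \<comment> \<open>The minor is alternating in its columns.\<close>
      moreover have "?h = (- 1) * N k i k j"
        unfolding N_def det3_def by (simp add: algebra_simps)
      ultimately show ?thesis by (simp only:) (intro indeterminate_ideal_closed(4) polys_uminus polys_one)
    qed
    then show ?thesis using h by blast
  next
    case (ccbb i j k l)
    have k: "i < m" "j < m" "k < m" "l < m" using F(2) ccbb by (auto simp: set_L_vars)
    let ?r = "\<delta> j i * \<delta> k l * prod_list (map Var [L 2 k, L 2 l, L 1 i, L 1 j])
      + \<delta> k i * \<delta> l j * prod_list (map Var [L 2 j, L 2 l, L 1 i, L 1 k])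
      + \<delta> l i * \<delta> j k * prod_list (map Var [L 2 j, L 2 k, L 1 i, L 1 l])
      + \<delta> k j * \<delta> i l * prod_list (map Var [L 2 i, L 2 l, L 1 j, L 1 k])
      + \<delta> l j * \<delta> k i * prod_list (map Var [L 2 i, L 2 k, L 1 j, L 1 l])"
    have "lifted_leader m u (\<Sum>x\<in>F. single x 1) (det4 vb vc ?w i j k l)"
    proof (rule lifted_leaderI)
      show "det4 vb vc ?w i j k l = \<delta> k l * \<delta> j i * prod_list (map Var [L 2 i, L 2 j, L 1 k, L 1 l]) + ?r"
        unfolding det4_def Let_def by (simp add: \<delta>_def algebra_simps)
      show "below m (vprod [L 2 i, L 2 j, L 1 k, L 1 l]) ?r"
        by (intro below_add,
            rule below_term[where r = 2 and j = l], (use ccbb(2-) k in \<open>simp_all add: \<delta>\<delta>V\<close>)[5],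
            rule below_term[where r = 2 and j = l], (use ccbb(2-) k in \<open>simp_all add: \<delta>\<delta>V\<close>)[5],
            rule below_term[where r = 2 and j = k], (use ccbb(2-) k in \<open>simp_all add: \<delta>\<delta>V\<close>)[5],
            rule below_term[where r = 2 and j = l], (use ccbb(2-) k in \<open>simp_all add: \<delta>\<delta>V\<close>)[5],
            rule below_term[where r = 2 and j = k], (use ccbb(2-) k in \<open>simp_all add: \<delta>\<delta>V\<close>)[5])
      show "specialize u (\<delta> k l * \<delta> j i) = Const ((u $ k - u $ l) * (u $ j - u $ i))" by (rule \<delta>\<delta>u)
    qed (use ccbb k distinct \<delta>\<delta>V in auto)
    moreover have "det4 vb vc ?w i j k l \<in> ?I"
      using ccbb k by (intro indeterminate_ideal_closed(1) det4_generator) auto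
    ultimately show ?thesis by blast
  next
    case (acbb i j k l)
    have k: "i < m" "j < m" "k < m" "l < m" using F(2) acbb by (auto simp: set_L_vars)
    let ?r = "\<delta> k l * \<delta> i j * prod_list (map Var [L 0 i, L 1 j, L 1 l, L 2 k])
      + \<delta> j k * \<delta> i l * prod_list (map Var [L 0 i, L 1 j, L 1 l, L 2 k])
      + \<delta> k j * \<delta> j l * prod_list (map Var [L 0 j, L 1 i, L 1 l, L 2 k])
      + \<delta> k j * \<delta> i l * prod_list (map Var [L 0 i, L 1 j, L 1 k, L 2 l])
      + \<delta> j k * \<delta> j l * prod_list (map Var [L 0 j, L 1 i, L 1 k, L 2 l])"
    let ?h = "\<delta> k l * vb l * N j i j k + \<delta> k j * vb j * N l i k l + \<delta> j k * vb i * N l j k l"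
    have "lifted_leader m u (\<Sum>x\<in>F. single x 1) ?h"
    proof (rule lifted_leaderI)
      show "?h = \<delta> k l * \<delta> j i * prod_list (map Var [L 0 i, L 2 j, L 1 k, L 1 l]) + ?r"
        unfolding N_def rows by (simp add: det3_def \<delta>_def algebra_simps)
      show "below m (vprod [L 0 i, L 2 j, L 1 k, L 1 l]) ?r"
        by (intro below_add,
            rule below_term[where r = 2 and j = k], (use acbb(2-) k in \<open>simp_all add: \<delta>\<delta>V\<close>)[5],
            rule below_term[where r = 2 and j = k], (use acbb(2-) k in \<open>simp_all add: \<delta>\<delta>V\<close>)[5],
            rule below_term[where r = 2 and j = k], (use acbb(2-) k in \<open>simp_all add: \<delta>\<delta>V\<close>)[5],
            rule below_term[where r = 2 and j = l], (use acbb(2-) k in \<open>simp_all add: \<delta>\<delta>V\<close>)[5],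
            rule below_term[where r = 2 and j = l], (use acbb(2-) k in \<open>simp_all add: \<delta>\<delta>V\<close>)[5])
      show "specialize u (\<delta> k l * \<delta> j i) = Const ((u $ k - u $ l) * (u $ j - u $ i))" by (rule \<delta>\<delta>u)
    qed (use acbb k distinct \<delta>\<delta>V in auto)
    moreover have "?h \<in> ?I"
      unfolding \<delta>_def using acbb k
      by (intro indeterminate_ideal_closed(2) indeterminate_ideal_closed(4) N polys_times polys_minus polys_Var)
        (auto simp: set_V_vars set_L_vars)
    ultimately show ?thesis by blast
  qed
qed

section \<open>A parametrization on which the ideal vanishes\<close>

context distinct_values
begin

definition var_degree :: "var \<Rightarrow> monomial" where
  "var_degree x = (case x of V j \<Rightarrow> 0 | L i j \<Rightarrow> single (V j) 1 + single (L i 0) 1)"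

text \<open>The multidegree as a monomial: the exponent of \<open>V j\<close> is the degree in column \<open>j\<close>, and the exponent
  of \<open>L i 0\<close> the degree in coordinate \<open>i\<close>. These variables play the part of \<open>\<lambda>\<^sub>j\<close> and of \<open>s, t, r\<close>.\<close>

definition degree_of :: "monomial \<Rightarrow> monomial" where
  "degree_of t = (\<Sum>x\<in>keys t. \<Sum>_<lookup t x. var_degree x)"

definition graded_value :: "var \<Rightarrow> (monomial \<Rightarrow>\<^sub>0 complex poly poly)" where
  "graded_value x = single (var_degree x) (val_xy x)"

text \<open>The parametrization with its scaling parameters. They are kept as monomials, so that the
  coefficients of the image separate the multidegrees.\<close>

definition param :: "mpoly \<Rightarrow> (monomial \<Rightarrow>\<^sub>0 complex poly poly)" where
  "param = subst (\<lambda>c. single 0 [:[:c:]:]) graded_value"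

lemma hom_graded: "comm_ring_hom (\<lambda>c::complex. single (0::monomial) [:[:c:]:])"
proof -
  have "comm_ring_hom (\<lambda>c::complex poly poly. single (0::monomial) c)"
    by unfold_locales (simp_all add: single_add mult_single)
  from comm_ring_hom_comp[OF hom_xy this] show ?thesis .
qed

lemma comm_ring_hom_param: "comm_ring_hom param"
  unfolding param_def by (rule comm_ring_hom_subst[OF hom_graded])

lemma param_Var: "param (Var x) = graded_value x"
  unfolding param_def by (rule subst_Var[OF hom_graded])

lemma param_Const: "param (Const c) = single 0 [:[:c:]:]"
  unfolding param_def by (rule subst_Const[OF hom_graded])

lemma single_power: "single d c ^ k = single (\<Sum>_<k. d) (c ^ k)"
  for d :: monomial and c :: "complex poly poly"
  by (induction k) (simp_all add: mult_single add.commute)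

lemma subst_mon_graded: "subst_mon graded_value t = single (degree_of t) (subst_mon val_xy t)"
  unfolding subst_mon_def graded_value_def single_power degree_of_def by (simp add: prod_single)

lemma lookup_param:
  "lookup (param p) \<delta> =
     eval_xy (\<Sum>t\<in>{t \<in> keys p. degree_of t = \<delta>}. single t (lookup p t))"
proof -
  have "param p = (\<Sum>t\<in>keys p. single (degree_of t) ([:[:lookup p t:]:] * subst_mon val_xy t))"
    unfolding param_def subst_def subst_mon_graded by (simp add: mult_single)
  then have "lookup (param p) \<delta> = (\<Sum>t\<in>keys p.
      if degree_of t = \<delta> then [:[:lookup p t:]:] * subst_mon val_xy t else 0)"
    by (simp only: lookup_sum lookup_single when_def)
  also have "\<dots> = (\<Sum>t\<in>{t \<in> keys p. degree_of t = \<delta>}. [:[:lookup p t:]:] * subst_mon val_xy t)"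
    by (rule sum.mono_neutral_cong_right) auto
  also have "\<dots> = eval_xy (\<Sum>t\<in>{t \<in> keys p. degree_of t = \<delta>}. single t (lookup p t))"
    by (simp add: subst_sum[OF hom_xy] subst_single[OF hom_xy])
  finally show ?thesis .
qed

lemma lookup_degree_of:
  "lookup (degree_of t) y =
    (\<Sum>x\<in>keys t. lookup t x * lookup (var_degree x) y)"
  by (simp add: degree_of_def lookup_sum)

lemma sum_keys_L_vars:
  assumes "keys t \<subseteq> set (L_vars n)"
  shows "(\<Sum>x\<in>keys t. lookup t x * f x) =
    (\<Sum>i<3. \<Sum>j<n. lookup t (L i j) * (f (L i j) :: nat))"
proof -
  have "(\<Sum>x\<in>keys t. lookup t x * f x) =
      (\<Sum>x\<in>set (L_vars n). lookup t x * f x)"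
    by (rule sum.mono_neutral_left) (use assms in \<open>auto simp: in_keys_iff\<close>)
  also have "set (L_vars n) = (\<lambda>(i, j). L i j) ` ({..<3} \<times> {..<n})" by (auto simp: set_L_vars)
  also have "(\<Sum>x\<in>\<dots>. lookup t x * f x) =
      (\<Sum>(i, j)\<in>{..<3} \<times> {..<n}. lookup t (L i j) * f (L i j))"
    by (subst sum.reindex) (auto simp: inj_on_def split_def)
  finally show ?thesis by (simp add: sum.cartesian_product)
qed

lemma multidegree_degree_of:
  assumes t: "keys t \<subseteq> set (L_vars n)"
  shows "multidegree n (\<lambda>j. lookup (degree_of t) (V j))
    (\<lambda>i. lookup (degree_of t) (L i 0)) t"
proof -
  have V: "lookup (var_degree (L i j)) (V j') = (if j = j' then 1 else 0)" for i j j'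
    by (simp add: var_degree_def lookup_add lookup_single when_def)
  have L: "lookup (var_degree (L i j)) (L i' 0) = (if i = i' then 1 else 0)" for i j i'
    by (simp add: var_degree_def lookup_add lookup_single when_def)
  show ?thesis
    unfolding multidegree_def
  proof (intro conjI allI impI)
    fix j assume j: "j < n"
    show "(\<Sum>i<3. lookup t (L i j)) = lookup (degree_of t) (V j)"
      unfolding lookup_degree_of sum_keys_L_vars[OF t] V using j by (simp add: if_distrib cong: if_cong)
  next
    fix i :: nat assume i: "i < 3"
    have "(\<Sum>i'<3. \<Sum>j<n. lookup t (L i' j) * (if i' = i then 1 else 0)) =
        (\<Sum>i'<3. if i' = i then \<Sum>j<n. lookup t (L i j) else 0)"
      by (rule sum.cong) auto
    then show "(\<Sum>j<n. lookup t (L i j)) = lookup (degree_of t) (L i 0)"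
      unfolding lookup_degree_of sum_keys_L_vars[OF t] L using i by simp
  qed (rule t)
qed

text \<open>The coefficients of \<open>param p\<close> are the values of the multihomogeneous components of \<open>p\<close>, to which
  \<open>standard_independent\<close> applies.\<close>

lemma standard_param_injective:
  assumes p: "p \<in> polys (set (L_vars n))" "\<And>t. t \<in> keys p \<Longrightarrow> standard t"
    and zero: "param p = 0"
  shows "p = 0"
proof (rule poly_mapping_eqI)
  fix t
  show "lookup p t = lookup 0 t"
  proof (cases "t \<in> keys p")
    case True
    let ?T = "{s \<in> keys p. degree_of s = degree_of t}"
    define q where "q = (\<Sum>s\<in>?T. single s (lookup p s))"
    have "eval_xy q = 0" using lookup_param[of p "degree_of t"] zero by (simp add: q_def)
    moreover have "multidegree n (\<lambda>j. lookup (degree_of t) (V j))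
        (\<lambda>i. lookup (degree_of t) (L i 0)) s \<and> standard s" if s: "s \<in> keys q" for s
    proof -
      have "s \<in> ?T" using subsetD[OF keys_sum s[unfolded q_def]] by (auto split: if_splits)
      then have "s \<in> keys p" "degree_of s = degree_of t" by auto
      then show ?thesis using multidegree_degree_of[of s] p unfolding polys_def by auto
    qed
    ultimately have "q = 0" using standard_independent by blast
    moreover have "lookup q t = lookup p t"
      using True by (simp add: q_def lookup_sum lookup_single when_def)
    ultimately show ?thesis by simp
  qed (simp add: in_keys_iff)
qed

lemma det3_rank_2:
  "det3 (\<lambda>p. f * x p + f' * y p) (\<lambda>p. g * x p + g' * y p) (\<lambda>p. h * x p + h' * y p) i j k = 0"
  by (simp add: det3_def algebra_simps)

lemma det4_scale:
  "det4 (\<lambda>p. s * x p * b p) (\<lambda>p. r * x p * c p) w i j k l = s * s * r * r * x i * x j * x k * x l * det4 b c w i j k l"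
  by (simp add: det4_def Let_def algebra_simps)

text \<open>The rows are the values at \<open>w\<^sub>i, w\<^sub>j, w\<^sub>k, w\<^sub>l\<close> of four polynomials of degree at most two, which are
  linearly dependent.\<close>

lemma det4_parametrized: "det4 (\<lambda>p. x + w p) (\<lambda>p. y + w p) w i j k l = 0"
  by (simp add: det4_def Let_def algebra_simps)

text \<open>On the parametrization the columns of the matrix of planes are \<open>\<lambda>\<^sub>p\<close> times affine linear functions
  of \<open>v\<^sub>p\<close>, so its rank is at most two.\<close>

lemma param_generator:
  assumes "g \<in> translation_generators m (\<lambda>j. Const (v j))"
  shows "param g = 0"
proof -
  interpret \<psi>: comm_ring_hom param by (rule comm_ring_hom_param)
  define S where "S i = single (single (L i 0) (1::nat)) (1 :: complex poly poly)" for i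
  define \<Lambda> where "\<Lambda> p = single (single (V p) (1::nat)) (1 :: complex poly poly)" for p
  define x where "x = single (0::monomial) ([:[:0, 1:]:] :: complex poly poly)"
  define y where "y = single (0::monomial) ([:0, 1:] :: complex poly poly)"
  define w where "w p = single (0::monomial) ([:[:v p:]:] :: complex poly poly)" for p
  have xw: "x + w p = single 0 [:[:v p, 1:]:]" "y + w p = single 0 [:[:v p:], 1:]" for p
    by (simp_all add: x_def y_def w_def single_add[symmetric])
  have a: "param (va p) = S 0 * \<Lambda> p" for p
    by (simp add: param_Var graded_value_def var_degree_def val_xy_def S_def \<Lambda>_def mult_single add.commute)
  have b: "param (vb p) = S 1 * \<Lambda> p * (x + w p)" for p
    unfolding xw by (simp add: param_Var graded_value_def var_degree_def val_xy_def S_def \<Lambda>_def mult_single add.commute)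
  have c: "param (vc p) = S 2 * \<Lambda> p * (y + w p)" for p
    unfolding xw by (simp add: param_Var graded_value_def var_degree_def val_xy_def S_def \<Lambda>_def mult_single add.commute)
  have W: "param (Const (v p)) = w p" for p
    unfolding w_def by (rule param_Const)
  show ?thesis using assms
  proof (cases rule: generator_cases)
    case (minor r s t i j k)
    have row: "\<exists>f f'. \<forall>p. param (plane_row (\<lambda>j. Const (v j)) r p) = f * \<Lambda> p + f' * (w p * \<Lambda> p)" if r: "r < 4" for r
    proof -
      consider "r = 0" | "r = 1" | "r = 2" | "r = 3" using r by linarith
      then show ?thesis
      proof cases
        case 1
        then show ?thesis by (intro exI[of _ "S 0"] exI[of _ 0]) (simp add: plane_row_def a)
      next
        case 2
        then show ?thesis by (intro exI[of _ "S 1 * x"] exI[of _ "S 1"]) (simp add: plane_row_def b[unfolded One_nat_def] algebra_simps)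
      next
        case 3
        then show ?thesis by (intro exI[of _ "S 2 * y"] exI[of _ "S 2"]) (simp add: plane_row_def c algebra_simps)
      next
        case 4
        then show ?thesis by (intro exI[of _ 0] exI[of _ "S 0"]) (simp add: plane_row_def a W \<psi>.hom_mult algebra_simps)
      qed
    qed
    obtain f f' where f: "\<And>p. param (plane_row (\<lambda>j. Const (v j)) r p) = f * \<Lambda> p + f' * (w p * \<Lambda> p)"
      using row[of r] minor by auto
    obtain g' g'' where g: "\<And>p. param (plane_row (\<lambda>j. Const (v j)) s p) = g' * \<Lambda> p + g'' * (w p * \<Lambda> p)"
      using row[of s] minor by auto
    obtain h h' where h: "\<And>p. param (plane_row (\<lambda>j. Const (v j)) t p) = h * \<Lambda> p + h' * (w p * \<Lambda> p)"
      using row[of t] minor by auto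
    have "param g = det3 (\<lambda>p. f * \<Lambda> p + f' * (w p * \<Lambda> p)) (\<lambda>p. g' * \<Lambda> p + g'' * (w p * \<Lambda> p))
        (\<lambda>p. h * \<Lambda> p + h' * (w p * \<Lambda> p)) i j k"
      unfolding minor(7) det3_def by (simp add: \<psi>.hom_add \<psi>.hom_minus \<psi>.hom_mult f g h)
    then show ?thesis by (simp only: det3_rank_2)
  next
    case (quad i j k l)
    have "param g = det4 (\<lambda>p. S 1 * \<Lambda> p * (x + w p)) (\<lambda>p. S 2 * \<Lambda> p * (y + w p)) w i j k l"
      unfolding quad(5) det4_def Let_def
      by (simp only: \<psi>.hom_add \<psi>.hom_minus \<psi>.hom_mult \<psi>.hom_uminus b c W)
    then show ?thesis by (simp only: det4_scale det4_parametrized mult_zero_right)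
  qed
qed

end

section \<open>Leading monomials of the specialized ideal\<close>

lemma keys_forbidden_sum: 
  assumes "finite F"
  shows "keys (\<Sum>x\<in>F. single x (1::nat)) = F"
    "lookup (\<Sum>x\<in>F. single x (1::nat)) x = (if x \<in> F then 1 else 0)"
proof -
  show *: "lookup (\<Sum>x\<in>F. single x (1::nat)) x = (if x \<in> F then 1 else 0)" for x
    using assms by (simp add: lookup_sum lookup_single when_def)
  show "keys (\<Sum>x\<in>F. single x (1::nat)) = F"
    by (auto simp: in_keys_iff *[unfolded One_nat_def] split: if_splits)
qed

lemma forbidden_finite: "F \<in> forbidden \<Longrightarrow> finite F"
  by (erule forbidden.cases) simp_all

lemma forbidden_dvd:
  assumes "F \<in> forbidden" "F \<subseteq> keys s"
  shows "monomial_dvd (\<Sum>x\<in>F. single x 1) s"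
proof -
  let ?t = "\<Sum>x\<in>F. single x (1::nat)"
  have "lookup ?t x \<le> lookup s x" for x
    using assms keys_forbidden_sum(2)[OF forbidden_finite[OF assms(1)], of x] by (auto simp: in_keys_iff)
  then have "s = ?t + (s - ?t)"
    by (intro poly_mapping_eqI) (simp add: lookup_add lookup_minus)
  then show ?thesis unfolding monomial_dvd_def by blast
qed

context
  fixes m :: nat and u :: "complex vec"
  assumes u_distinct: "\<forall>i<m. \<forall>j<m. i \<noteq> j \<longrightarrow> u $ i \<noteq> u $ j"
begin

interpretation distinct_values "($) u" m
  by unfold_locales (use u_distinct in blast)

interpretation O: monomial_order "set (L_vars m)" "grevlex_less (L_vars m)"
  by (rule monomial_order_grevlex)

lemma translation_ideal_closed:
  shows "translation_ideal m u \<subseteq> polys (set (L_vars m))" "0 \<in> translation_ideal m u"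
    and "p \<in> translation_ideal m u \<Longrightarrow> q \<in> translation_ideal m u \<Longrightarrow> p - q \<in> translation_ideal m u"
    and "q \<in> polys (set (L_vars m)) \<Longrightarrow> p \<in> translation_ideal m u \<Longrightarrow> q * p \<in> translation_ideal m u"
    and "(\<And>x. x \<in> A \<Longrightarrow> f x \<in> translation_ideal m u) \<Longrightarrow> sum f A \<in> translation_ideal m u"
  unfolding translation_ideal_def
  using idl_subset_polys[OF generators_polys(2)] idl_zero[OF generators_polys(2)] idl_minus[OF generators_polys(2)]
    idl_mult[OF generators_polys(2)] idl_sum[OF generators_polys(2)] by blast+

lemma specialize_ideal: "h \<in> indeterminate_translation_ideal m \<Longrightarrow> specialize u h \<in> translation_ideal m u"
  unfolding indeterminate_translation_ideal_def translation_ideal_def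
  by (rule specialize_genideal[OF generators_polys])
    (use specialize_generators idl_superset[OF generators_polys(2)] in blast)

lemma param_ideal: "f \<in> translation_ideal m u \<Longrightarrow> param f = 0"
proof -
  interpret \<psi>: comm_ring_hom param by (rule comm_ring_hom_param)
  assume "f \<in> translation_ideal m u"
  then have "f \<in> {p \<in> polys (set (L_vars m)). param p = 0}"
    unfolding translation_ideal_def
    by (rule genideal_poly_ring_induct)
      (use generators_polys(2) param_generator in
        \<open>auto simp: polys_zero polys_plus polys_times \<psi>.hom_zero \<psi>.hom_add \<psi>.hom_mult\<close>)
  then show ?thesis by simp
qed

text \<open>Division by the specialized lifts. The induction is along the monomial order, since each of them
  replaces a forbidden monomial by smaller ones.\<close>

lemma standard_form:
  assumes "keys s \<subseteq> set (L_vars m)"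
  shows "\<exists>r. r \<in> polys (set (L_vars m)) \<and> single s 1 - r \<in> translation_ideal m u \<and>
    (\<forall>k\<in>keys r. standard k \<and> (k = s \<or> grevlex_less (L_vars m) k s))"
  using assms
proof (induction s rule: wfp_induct_rule[OF O.wf])
  case (1 s)
  let ?J = "translation_ideal m u" and ?P = "polys (set (L_vars m))"
  show ?case
  proof (cases "standard s")
    case True
    then show ?thesis using "1.prems" translation_ideal_closed(2)
      by (intro exI[of _ "single s 1"]) (auto simp: polys_single)
  next
    case False
    then obtain F where F: "F \<in> forbidden" "F \<subseteq> keys s" unfolding standard_def by blast
    define t where "t = (\<Sum>x\<in>F. single x (1::nat))"
    have FL: "F \<subseteq> set (L_vars m)" using F "1.prems" by blast
    obtain h where h: "h \<in> indeterminate_translation_ideal m" "lifted_leader m u t h"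
      using forbidden_lift[OF F(1) FL u_distinct] unfolding t_def by blast
    obtain q where q: "s = t + q" using forbidden_dvd[OF F] unfolding t_def monomial_dvd_def by blast
    have "keys t \<subseteq> set (L_vars m)"
      using FL keys_forbidden_sum(1)[OF forbidden_finite[OF F(1)]] by (simp add: t_def)
    then obtain k r where k: "k \<noteq> 0" "specialize u h = single t k + r" "below m t r"
      using lifted_leader_specialize(1)[OF h(2)] by blast
    have tP: "single t k \<in> ?P" by (rule polys_single) fact
    have hJ: "specialize u h \<in> ?J" using specialize_ideal h(1) by blast
    then have "specialize u h - single t k \<in> ?P"
      using tP translation_ideal_closed(1) by (intro polys_minus) auto
    then have rP: "r \<in> ?P" by (simp add: k(2))
    define c where "c = single q (1 / k)"
    have "keys q \<subseteq> set (L_vars m)" using "1.prems" unfolding q keys_add_mon by blast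
    then have cP: "c \<in> ?P" unfolding c_def by (rule polys_single)
    have s_eq: "single s 1 = c * specialize u h - c * r"
      using k(1) by (simp add: k(2) c_def mult_single q algebra_simps)
    have less: "grevlex_less (L_vars m) l s" if l: "l \<in> keys (c * r)" for l
    proof -
      obtain l' where "l' \<in> keys r" "l = q + l'"
        using keys_mult[of c r] l by (auto simp: c_def split: if_splits)
      then show ?thesis using k(3) unfolding below_def q by (simp add: add.commute[of q] grevlex_add)
    qed
    have crP: "c * r \<in> ?P" using cP rP by (rule polys_times)
    have "\<forall>l\<in>keys (c * r). \<exists>r'. r' \<in> ?P \<and> single l 1 - r' \<in> ?J \<and>
        (\<forall>k\<in>keys r'. standard k \<and> (k = l \<or> grevlex_less (L_vars m) k l))"
      using "1.IH" less crP unfolding polys_def by blast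
    then obtain f where f: "\<And>l. l \<in> keys (c * r) \<Longrightarrow> f l \<in> ?P \<and> single l 1 - f l \<in> ?J \<and>
        (\<forall>k\<in>keys (f l). standard k \<and> (k = l \<or> grevlex_less (L_vars m) k l))"
      by metis
    let ?K = "keys (c * r)" and ?a = "\<lambda>l. Const (lookup (c * r) l)"
    define r' where "r' = - (\<Sum>l\<in>?K. ?a l * f l)"
    have cr: "c * r = (\<Sum>l\<in>?K. ?a l * single l 1)"
      using poly_eq_sum_singles[of "c * r"] by (simp add: Const_def mult_single)
    have "single s 1 - r' = c * specialize u h - (\<Sum>l\<in>?K. ?a l * (single l 1 - f l))"
    proof -
      have "(\<Sum>l\<in>?K. ?a l * (single l 1 - f l)) = c * r + r'"
        by (subst cr) (simp add: r'_def right_diff_distrib sum_subtractf)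
      then show ?thesis by (simp add: s_eq)
    qed
    also have "\<dots> \<in> ?J"
      by (rule translation_ideal_closed(3)[OF translation_ideal_closed(4)[OF cP hJ]],
          rule translation_ideal_closed(5), rule translation_ideal_closed(4), rule polys_Const)
        (use f in blast)
    finally have "single s 1 - r' \<in> ?J" .
    moreover have "r' \<in> ?P" unfolding r'_def by (intro polys_intros) (use f in blast)
    moreover have "standard l \<and> (l = s \<or> grevlex_less (L_vars m) l s)" if l: "l \<in> keys r'" for l
    proof -
      have "l \<in> (\<Union>x\<in>?K. keys (?a x * f x))"
        using subsetD[OF keys_sum] l by (simp add: r'_def)
      then obtain x where x: "x \<in> ?K" "l \<in> keys (?a x * f x)" by blast
      have "l \<in> keys (f x)"
        using keys_mult[of "?a x" "f x"] x(2) by (auto simp: Const_def split: if_splits)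
      then have "standard l" "l = x \<or> grevlex_less (L_vars m) l x" using f[OF x(1)] by blast+
      then show ?thesis using less[OF x(1)] O.trans by blast
    qed
    ultimately show ?thesis by blast
  qed
qed

text \<open>Bring all terms of \<open>f\<close> below the leading one into standard form. This does not touch the
  leading coefficient, yet the result \<open>g\<close> is a combination of standard monomials in the ideal, hence zero.\<close>

lemma leading_monomial_not_standard:
  assumes f: "f \<in> translation_ideal m u" "f \<noteq> 0"
  shows "\<not> standard (leading_monomial (grevlex_less (L_vars m)) f)"
proof
  let ?J = "translation_ideal m u" and ?P = "polys (set (L_vars m))"
  let ?t = "leading_monomial (grevlex_less (L_vars m)) f" and ?f = "lookup f"
  assume st: "standard ?t"
  have fP: "f \<in> ?P" using f(1) translation_ideal_closed(1) by blast
  note lm = O.leading_monomial[OF fP f(2)]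
  let ?K = "keys f - {?t}"
  have "\<forall>s\<in>?K. \<exists>r. r \<in> ?P \<and> single s 1 - r \<in> ?J \<and>
      (\<forall>k\<in>keys r. standard k \<and> (k = s \<or> grevlex_less (L_vars m) k s))"
    using standard_form fP unfolding polys_def by blast
  then obtain r where r: "\<And>s. s \<in> ?K \<Longrightarrow> r s \<in> ?P \<and> single s 1 - r s \<in> ?J \<and>
      (\<forall>k\<in>keys (r s). standard k \<and> (k = s \<or> grevlex_less (L_vars m) k s))"
    by metis
  define g where "g = single ?t (?f ?t) + (\<Sum>s\<in>?K. Const (?f s) * r s)"
  have f_eq: "f = single ?t (?f ?t) + (\<Sum>s\<in>?K. Const (?f s) * single s 1)"
    using poly_eq_sum_singles[of f] lm(1) by (simp add: Const_def mult_single sum.remove[of _ ?t])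
  have "f - g = (\<Sum>s\<in>?K. Const (?f s) * (single s 1 - r s))"
    by (rule trans[OF arg_cong2[of _ _ _ _ "(-)", OF f_eq g_def]])
      (simp add: right_diff_distrib sum_subtractf)
  also have "\<dots> \<in> ?J"
    by (rule translation_ideal_closed(5), rule translation_ideal_closed(4), rule polys_Const) (use r in blast)
  finally have "f - (f - g) \<in> ?J" by (rule translation_ideal_closed(3)[OF f(1)])
  then have gJ: "g \<in> ?J" by simp
  have keys: "\<exists>s\<in>?K. k \<in> keys (r s)" if k: "k \<in> keys (\<Sum>s\<in>?K. Const (?f s) * r s)" for k
  proof -
    obtain s where s: "s \<in> ?K" "k \<in> keys (Const (?f s) * r s)"
      using subsetD[OF keys_sum k] by blast
    then have "k \<in> keys (r s)"
      using keys_mult[of "Const (?f s)" "r s"] by (auto simp: Const_def split: if_splits)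
    then show ?thesis using s(1) by blast
  qed
  have "standard k" if k: "k \<in> keys g" for k
  proof -
    have "k \<in> keys (single ?t (?f ?t)) \<or> k \<in> keys (\<Sum>s\<in>?K. Const (?f s) * r s)"
      using subsetD[OF keys_add k[unfolded g_def]] by blast
    then show ?thesis
    proof
      assume "k \<in> keys (single ?t (?f ?t))"
      then show ?thesis using st by (simp split: if_splits)
    next
      assume "k \<in> keys (\<Sum>s\<in>?K. Const (?f s) * r s)"
      then show ?thesis using keys r by blast
    qed
  qed
  then have "g = 0"
    using standard_param_injective[of g] gJ translation_ideal_closed(1) param_ideal by blast
  moreover have "?t \<notin> keys (\<Sum>s\<in>?K. Const (?f s) * r s)"
  proof
    assume "?t \<in> keys (\<Sum>s\<in>?K. Const (?f s) * r s)"
    then obtain s where s: "s \<in> ?K" "?t \<in> keys (r s)" using keys by blast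
    then have "?t = s \<or> grevlex_less (L_vars m) ?t s" using r by blast
    then show False using lm(2)[of s] s(1) O.trans O.irrefl by blast
  qed
  moreover have "lookup g ?t = ?f ?t + lookup (\<Sum>s\<in>?K. Const (?f s) * r s) ?t"
    unfolding g_def by (simp only: lookup_add lookup_single_eq)
  ultimately have "?f ?t = 0" by (simp add: in_keys_iff)
  then show False using lm(1) by (simp add: in_keys_iff)
qed

lemma leading_monomial_lift:
  assumes f: "f \<in> translation_ideal m u" "f \<noteq> 0"
  shows "\<exists>h t. h \<in> indeterminate_translation_ideal m \<and> (\<forall>s\<in>keys h. L_le m s t) \<and>
    lookup (specialize u h) t \<noteq> 0 \<and>
    monomial_dvd t (leading_monomial (grevlex_less (L_vars m)) f)"
proof -
  let ?t = "leading_monomial (grevlex_less (L_vars m)) f"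
  obtain F where F: "F \<in> forbidden" "F \<subseteq> keys ?t"
    using leading_monomial_not_standard[OF f] unfolding standard_def by blast
  have fP: "f \<in> polys (set (L_vars m))" using f(1) translation_ideal_closed(1) by blast
  have FL: "F \<subseteq> set (L_vars m)"
    using F(2) O.leading_monomial(1)[OF fP f(2)] fP unfolding polys_def by blast
  obtain h where h: "h \<in> indeterminate_translation_ideal m" "lifted_leader m u (\<Sum>x\<in>F. single x 1) h"
    using forbidden_lift[OF F(1) FL u_distinct] by blast
  have "keys (\<Sum>x\<in>F. single x (1::nat)) \<subseteq> set (L_vars m)"
    using FL keys_forbidden_sum(1)[OF forbidden_finite[OF F(1)]] by simp
  then show ?thesis
    using h(1) lifted_leader_specialize(2,3)[OF h(2)] forbidden_dvd[OF F] by blast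
qed

end

theorem theorem6p2:
  fixes m :: nat and u :: "complex vec" and G :: "mpoly set"
  assumes "m \<ge> 4"
    and "u \<in> carrier_vec m"
    and "\<forall>i<m. \<forall>j<m. i \<noteq> j \<longrightarrow> u $ i \<noteq> u $ j"
    and "reduced_groebner_basis (set (L_vars m) \<union> set (V_vars m))
           (product_less (L_vars m) (V_vars m)) (indeterminate_translation_ideal m) G"
  shows "groebner_basis (set (L_vars m)) (grevlex_less (L_vars m))
           (translation_ideal m u) (specialize u ` G)"
  unfolding translation_ideal_def
proof (rule groebner_basis_specialize[OF generators_polys])
  show "specialize u ` translation_generators m (\<lambda>j. Var (V j)) \<subseteq>
      Idl\<^bsub>poly_ring (set (L_vars m))\<^esub> translation_generators m (\<lambda>j. Const (u $ j))"
    using specialize_generators idl_superset[OF generators_polys(2)] by blast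
  show "groebner_basis (set (L_vars m) \<union> set (V_vars m)) (product_less (L_vars m) (V_vars m))
      (Idl\<^bsub>poly_ring (set (L_vars m) \<union> set (V_vars m))\<^esub> translation_generators m (\<lambda>j. Var (V j))) G"
    using assms(4) unfolding reduced_groebner_basis_def indeterminate_translation_ideal_def by blast
  show "\<exists>h t. h \<in> Idl\<^bsub>poly_ring (set (L_vars m) \<union> set (V_vars m))\<^esub> translation_generators m (\<lambda>j. Var (V j)) \<and>
      (\<forall>s\<in>keys h. L_le m s t) \<and> lookup (specialize u h) t \<noteq> 0 \<and>
      monomial_dvd t (leading_monomial (grevlex_less (L_vars m)) f)"
    if "f \<in> Idl\<^bsub>poly_ring (set (L_vars m))\<^esub> translation_generators m (\<lambda>j. Const (u $ j))" "f \<noteq> 0" for f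
    using leading_monomial_lift[OF assms(3)] that
    unfolding translation_ideal_def indeterminate_translation_ideal_def by blast
qed

end
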